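(* Let $G=(V,E)$ be a finite simple graph, let $u\in[0,1]$ and let $\theta>0$. Then for every $t\ge0$, $$D_{\theta,u}(t)=\mathbb E^G_{\theta,t,u}\left[(1+\theta u)J_++(1+\theta(1-u))J_--|E|\right],$$ where $$D_{\theta,u}(t)=\begin{cases}\dfrac{\mathrm d}{\mathrm dt}\,\mathbb E^G_{1,t,u}[\lambda(\omega)],&\theta=1,\\[1ex]\dfrac{\theta}{\theta-1}\,\dfrac{\mathrm d}{\mathrm dt}\log Z_G(\theta,t,u),&\theta\ne1.\end{cases}$$
   Context: Derivatives in $t$ at $t=0$ are right derivatives. Random loop model. Let $G=(V,E)$ be a finite simple graph, and $S^1=\mathbb R/\mathbb Z$. For $t\ge0$ and $u\in[0,1]$, let $\omega=(\omega_e)_{e\in E}$ be independent marked Poisson point processes on $S^1\times\{\times,\mid\}$ with intensity measure $t\,\mathrm ds\otimes(u\,\delta_\times+(1-u)\,\delta_\mid)$; the law of $\omega$ is $\rho^G_{t,u}$. A point $(s,\times)\in\omega_e$ is a cross, and a point $(s,\mid)\in\omega_e$ a bar, on the edge $e$ at time $s$. Almost surely there are finitely many marks, at distinct times. Loops: a particle moves in $G\times S^1\times\{-1,+1\}$, the third coordinate being its vertical direction. Between marks it moves vertically (in the $S^1$ coordinate) at unit speed in its current direction; when at vertex $x$ it meets a mark on an edge $\{x,y\}$, it jumps instantaneously from $x$ to $y$, keeping its direction if the mark is a cross and reversing it if the mark is a bar. All trajectories are closed; the resulting closed trajectories, regarded as (unoriented) subsets of $V\times S^1$, are the loops. $\mathcal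 L(\omega)$ is the set of loops and $\lambda(\omega)=|\mathcal L(\omega)|$. For $\theta>0$, the weighted measure is $\mathbb P^G_{\theta,t,u}(\mathrm d\omega)=Z_G(\theta,t,u)^{-1}\theta^{\lambda(\omega)}\rho^G_{t,u}(\mathrm d\omega)$ with $Z_G(\theta,t,u)=\int\theta^{\lambda(\omega)}\rho^G_{t,u}(\mathrm d\omega)$, and $\mathbb E^G_{\theta,t,u}$ is its expectation. Let $T(\omega)\subset S^1$ be the (finite) set of times at which $\omega$ has a mark; times in $S^1\setminus T(\omega)$ are regular. At a regular time $s$, when a loop is traversed it passes through each of its points $(x,s)$ with a vertical direction in $\{-1,+1\}$ (its local vertical orientation; reversing the traversal flips all of these simultaneously, so equality or oppositeness at two points of the same loop is well defined). For $e=\{x,y\}\in E$ and regular $s$, $I_+(\omega;e,s)$ (resp. $I_-(\omega;e,s)$) is the indicator that $(x,s)$ and $(y,s)$ belong to the same loop with the same (resp. opposite) local vertical orientations; at $s\in T(\omega)$ both are $0$. Put $J_\pm(\omega)=\sum_{e\in E}\int_{S^1}I_\pm(\omega;e,s)\,\mathrm ds$. *)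

theory Defs
  imports "HOL-Probability.Probability"
begin

section \<open>Poisson point processes\<close>

text \<open>
  Finite configurations of points in the space of a measure, with the sigma-algebra generated by
  the counting maps. Configurations are sets, so only simple point processes are covered; a Poisson
  process with an atomless intensity is almost surely simple.
\<close>

definition configurations :: "'a measure \<Rightarrow> 'a set measure" where
  "configurations \<mu> =
     sigma {\<eta>. finite \<eta> \<and> \<eta> \<subseteq> space \<mu>}
       {{\<eta>. finite \<eta> \<and> \<eta> \<subseteq> space \<mu> \<and> card (\<eta> \<inter> B) = k} | B k. B \<in> sets \<mu>}"

text \<open>
  The probability measure \<open>P\<close> is the law of a Poisson point process with finite intensity
  measure \<open>\<mu>\<close>. The Poisson weights are written out because sets of intensity 0 must be allowed.
\<close>

definition poisson_process_law :: "'a measure \<Rightarrow> 'a set measure \<Rightarrow> bool" where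
  "poisson_process_law \<mu> P \<longleftrightarrow>
     finite_measure \<mu> \<and> prob_space P \<and> sets P = sets (configurations \<mu>) \<and>
     (\<forall>B \<in> sets \<mu>. \<forall>k. measure P {\<eta> \<in> space P. card (\<eta> \<inter> B) = k} =
        measure \<mu> B ^ k / fact k * exp (- measure \<mu> B)) \<and>
     (\<forall>(I :: nat set) B. finite I \<and> disjoint_family_on B I \<and> (\<forall>i\<in>I. B i \<in> sets \<mu>) \<longrightarrow>
        prob_space.indep_vars P (\<lambda>_. count_space UNIV) (\<lambda>i \<eta>. card (\<eta> \<inter> B i)) I)"


section \<open>Marks and configurations\<close>

datatype mark = Cross | Bar

text \<open>
  The circle \<open>\<real>/\<int>\<close> is represented by its fundamental domain \<open>[0,1)\<close>; a real time is reduced to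
  the circle by \<^const>\<open>frac\<close>.
\<close>

definition circle :: "real measure" where
  "circle = restrict_space lborel {0..<1}"

definition mark_intensity :: "real \<Rightarrow> real \<Rightarrow> (real \<times> mark) measure" where
  "mark_intensity t u =
     scale_measure (ennreal t) circle \<Otimes>\<^sub>M
     point_measure UNIV (\<lambda>m. case m of Cross \<Rightarrow> ennreal u | Bar \<Rightarrow> ennreal (1 - u))"

text \<open>An edge is a two-element set of vertices; \<open>\<omega> e\<close> is the set of marks on the edge \<open>e\<close>.\<close>

type_synonym 'v config = "'v set \<Rightarrow> (real \<times> mark) set"

definition mark_times :: "'v set set \<Rightarrow> 'v config \<Rightarrow> real set" where
  "mark_times E \<omega> = {s. \<exists>e\<in>E. \<exists>m. (s, m) \<in> \<omega> e}"

definition distinct_times :: "'v set set \<Rightarrow> 'v config \<Rightarrow> bool" where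
  "distinct_times E \<omega> \<longleftrightarrow>
     (\<forall>e\<in>E. \<forall>e'\<in>E. \<forall>s m m'. (s, m) \<in> \<omega> e \<and> (s, m') \<in> \<omega> e' \<longrightarrow> e = e' \<and> m = m')"

text \<open>
  The joint law of independent mark processes with common law \<open>P\<close>, one on each edge. The null event
  on which two marks are simultaneous, where the motion of the particle would be ambiguous, is
  removed from the sample space.
\<close>

definition config_law :: "'v set set \<Rightarrow> (real \<times> mark) set measure \<Rightarrow> 'v config measure" where
  "config_law E P = restrict_space (Pi\<^sub>M E (\<lambda>_. P)) {\<omega>. distinct_times E \<omega>}"


section \<open>Loops\<close>

text \<open>
  A state \<open>(x, s, d)\<close> is a particle at \<open>(x, s)\<close> about to move vertically in direction \<open>d\<close>, where
  \<open>d\<close> is 1 or -1; if there is a mark at \<open>(x, s)\<close>, the particle has already jumped.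
\<close>

type_synonym 'v state = "'v \<times> real \<times> real"

definition states :: "'v set \<Rightarrow> 'v state set" where
  "states V = V \<times> {0..<1} \<times> {1, -1}"

definition unobstructed ::
  "'v set set \<Rightarrow> 'v config \<Rightarrow> 'v \<Rightarrow> real \<Rightarrow> real \<Rightarrow> real \<Rightarrow> bool" where
  "unobstructed E \<omega> x s d r \<longleftrightarrow>
     (\<forall>q e m. 0 < q \<and> q < r \<and> e \<in> E \<and> x \<in> e \<longrightarrow> (frac (s + d * q), m) \<notin> \<omega> e)"

fun turn :: "mark \<Rightarrow> real \<Rightarrow> real" where
  "turn Cross d = d"
| "turn Bar d = - d"

text \<open>Vertical motion up to the next mark met, followed by the jump across that mark.\<close>

inductive jump :: "'v set set \<Rightarrow> 'v config \<Rightarrow> 'v state \<Rightarrow> 'v state \<Rightarrow> bool"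
  for E :: "'v set set" and \<omega> :: "'v config" where
  "\<lbrakk>0 < r; unobstructed E \<omega> x s d r; {x, y} \<in> E; (frac (s + d * r), m) \<in> \<omega> {x, y}\<rbrakk>
   \<Longrightarrow> jump E \<omega> (x, s, d) (y, frac (s + d * r), turn m d)"

text \<open>
  The trajectory started in the state \<open>z\<close> passes through the point \<open>(x, s')\<close> in direction \<open>d\<close>.
  Vertical segments are closed: at a mark, both the point from which the particle jumps
  and the point to which it jumps are passed. Hence a trajectory and its reversal pass
  through the same points.
\<close>

definition passes :: "'v set set \<Rightarrow> 'v config \<Rightarrow> 'v state \<Rightarrow> 'v \<Rightarrow> real \<Rightarrow> real \<Rightarrow> bool" where
  "passes E \<omega> z x s' d \<longleftrightarrow>
     (\<exists>s r. (jump E \<omega>)\<^sup>*\<^sup>* z (x, s, d) \<and> 0 \<le> r \<and> unobstructed E \<omega> x s d r \<and>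
            s' = frac (s + d * r))"

definition loop_of :: "'v set set \<Rightarrow> 'v config \<Rightarrow> 'v state \<Rightarrow> ('v \<times> real) set" where
  "loop_of E \<omega> z = {(x, s). \<exists>d. passes E \<omega> z x s d}"

definition loops :: "'v set \<Rightarrow> 'v set set \<Rightarrow> 'v config \<Rightarrow> ('v \<times> real) set set" where
  "loops V E \<omega> = loop_of E \<omega> ` states V"

definition loop_number :: "'v set \<Rightarrow> 'v set set \<Rightarrow> 'v config \<Rightarrow> nat" where
  "loop_number V E \<omega> = card (loops V E \<omega>)"

text \<open>
  In \<open>I_plus\<close> and \<open>I_minus\<close>, the state \<open>z\<close> selects a loop together with one of its two
  traversals.
\<close>

definition I_plus :: "'v set \<Rightarrow> 'v set set \<Rightarrow> 'v config \<Rightarrow> 'v set \<Rightarrow> real \<Rightarrow> real" where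
  "I_plus V E \<omega> e s = of_bool (s \<notin> mark_times E \<omega> \<and>
     (\<exists>x y d. e = {x, y} \<and> x \<noteq> y \<and>
        (\<exists>z \<in> states V. passes E \<omega> z x s d \<and> passes E \<omega> z y s d)))"

definition I_minus :: "'v set \<Rightarrow> 'v set set \<Rightarrow> 'v config \<Rightarrow> 'v set \<Rightarrow> real \<Rightarrow> real" where
  "I_minus V E \<omega> e s = of_bool (s \<notin> mark_times E \<omega> \<and>
     (\<exists>x y d. e = {x, y} \<and> x \<noteq> y \<and>
        (\<exists>z \<in> states V. passes E \<omega> z x s d \<and> passes E \<omega> z y s (- d))))"

definition J_plus :: "'v set \<Rightarrow> 'v set set \<Rightarrow> 'v config \<Rightarrow> real" where
  "J_plus V E \<omega> = (\<Sum>e\<in>E. LINT s|circle. I_plus V E \<omega> e s)"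

definition J_minus :: "'v set \<Rightarrow> 'v set set \<Rightarrow> 'v config \<Rightarrow> real" where
  "J_minus V E \<omega> = (\<Sum>e\<in>E. LINT s|circle. I_minus V E \<omega> e s)"


section \<open>The weighted measure\<close>

text \<open>
  The parameters \<open>t\<close> and \<open>u\<close> enter only through the law \<open>P\<close> of the marks on a single edge.
\<close>

definition partition_function ::
  "'v set \<Rightarrow> 'v set set \<Rightarrow> (real \<times> mark) set measure \<Rightarrow> real \<Rightarrow> real" where
  "partition_function V E P \<theta> = (LINT \<omega>|config_law E P. \<theta> ^ loop_number V E \<omega>)"

definition weighted_law ::
  "'v set \<Rightarrow> 'v set set \<Rightarrow> (real \<times> mark) set measure \<Rightarrow> real \<Rightarrow> 'v config measure" where
  "weighted_law V E P \<theta> =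
     density (config_law E P)
       (\<lambda>\<omega>. ennreal (\<theta> ^ loop_number V E \<omega> / partition_function V E P \<theta>))"

definition weighted_expectation ::
  "'v set \<Rightarrow> 'v set set \<Rightarrow> (real \<times> mark) set measure \<Rightarrow> real \<Rightarrow> ('v config \<Rightarrow> real) \<Rightarrow> real" where
  "weighted_expectation V E P \<theta> f = (LINT \<omega>|weighted_law V E P \<theta>. f \<omega>)"

end

theory Submission
  imports Defs
begin

text \<open>
  Let \<open>\<lambda>\<close> be the loop number. Adding one mark at a regular time \<open>s\<close> on an edge \<open>{a, b}\<close> changes \<open>\<lambda>\<close> by
  at most one. If \<open>(a, s)\<close> and \<open>(b, s)\<close> lie in different loops, a mark of either type merges the two. If
  they lie in one loop with equal orientations, a cross splits it and a bar keeps \<open>\<lambda>\<close>; with opposite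
  orientations a bar splits it and a cross keeps \<open>\<lambda>\<close> (\<open>loop_number_add_mark_cases\<close>). Suppose that two
  functions \<open>g\<close> and \<open>\<psi>\<close> on the natural numbers satisfy \<open>g (k + 1) - g k = \<psi> (k + 1) = \<theta> \<psi> k\<close>. A new mark
  that is a cross with probability \<open>u\<close> and a bar with probability \<open>1 - u\<close> then changes \<open>g \<lambda>\<close> on average by
  \<open>\<psi> \<lambda> ((1 + \<theta> u) I\<^sub>+ + (1 + \<theta> (1 - u)) I\<^sub>- - 1)\<close>. There are two such pairs of interest:
  \<open>g k = \<theta>\<^sup>k\<close> with \<open>\<psi> k = \<theta>\<^sup>k (\<theta> - 1) / \<theta>\<close>, and, for \<open>\<theta> = 1\<close>, \<open>g k = k\<close> with \<open>\<psi> k = 1\<close>.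
  
  The derivative of a Poisson expectation in the intensity is the expected effect of one additional point
  (\<open>derivative_of_poisson_expectation\<close>). Hence the derivative of the expectation of \<open>g \<lambda>\<close> is the
  expectation of \<open>\<psi> \<lambda>\<close> times the observable in the theorem (\<open>derivative_of_loop_functional\<close>), and
  dividing by the partition function gives the claim.
  
  The change of \<open>\<lambda>\<close> is a statement about graphs. Cut the circle at a finite set \<open>T\<close> of times
  that contains all mark times. The half-edges \<open>(x, s, d)\<close>, where \<open>s \<in> T\<close> and the vertical segment leaves
  \<open>(x, s)\<close> in direction \<open>d\<close>, carry two perfect matchings: one pairs the two ends of a segment, the other
  pairs the half-edges between which a particle passes at a time of \<open>T\<close>. The loops are the
  components of the union of these matchings, and a new mark replaces two pairs of the second
  matching by two others on the same four half-edges. Following the component of one of the four up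
  to the first return to them decides what happens (\<open>rewire_linked\<close>).
  
  For the derivative, the joint law of the mark sets is identified with the law of a Poisson
  number of independent points, because both give the same probabilities to void events
  (\<open>graph_law_eq_mixture\<close>). An expectation thereby becomes \<open>exp (- r)\<close> times a power series in \<open>r\<close>, whose
  coefficient with index \<open>n + 1\<close> is that of index \<open>n\<close> for the function averaged over one inserted point.
  
  All this needs the loop number to be measurable. It is invariant under order-preserving changes of
  the mark times, so moving the times to a fine dyadic grid does not change it, and
  on the grid it depends only on which of finitely many cells are occupied.
\<close>

section \<open>Pairs of matchings and their components\<close>

text \<open>
  A perfect matching of \<open>D\<close>, as the involution that exchanges partners.
\<close>

definition matching :: "'a set \<Rightarrow> ('a \<Rightarrow> 'a) \<Rightarrow> bool" where
  "matching D \<beta> \<longleftrightarrow> (\<forall>x\<in>D. \<beta> x \<in> D \<and> \<beta> (\<beta> x) = x \<and> \<beta> x \<noteq> x)"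

definition linked :: "('a \<Rightarrow> 'a) \<Rightarrow> ('a \<Rightarrow> 'a) \<Rightarrow> 'a \<Rightarrow> 'a \<Rightarrow> bool" where
  "linked \<alpha> \<beta> = (\<lambda>x y. y = \<alpha> x \<or> y = \<beta> x)\<^sup>*\<^sup>*"

definition component_number :: "'a set \<Rightarrow> ('a \<Rightarrow> 'a) \<Rightarrow> ('a \<Rightarrow> 'a) \<Rightarrow> nat" where
  "component_number D \<alpha> \<beta> = card ((\<lambda>x. {y. linked \<alpha> \<beta> x y}) ` D)"

text \<open>
  Using the two matchings alternately moves along a component in one of its two directions.
\<close>

definition follow :: "('a \<Rightarrow> 'a) \<Rightarrow> ('a \<Rightarrow> 'a) \<Rightarrow> 'a \<Rightarrow> 'a" where
  "follow \<alpha> \<beta> x = \<beta> (\<alpha> x)"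

definition in_orbit :: "('a \<Rightarrow> 'a) \<Rightarrow> 'a \<Rightarrow> 'a \<Rightarrow> bool" where
  "in_orbit f x y \<longleftrightarrow> (\<exists>k. y = (f ^^ k) x)"

lemma matchingD:
  assumes "matching D \<beta>" "x \<in> D"
  shows "\<beta> x \<in> D" "\<beta> (\<beta> x) = x" "\<beta> x \<noteq> x"
  using assms unfolding matching_def by auto

lemma linked_refl: "linked \<alpha> \<beta> x x"
  by (simp add: linked_def)

lemma linked_trans: "linked \<alpha> \<beta> x y \<Longrightarrow> linked \<alpha> \<beta> y z \<Longrightarrow> linked \<alpha> \<beta> x z"
  by (simp add: linked_def)

lemma linked_fst: "linked \<alpha> \<beta> x (\<alpha> x)" and linked_snd: "linked \<alpha> \<beta> x (\<beta> x)"
  by (auto simp: linked_def)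

lemma in_orbit_refl: "in_orbit f x x"
  unfolding in_orbit_def by (metis funpow_0)

lemma in_orbit_step: "in_orbit f x y \<Longrightarrow> in_orbit f x (f y)"
  unfolding in_orbit_def by (metis comp_apply funpow.simps(2))

lemma in_orbit_trans: "in_orbit f x y \<Longrightarrow> in_orbit f y z \<Longrightarrow> in_orbit f x z"
  unfolding in_orbit_def by (metis comp_apply funpow_add)

lemma in_orbit_imp_linked: "in_orbit (follow \<alpha> \<beta>) x y \<Longrightarrow> linked \<alpha> \<beta> x y"
proof -
  have "linked \<alpha> \<beta> x (((follow \<alpha> \<beta>) ^^ k) x)" for k
  proof (induction k)
    case (Suc k)
    then show ?case
      using linked_trans[OF linked_trans[OF Suc linked_fst] linked_snd] by (simp add: follow_def)
  qed (simp add: linked_refl)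
  then show "in_orbit (follow \<alpha> \<beta>) x y \<Longrightarrow> linked \<alpha> \<beta> x y"
    by (auto simp: in_orbit_def)
qed

text \<open>
  Relative to \<open>D\<close>, because the matchings are involutions only there.
\<close>

definition equivalence_on :: "'a set \<Rightarrow> ('a \<Rightarrow> 'a \<Rightarrow> bool) \<Rightarrow> bool" where
  "equivalence_on D r \<longleftrightarrow>
     (\<forall>x\<in>D. r x x) \<and> (\<forall>x\<in>D. \<forall>y. r x y \<longrightarrow> y \<in> D) \<and> (\<forall>x\<in>D. \<forall>y. r x y \<longrightarrow> r y x) \<and>
     (\<forall>x\<in>D. \<forall>y z. r x y \<longrightarrow> r y z \<longrightarrow> r x z)"

lemma equivalence_onI:
  assumes "\<And>x. x \<in> D \<Longrightarrow> r x x" "\<And>x y. x \<in> D \<Longrightarrow> r x y \<Longrightarrow> y \<in> D"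
    "\<And>x y. x \<in> D \<Longrightarrow> r x y \<Longrightarrow> r y x" "\<And>x y z. x \<in> D \<Longrightarrow> r x y \<Longrightarrow> r y z \<Longrightarrow> r x z"
  shows "equivalence_on D r"
  unfolding equivalence_on_def
  apply (intro conjI ballI allI impI)
     apply (erule assms(1))
    apply (erule (1) assms(2))
   apply (erule (1) assms(3))
  apply (erule (2) assms(4))
  done

lemma equivalence_onD:
  assumes "equivalence_on D r" "x \<in> D"
  shows "r x x" "r x y \<Longrightarrow> y \<in> D" "r x y \<Longrightarrow> r y x" "r x y \<Longrightarrow> r y z \<Longrightarrow> r x z"
  using assms unfolding equivalence_on_def by blast+

lemma class_eq_iff:
  assumes r: "equivalence_on D r" and x: "x \<in> D" and y: "y \<in> D"
  shows "Collect (r x) = Collect (r y) \<longleftrightarrow> r x y"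
proof
  assume "Collect (r x) = Collect (r y)"
  then show "r x y" using equivalence_onD(1)[OF r y] by blast
next
  assume xy: "r x y"
  note yx = equivalence_onD(3)[OF r x xy]
  show "Collect (r x) = Collect (r y)"
    using equivalence_onD(4)[OF r y yx] equivalence_onD(4)[OF r x xy] by blast
qed

text \<open>
  If \<open>r\<close> is an equivalence, this is the finest coarser one that identifies \<open>a\<close> and \<open>b\<close>.
\<close>

definition joined :: "('a \<Rightarrow> 'a \<Rightarrow> bool) \<Rightarrow> 'a \<Rightarrow> 'a \<Rightarrow> 'a \<Rightarrow> 'a \<Rightarrow> bool" where
  "joined r a b x y \<longleftrightarrow> r x y \<or> (r x a \<and> r b y) \<or> (r x b \<and> r a y)"

text \<open>
  The classes of \<open>a\<close> and \<open>b\<close> are replaced by their union.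
\<close>

lemma card_classes_joined:
  assumes D: "finite D" and r: "equivalence_on D r" and a: "a \<in> D" and b: "b \<in> D"
  shows "card ((\<lambda>x. Collect (joined r a b x)) ` D) + of_bool (\<not> r a b) = card ((\<lambda>x. Collect (r x)) ` D)"
proof -
  let ?j = "joined r a b"
  let ?c = "\<lambda>x. Collect (r x)"
  let ?A = "?c a" and ?B = "?c b"
  have *: "r x a \<longleftrightarrow> ?c x = ?A" "r x b \<longleftrightarrow> ?c x = ?B" if "x \<in> D" for x
    using class_eq_iff[OF r that a] class_eq_iff[OF r that b] by auto
  have cj: "Collect (?j x) = (if ?c x = ?A \<or> ?c x = ?B then ?A \<union> ?B else ?c x)" if "x \<in> D" for x
  proof -
    have "Collect (?j x) = ?c x \<union> {y. r x a \<and> r b y} \<union> {y. r x b \<and> r a y}"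
      unfolding joined_def by blast
    then show ?thesis unfolding *[OF that] by auto
  qed
  have img: "(\<lambda>x. Collect (?j x)) ` D = insert (?A \<union> ?B) (?c ` D - {?A, ?B})"
  proof -
    have "(\<lambda>x. Collect (?j x)) ` D = (\<lambda>A. if A = ?A \<or> A = ?B then ?A \<union> ?B else A) ` (?c ` D)"
      unfolding image_image by (rule image_cong[OF refl]) (rule cj)
    also have "\<dots> = insert (?A \<union> ?B) (?c ` D - {?A, ?B})"
    proof -
      have *: "(\<lambda>A. if A = x \<or> A = y then z else A) ` X = insert z (X - {x, y})"
        if "x \<in> X" for X and x y z :: "'a set"
        using that by auto
      show ?thesis by (rule *) (use a in simp)
    qed
    finally show ?thesis .
  qed
  show ?thesis
  proof (cases "r a b")
    case True
    then have "?A = ?B" using class_eq_iff[OF r a b] by blast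
    moreover have "?B \<in> ?c ` D" using b by blast
    ultimately show ?thesis using True unfolding img by (simp add: insert_absorb)
  next
    case False
    then have ne: "?A \<noteq> ?B" using class_eq_iff[OF r a b] by blast
    have notin: "?A \<union> ?B \<notin> ?c ` D"
    proof
      assume "?A \<union> ?B \<in> ?c ` D"
      then obtain x where x: "x \<in> D" "?c x = ?A \<union> ?B" by auto
      have "r x a" "r x b"
        using x(2) equivalence_onD(1)[OF r a] equivalence_onD(1)[OF r b] by auto
      then have "?A = ?B" using *[OF x(1)] by simp
      then show False using ne by simp
    qed
    have "card (?c ` D - {?A, ?B}) = card (?c ` D) - card {?A, ?B}"
      by (rule card_Diff_subset) (use a b in auto)
    moreover have "card {?A, ?B} \<le> card (?c ` D)"
      by (rule card_mono) (use a b D in auto)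
    ultimately show ?thesis using D notin False ne unfolding img by simp
  qed
qed

text \<open>
  The graph in which every \<open>x\<close> is adjacent to \<open>\<alpha> x\<close> and \<open>\<beta> x\<close> is a disjoint union of cycles. A cycle
  carries two orbits of \<open>follow \<alpha> \<beta>\<close>, one for each direction.
\<close>

locale two_matchings =
  fixes D :: "'a set" and \<alpha> \<beta> :: "'a \<Rightarrow> 'a"
  assumes finite_D: "finite D" and \<alpha>: "matching D \<alpha>" and \<beta>: "matching D \<beta>"
begin

abbreviation step :: "'a \<Rightarrow> 'a" where "step \<equiv> follow \<alpha> \<beta>"

lemmas \<alpha>D [simp] = matchingD[OF \<alpha>] and \<beta>D [simp] = matchingD[OF \<beta>]

lemma linked_in_D: "linked \<alpha> \<beta> x y \<Longrightarrow> x \<in> D \<Longrightarrow> y \<in> D"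
  unfolding linked_def
  by (induction rule: rtranclp_induct) (auto dest: matchingD[OF \<alpha>] matchingD[OF \<beta>])

lemma linked_sym: "linked \<alpha> \<beta> x y \<Longrightarrow> x \<in> D \<Longrightarrow> linked \<alpha> \<beta> y x"
  unfolding linked_def
proof (induction rule: rtranclp_induct)
  case (step y z)
  have "y \<in> D" using linked_in_D step unfolding linked_def by blast
  then have "y = \<alpha> z \<or> y = \<beta> z" using step matchingD[OF \<alpha>] matchingD[OF \<beta>] by auto
  then have "(\<lambda>x y. y = \<alpha> x \<or> y = \<beta> x) z y" .
  then show ?case using step.IH[OF step.prems] by (rule converse_rtranclp_into_rtranclp)
qed simp

lemma linked_equivalence: "equivalence_on D (linked \<alpha> \<beta>)"
proof (rule equivalence_onI)
  show "linked \<alpha> \<beta> x x" for x by (rule linked_refl)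
  show "y \<in> D" if "x \<in> D" "linked \<alpha> \<beta> x y" for x y by (rule linked_in_D[OF that(2,1)])
  show "linked \<alpha> \<beta> y x" if "x \<in> D" "linked \<alpha> \<beta> x y" for x y by (rule linked_sym[OF that(2,1)])
  show "linked \<alpha> \<beta> x z" if "linked \<alpha> \<beta> x y" "linked \<alpha> \<beta> y z" for x y z by (rule linked_trans[OF that])
qed

lemma step_in_D: "x \<in> D \<Longrightarrow> (step ^^ k) x \<in> D"
  by (induction k) (auto simp: follow_def)

lemma inj_step: "inj_on step D"
proof (rule inj_onI)
  fix x y assume xy: "x \<in> D" "y \<in> D" "step x = step y"
  have "x = \<alpha> (\<beta> (step x))" using xy(1) by (simp add: follow_def)
  also have "\<dots> = \<alpha> (\<beta> (step y))" by (simp only: xy(3))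
  also have "\<dots> = y" using xy(2) by (simp add: follow_def)
  finally show "x = y" .
qed

lemma step_period:
  assumes x: "x \<in> D"
  obtains k where "0 < k" "(step ^^ k) x = x"
proof -
  have "\<not> inj (\<lambda>k. (step ^^ k) x)"
  proof
    assume "inj (\<lambda>k. (step ^^ k) x)"
    then have "infinite (range (\<lambda>k. (step ^^ k) x))" using finite_imageD infinite_UNIV_nat by blast
    moreover have "range (\<lambda>k. (step ^^ k) x) \<subseteq> D" using step_in_D[OF x] by blast
    ultimately show False using finite_D finite_subset by blast
  qed
  then obtain i j where "i \<noteq> j" "(step ^^ i) x = (step ^^ j) x" unfolding inj_def by blast
  then obtain i j where ij: "i < j" "(step ^^ i) x = (step ^^ j) x"
    by (cases i j rule: linorder_cases) auto
  have cancel: "(step ^^ i) y = (step ^^ i) z \<Longrightarrow> y = z" if "y \<in> D" "z \<in> D" for i y z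
  proof (induction i)
    case (Suc i)
    have "step ((step ^^ i) y) = step ((step ^^ i) z)" using Suc.prems by simp
    then have "(step ^^ i) y = (step ^^ i) z"
      by (rule inj_onD[OF inj_step _ step_in_D[OF that(1)] step_in_D[OF that(2)]])
    then show ?case by (rule Suc.IH)
  qed simp
  have "(step ^^ i) ((step ^^ (j - i)) x) = (step ^^ i) x"
    using ij by (metis add_diff_inverse_nat comp_apply funpow_add not_less_iff_gr_or_eq)
  then have "(step ^^ (j - i)) x = x"
    by (rule cancel[OF step_in_D[OF x] x])
  then show ?thesis using that[of "j - i"] ij by simp
qed

lemma in_orbit_sym:
  assumes "x \<in> D" "in_orbit step x y"
  shows "in_orbit step y x"
proof -
  obtain k where y: "y = (step ^^ k) x" using assms unfolding in_orbit_def by auto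
  obtain m where m: "0 < m" "(step ^^ m) x = x" using step_period[OF assms(1)] .
  have period: "(step ^^ (m * n)) x = x" for n
    using funpow_mod_eq[OF m(2), of "m * n"] by simp
  have "k \<le> m * k" using m by simp
  then have "(step ^^ (m * k - k)) y = x"
    unfolding y using period[of k] by (metis comp_apply funpow_add le_add_diff_inverse2)
  then show ?thesis unfolding in_orbit_def by metis
qed

text \<open>
  Either matching conjugates the step into its inverse, so it maps orbits to orbits.
\<close>

lemma in_orbit_reversal:
  assumes x: "x \<in> D" and xy: "in_orbit step x y"
  shows "in_orbit step (\<alpha> x) (\<alpha> y)" "in_orbit step (\<beta> x) (\<beta> y)"
proof -
  have one: "in_orbit step (\<alpha> z) (\<alpha> (step z))" if "z \<in> D" for z
  proof (rule in_orbit_sym)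
    show "\<alpha> (step z) \<in> D" using that by (simp add: follow_def)
    have "step (\<alpha> (step z)) = \<alpha> z" using that by (simp add: follow_def)
    then show "in_orbit step (\<alpha> (step z)) (\<alpha> z)" using in_orbit_step[OF in_orbit_refl] by metis
  qed
  obtain k where k: "y = (step ^^ k) x" using xy unfolding in_orbit_def by blast
  have "in_orbit step (\<alpha> x) (\<alpha> ((step ^^ k) x))"
  proof (induction k)
    case (Suc k)
    then show ?case using in_orbit_trans[OF Suc one[OF step_in_D[OF x]]] by simp
  qed (simp add: in_orbit_refl)
  then show a: "in_orbit step (\<alpha> x) (\<alpha> y)" unfolding k .
  have y: "y \<in> D" unfolding k by (rule step_in_D[OF x])
  have "step (\<alpha> x) = \<beta> x" "step (\<alpha> y) = \<beta> y" using x y by (simp_all add: follow_def)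
  then have xb: "in_orbit step (\<alpha> x) (\<beta> x)" and yb: "in_orbit step (\<alpha> y) (\<beta> y)"
    using in_orbit_step[OF in_orbit_refl] by metis+
  have "in_orbit step (\<beta> x) (\<alpha> x)" by (rule in_orbit_sym[OF \<alpha>D(1)[OF x] xb])
  then show "in_orbit step (\<beta> x) (\<beta> y)" by (rule in_orbit_trans[OF in_orbit_trans[OF _ a] yb])
qed

text \<open>
  A path of the step from \<open>x\<close> to \<open>\<beta> x\<close> is its own reversal, so its middle is a fixed point of \<open>\<alpha>\<close> or of
  \<open>\<beta>\<close>. The induction removes one step at each end of the path.
\<close>

lemma reversal_notin_orbit: "x \<in> D \<Longrightarrow> (step ^^ k) x \<noteq> \<beta> x"
proof (induction k arbitrary: x rule: less_induct)
  case (less k)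
  consider "k = 0" | "k = 1" | j where "k = Suc (Suc j)"
    by (metis One_nat_def not0_implies_Suc)
  then show ?case
  proof cases
    case 1
    then show ?thesis using matchingD(3)[OF \<beta> less.prems] by simp
  next
    case 2
    have "\<beta> (\<alpha> x) \<noteq> \<beta> x"
    proof
      assume *: "\<beta> (\<alpha> x) = \<beta> x"
      have "\<alpha> x = \<beta> (\<beta> (\<alpha> x))" using less.prems by simp
      also have "\<dots> = x" unfolding * using less.prems by simp
      finally show False using less.prems by simp
    qed
    then show ?thesis using 2 by (simp add: follow_def)
  next
    case 3
    let ?y = "step x"
    have y: "?y \<in> D" using step_in_D[OF less.prems, of 1] by simp
    have "(step ^^ k) x = step ((step ^^ j) ?y)"
      by (simp only: 3 funpow.simps(2) comp_apply funpow_swap1)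
    moreover have "(step ^^ j) ?y = \<beta> ?y" if *: "step ((step ^^ j) ?y) = \<beta> x"
    proof -
      let ?z = "(step ^^ j) ?y"
      have z: "?z \<in> D" by (rule step_in_D[OF y])
      have "?z = \<alpha> (\<beta> (step ?z))" using z by (simp add: follow_def)
      also have "\<dots> = \<alpha> x" unfolding * using less.prems by simp
      also have "\<dots> = \<beta> ?y" using less.prems by (simp add: follow_def)
      finally show ?thesis .
    qed
    ultimately show ?thesis using less.IH[OF _ y, of j] 3 by auto
  qed
qed

text \<open>
  A component is the union of an orbit and the same orbit run backwards.
\<close>

lemma linked_iff_orbit:
  assumes x: "x \<in> D" and y: "y \<in> D"
  shows "linked \<alpha> \<beta> x y \<longleftrightarrow> in_orbit step x y \<or> in_orbit step x (\<beta> y)"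
proof
  assume "linked \<alpha> \<beta> x y"
  then have "y \<in> D \<and> (in_orbit step x y \<or> in_orbit step x (\<beta> y))"
    unfolding linked_def
  proof (induction rule: rtranclp_induct)
    case base
    then show ?case using x in_orbit_refl by metis
  next
    case (step y z)
    then have y: "y \<in> D" by simp
    have z: "z \<in> D" using step.hyps(2) y matchingD(1)[OF \<alpha>] matchingD(1)[OF \<beta>] by auto
    have preceding: "in_orbit step x (\<alpha> w)" if "in_orbit step x (\<beta> w)" "w \<in> D" for w
    proof -
      have "\<beta> w = step (\<alpha> w)" using that(2) by (simp add: follow_def)
      then have "in_orbit step (\<alpha> w) (\<beta> w)" using in_orbit_step[OF in_orbit_refl] by metis
      then have "in_orbit step (\<beta> w) (\<alpha> w)" by (rule in_orbit_sym[OF \<alpha>D(1)[OF that(2)]])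
      then show ?thesis by (rule in_orbit_trans[OF that(1)])
    qed
    from step.IH consider "in_orbit (follow \<alpha> \<beta>) x y" | "in_orbit (follow \<alpha> \<beta>) x (\<beta> y)" by auto
    then show ?case
    proof cases
      case 1
      have "in_orbit (follow \<alpha> \<beta>) x (\<beta> (\<alpha> y))" using in_orbit_step[OF 1] by (simp add: follow_def)
      then show ?thesis using 1 step.hyps(2) z matchingD(2)[OF \<beta> y] by auto
    next
      case 2
      have "in_orbit (follow \<alpha> \<beta>) x (\<alpha> y)" using preceding[OF 2 y] .
      then show ?thesis using 2 step.hyps(2) z by auto
    qed
  qed
  then show "in_orbit step x y \<or> in_orbit step x (\<beta> y)" by simp
next
  assume *: "in_orbit step x y \<or> in_orbit step x (\<beta> y)"
  show "linked \<alpha> \<beta> x y"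
  proof (cases "in_orbit step x y")
    case False
    then have "linked \<alpha> \<beta> x (\<beta> y)" using * by (auto intro: in_orbit_imp_linked)
    from linked_trans[OF this linked_snd] show ?thesis using matchingD(2)[OF \<beta> y] by simp
  qed (simp add: in_orbit_imp_linked)
qed

end

lemma equivalence_on_joined:
  assumes r: "equivalence_on D r" and a: "a \<in> D" and b: "b \<in> D"
  shows "equivalence_on D (joined r a b)"
proof (rule equivalence_onI)
  note R = equivalence_onD[OF r]
  have trans: "r x z" if "x \<in> D" "r x y" "r y z" for x y z using R(4) that by blast
  have sym: "r y x" if "x \<in> D" "r x y" for x y using R(3) that by blast
  have cl: "y \<in> D" if "x \<in> D" "r x y" for x y using R(2) that by blast
  fix x y assume x: "x \<in> D" and xy: "joined r a b x y"
  show y: "y \<in> D" using xy cl[OF x] cl[OF a] cl[OF b] unfolding joined_def by blast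
  show "joined r a b y x" using xy sym[OF x] sym[OF a] sym[OF b] unfolding joined_def by blast
  show "joined r a b x z" if yz: "joined r a b y z" for z
    using xy unfolding joined_def
  proof (elim disjE conjE)
    assume "r x y" then show "r x z \<or> (r x a \<and> r b z) \<or> (r x b \<and> r a z)"
      using yz trans[OF x] unfolding joined_def by blast
  next
    assume *: "r x a" "r b y"
    then show "r x z \<or> (r x a \<and> r b z) \<or> (r x b \<and> r a z)"
      using yz trans[OF x] trans[OF a] trans[OF b] sym[OF b] unfolding joined_def by blast
  next
    assume *: "r x b" "r a y"
    then show "r x z \<or> (r x a \<and> r b z) \<or> (r x b \<and> r a z)"
      using yz trans[OF x] trans[OF a] trans[OF b] sym[OF a] unfolding joined_def by blast
  qed
qed (simp add: joined_def equivalence_onD(1)[OF r])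

text \<open>
  Once \<open>p\<close> and \<open>q\<close> are identified, the pairs \<open>{p, \<beta> p}, {q, \<beta> q}\<close> and the pairs
  \<open>{p, \<beta> q}, {q, \<beta> p}\<close> connect the same points.
\<close>

lemma joined_linked_rewire:
  assumes "two_matchings D \<alpha> \<beta>" "two_matchings D \<alpha> \<beta>'"
    and pq: "p \<in> D" "q \<in> D"
    and \<beta>': "\<beta>' p = \<beta> q" "\<beta>' q = \<beta> p"
    and eq: "\<And>x. x \<in> D \<Longrightarrow> x \<notin> {p, q, \<beta> p, \<beta> q} \<Longrightarrow> \<beta>' x = \<beta> x"
    and x: "x \<in> D" and l: "joined (linked \<alpha> \<beta>) p q x y"
  shows "joined (linked \<alpha> \<beta>') p q x y"
proof -
  interpret M: two_matchings D \<alpha> \<beta> by fact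
  interpret M': two_matchings D \<alpha> \<beta>' by fact
  let ?r = "linked \<alpha> \<beta>'"
  let ?j = "joined ?r p q"
  note J = equivalence_onD[OF equivalence_on_joined[OF M'.linked_equivalence pq]]
  have r_j: "?j a b" if "?r a b" for a b using that by (simp add: joined_def)
  have jp: "?j p (\<beta> p)" unfolding joined_def using linked_snd[of \<alpha> \<beta>' q] linked_refl \<beta>' by metis
  have jq: "?j q (\<beta> q)" unfolding joined_def using linked_snd[of \<alpha> \<beta>' p] linked_refl \<beta>' by metis
  have j_\<beta>: "?j a (\<beta> a)" if a: "a \<in> D" for a
  proof -
    consider "a = p" | "a = q" | "a = \<beta> p" | "a = \<beta> q" | "\<beta>' a = \<beta> a" using eq[OF a] by blast
    then show ?thesis
    proof cases
      case 3
      then show ?thesis using J(3)[OF pq(1) jp] matchingD(2)[OF M.\<beta> pq(1)] by simp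
    next
      case 4
      then show ?thesis using J(3)[OF pq(2) jq] matchingD(2)[OF M.\<beta> pq(2)] by simp
    next
      case 5
      then show ?thesis using r_j[OF linked_snd[of \<alpha> \<beta>' a]] by simp
    qed (use jp jq in simp_all)
  qed
  have L: "?j a b" if a: "a \<in> D" and ab: "linked \<alpha> \<beta> a b" for a b
    using ab unfolding linked_def[of \<alpha> \<beta>]
  proof (induction rule: rtranclp_induct)
    case base
    then show ?case using J(1)[OF a] .
  next
    case (step b c)
    have "?j b c"
      using step.hyps(2) j_\<beta>[OF J(2)[OF a step.IH]] r_j[OF linked_fst[of \<alpha> \<beta>' b]] by auto
    then show ?case by (rule J(4)[OF a step.IH])
  qed
  have jpq: "?j p q" "?j q p" unfolding joined_def using linked_refl by metis+
  show ?thesis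
    using l unfolding joined_def[of "linked \<alpha> \<beta>"]
  proof (elim disjE conjE)
    assume "linked \<alpha> \<beta> x y" then show ?thesis by (rule L[OF x])
  next
    assume "linked \<alpha> \<beta> x p" "linked \<alpha> \<beta> q y"
    then have "?j x p" "?j q y" using L x pq by auto
    then show ?thesis using J(4)[OF x] jpq(1) by blast
  next
    assume "linked \<alpha> \<beta> x q" "linked \<alpha> \<beta> p y"
    then have "?j x q" "?j p y" using L x pq by auto
    then show ?thesis using J(4)[OF x] jpq(2) by blast
  qed
qed

text \<open>
  Both sides count the classes of one common coarsening, in which \<open>p\<close> and \<open>q\<close> are identified.
\<close>

lemma component_number_rewire:
  assumes MM: "two_matchings D \<alpha> \<beta>" "two_matchings D \<alpha> \<beta>'"
    and pq: "p \<in> D" "q \<in> D"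
    and \<beta>': "\<beta>' p = \<beta> q" "\<beta>' q = \<beta> p"
    and eq: "\<And>x. x \<in> D \<Longrightarrow> x \<notin> {p, q, \<beta> p, \<beta> q} \<Longrightarrow> \<beta>' x = \<beta> x"
  shows "component_number D \<alpha> \<beta>' + of_bool (\<not> linked \<alpha> \<beta> p q)
           = component_number D \<alpha> \<beta> + of_bool (\<not> linked \<alpha> \<beta>' p q)"
proof -
  interpret M: two_matchings D \<alpha> \<beta> by fact
  interpret M': two_matchings D \<alpha> \<beta>' by fact
  note B = matchingD[OF M.\<beta>] and B' = matchingD[OF M'.\<beta>]
  have eq': "\<beta> x = \<beta>' x" if "x \<in> D" "x \<notin> {p, q, \<beta>' p, \<beta>' q}" for x
    using eq[of x] that unfolding \<beta>' by auto
  let ?j = "\<lambda>\<beta>. joined (linked \<alpha> \<beta>) p q"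
  have "Collect (?j \<beta>' x) = Collect (?j \<beta> x)" if "x \<in> D" for x
    using joined_linked_rewire[OF MM pq \<beta>' eq that]
      joined_linked_rewire[OF MM(2,1) pq \<beta>'(2,1)[symmetric] eq' that] by blast
  then have "(\<lambda>x. Collect (?j \<beta>' x)) ` D = (\<lambda>x. Collect (?j \<beta> x)) ` D"
    by (rule image_cong[OF refl])
  moreover note card_classes_joined[OF M.finite_D M.linked_equivalence pq]
    card_classes_joined[OF M.finite_D M'.linked_equivalence pq]
  ultimately show ?thesis unfolding component_number_def by simp
qed

text \<open>
  Follow the step from \<open>p\<close> until \<open>\<alpha>\<close> leads for the first time to one of \<open>p, q, \<beta> p, \<beta> q\<close>. Up to there the
  rewiring has no effect. The point \<open>p\<close> cannot be reached, by \<open>reversal_notin_orbit\<close>. If \<open>\<beta> p\<close> is reached,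
  the rewired step continues to \<open>q\<close>; if \<open>q\<close> is reached, it continues to \<open>\<beta> p\<close>, the new partner of
  \<open>q\<close>; in both cases \<open>p\<close> and \<open>q\<close> become linked. If \<open>\<beta> q\<close> is reached, the original step continues
  to \<open>q\<close>, whereas the rewired one closes up at \<open>p\<close> without having met \<open>q\<close>. This last case
  occurs exactly if \<open>q\<close> is in the original orbit of \<open>p\<close>.
\<close>

lemma rewire_linked:
  assumes MM: "two_matchings D \<alpha> \<beta>" "two_matchings D \<alpha> \<beta>'"
    and pq: "p \<in> D" "q \<in> D" "q \<noteq> p" "q \<noteq> \<beta> p"
    and \<beta>': "\<beta>' p = \<beta> q" "\<beta>' q = \<beta> p"
    and eq: "\<And>x. x \<in> D \<Longrightarrow> x \<notin> {p, q, \<beta> p, \<beta> q} \<Longrightarrow> \<beta>' x = \<beta> x"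
  shows "linked \<alpha> \<beta>' p q \<longleftrightarrow> \<not> in_orbit (follow \<alpha> \<beta>) p q"
proof -
  interpret M: two_matchings D \<alpha> \<beta> by fact
  interpret M': two_matchings D \<alpha> \<beta>' by fact
  note A = matchingD[OF M.\<alpha>] and B = matchingD[OF M.\<beta>] and B' = matchingD[OF M'.\<beta>]
  define f f' where "f = follow \<alpha> \<beta>" and "f' = follow \<alpha> \<beta>'"
  \<comment> \<open>the points at which the rewired step differs from the original one\<close>
  define H where "H = {\<alpha> p, \<alpha> q, \<alpha> (\<beta> p), \<alpha> (\<beta> q)}"
  have \<beta>'2: "\<beta>' (\<beta> q) = p" "\<beta>' (\<beta> p) = q" using B'(2)[OF pq(1)] B'(2)[OF pq(2)] \<beta>' by auto
  have fD: "(f ^^ k) p \<in> D" for k unfolding f_def by (rule M.step_in_D[OF pq(1)])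
  have pre: "z = \<alpha> (\<beta> w)" if "f z = w" "z \<in> D" "w \<in> D" for z w
    using that unfolding f_def follow_def by auto
  have off: "f' z = f z" if "z \<in> D" "z \<notin> H" for z
  proof -
    have "\<alpha> z \<notin> {p, q, \<beta> p, \<beta> q}" using that(2) A(2)[OF that(1)] unfolding H_def by force
    then show ?thesis using eq[OF A(1)[OF that(1)]] by (simp add: f_def f'_def follow_def)
  qed
  obtain m where m: "0 < m" "(f ^^ m) p = p" unfolding f_def using M.step_period[OF pq(1)] .
  have "f ((f ^^ (m - 1)) p) = p" using m by (metis Suc_diff_1 comp_apply funpow.simps(2))
  then have "(f ^^ (m - 1)) p \<in> H" using pre[OF _ fD pq(1)] unfolding H_def by simp
  then have ex: "\<exists>i. (f ^^ i) p \<in> H" by blast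
  define i where "i = (LEAST i. (f ^^ i) p \<in> H)"
  have iH: "(f ^^ i) p \<in> H" unfolding i_def by (rule LeastI_ex[OF ex])
  have i_least: "i \<le> j" if "(f ^^ j) p \<in> H" for j unfolding i_def using that by (rule Least_le)
  have same: "(f' ^^ j) p = (f ^^ j) p" if "j \<le> i" for j
    using that
  proof (induction j)
    case (Suc j)
    then have "(f ^^ j) p \<notin> H" using i_least[of j] by fastforce
    then show ?case using Suc off[OF fD] by simp
  qed simp
  have i': "(f' ^^ Suc i) p = \<beta>' (\<alpha> ((f ^^ i) p))" using same[of i] by (simp add: f'_def follow_def)
  have i1: "(f ^^ Suc i) p = \<beta> (\<alpha> ((f ^^ i) p))" by (simp add: f_def follow_def)
  have norev: "(f ^^ k) p \<noteq> \<beta> p" for k using M.reversal_notin_orbit[OF pq(1)] unfolding f_def .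
  have orb': "linked \<alpha> \<beta>' p ((f' ^^ k) p)" for k
    by (rule in_orbit_imp_linked) (auto simp: in_orbit_def f'_def)
  have "(f ^^ i) p \<noteq> \<alpha> p" using norev[of "Suc i"] i1 A(2)[OF pq(1)] by auto
  then consider (p') "(f ^^ i) p = \<alpha> (\<beta> p)" | (q) "(f ^^ i) p = \<alpha> q" | (q') "(f ^^ i) p = \<alpha> (\<beta> q)"
    using iH unfolding H_def by blast
  note hit = this
  show ?thesis
  proof (cases "in_orbit f p q")
    case False
    from hit have "linked \<alpha> \<beta>' p q"
    proof cases
      case p'
      then have "(f' ^^ Suc i) p = q" using i' A(2) B(1) \<beta>'2 pq by simp
      then show ?thesis using orb'[of "Suc i"] by simp
    next
      case q
      then have "(f' ^^ Suc i) p = \<beta> p" using i' A(2) \<beta>' pq by simp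
      then have "linked \<alpha> \<beta>' p (\<beta> p)" using orb'[of "Suc i"] by simp
      then show ?thesis using linked_trans linked_snd[of \<alpha> \<beta>' "\<beta> p"] unfolding \<beta>'2 by metis
    next
      case q'
      then have "(f ^^ Suc i) p = q" using i1 A(2) B pq by simp
      then show ?thesis using False unfolding in_orbit_def by metis
    qed
    then show ?thesis using False unfolding f_def by simp
  next
    case True
    define k where "k = (LEAST k. (f ^^ k) p = q)"
    have exk: "\<exists>k. (f ^^ k) p = q" using True unfolding in_orbit_def by metis
    have k: "(f ^^ k) p = q" unfolding k_def by (rule LeastI_ex[OF exk])
    have k_least: "k \<le> j" if "(f ^^ j) p = q" for j unfolding k_def using that by (rule Least_le)
    have k0: "0 < k" using k pq(3) by (metis funpow_0 gr0I)
    have "f ((f ^^ (k - 1)) p) = q" using k k0 by (metis Suc_diff_1 comp_apply funpow.simps(2))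
    then have "(f ^^ (k - 1)) p \<in> H" using pre[OF _ fD pq(2)] unfolding H_def by simp
    then have ik: "Suc i \<le> k" using i_least[of "k - 1"] k0 by simp
    from hit have q': "(f ^^ i) p = \<alpha> (\<beta> q)"
    proof cases
      case p'
      then have "(f ^^ Suc i) p = p" using i1 A(2) B pq by simp
      then have "(f ^^ (k - Suc i)) p = q" using k ik by (metis comp_apply funpow_add le_add_diff_inverse2)
      then show ?thesis using k_least[of "k - Suc i"] k0 ik by simp
    next
      case q
      then have "(f ^^ Suc i) p = \<beta> q" using i1 A(2) pq by simp
      then have "in_orbit f p (\<beta> q)" unfolding in_orbit_def by metis
      moreover have "in_orbit f q p" unfolding f_def
        by (rule M.in_orbit_sym[OF pq(1)]) (use True in \<open>simp add: f_def\<close>)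
      ultimately have "in_orbit f q (\<beta> q)" using in_orbit_trans by metis
      then show ?thesis using M.reversal_notin_orbit[OF pq(2)] unfolding in_orbit_def f_def by metis
    qed
    then have per: "(f' ^^ Suc i) p = p" using i' A(2) B(1) \<beta>'2 pq by simp
    have orbit': "\<exists>j\<le>i. (f' ^^ n) p = (f ^^ j) p" for n
    proof -
      have "(f' ^^ n) p = (f' ^^ (n mod Suc i)) p" using funpow_mod_eq[OF per] by simp
      moreover have "n mod Suc i \<le> i" using mod_less_divisor[of "Suc i" n] by linarith
      ultimately show ?thesis using same by metis
    qed
    have "\<not> in_orbit f' p q"
      using orbit' k_least ik unfolding in_orbit_def by (metis not_less_eq_eq order_trans)
    moreover have "\<not> in_orbit f' p (\<beta>' q)"
      using orbit' norev unfolding in_orbit_def \<beta>' by metis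
    ultimately have "\<not> linked \<alpha> \<beta>' p q"
      using M'.linked_iff_orbit[OF pq(1,2)] unfolding f'_def by simp
    then show ?thesis using True unfolding f_def by simp
  qed
qed

lemma component_number_bij:
  assumes M: "two_matchings D \<alpha> \<beta>" and inj: "inj_on \<Phi> D"
    and \<alpha>': "\<And>x. x \<in> D \<Longrightarrow> \<alpha>' (\<Phi> x) = \<Phi> (\<alpha> x)" and \<beta>': "\<And>x. x \<in> D \<Longrightarrow> \<beta>' (\<Phi> x) = \<Phi> (\<beta> x)"
  shows "component_number (\<Phi> ` D) \<alpha>' \<beta>' = component_number D \<alpha> \<beta>"
proof -
  interpret M: two_matchings D \<alpha> \<beta> by fact
  have cls: "{y. linked \<alpha>' \<beta>' (\<Phi> x) y} = \<Phi> ` {y. linked \<alpha> \<beta> x y}" if x: "x \<in> D" for x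
  proof (intro set_eqI iffI)
    fix y assume "y \<in> {y. linked \<alpha>' \<beta>' (\<Phi> x) y}"
    then have "linked \<alpha>' \<beta>' (\<Phi> x) y" by simp
    then have "\<exists>z. y = \<Phi> z \<and> linked \<alpha> \<beta> x z"
      unfolding linked_def
    proof (induction rule: rtranclp_induct)
      case (step y w)
      then obtain z where z: "y = \<Phi> z" "linked \<alpha> \<beta> x z" unfolding linked_def by blast
      have "z \<in> D" using M.linked_in_D[OF z(2) x] .
      then have "w = \<Phi> (\<alpha> z) \<or> w = \<Phi> (\<beta> z)" using step.hyps(2) z(1) \<alpha>' \<beta>' by auto
      then show ?case
        using linked_trans[OF z(2) linked_fst] linked_trans[OF z(2) linked_snd] unfolding linked_def by blast
    qed blast
    then show "y \<in> \<Phi> ` {y. linked \<alpha> \<beta> x y}" by blast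
  next
    fix y assume "y \<in> \<Phi> ` {y. linked \<alpha> \<beta> x y}"
    then obtain z where z: "y = \<Phi> z" "linked \<alpha> \<beta> x z" by blast
    from z(2) have "linked \<alpha>' \<beta>' (\<Phi> x) (\<Phi> z)"
      unfolding linked_def
    proof (induction rule: rtranclp_induct)
      case (step y w)
      have "y \<in> D" using M.linked_in_D[of x y] step.hyps(1) x unfolding linked_def by blast
      then have "\<Phi> w = \<alpha>' (\<Phi> y) \<or> \<Phi> w = \<beta>' (\<Phi> y)" using step.hyps(2) \<alpha>' \<beta>' by auto
      then show ?case by (rule rtranclp.rtrancl_into_rtrancl[OF step.IH])
    qed simp
    then show "y \<in> {y. linked \<alpha>' \<beta>' (\<Phi> x) y}" using z by simp
  qed
  have "(\<lambda>x. {y. linked \<alpha>' \<beta>' x y}) ` \<Phi> ` D = (image \<Phi>) ` (\<lambda>x. {y. linked \<alpha> \<beta> x y}) ` D"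
    unfolding image_image by (rule image_cong[OF refl cls])
  moreover have "inj_on (image \<Phi>) ((\<lambda>x. {y. linked \<alpha> \<beta> x y}) ` D)"
    by (rule inj_on_subset[OF inj_on_image_Pow[OF inj]]) (use M.linked_in_D in blast)
  ultimately show ?thesis unfolding component_number_def by (simp add: card_image)
qed

lemma component_number_le: "finite D \<Longrightarrow> component_number D \<alpha> \<beta> \<le> card D"
  unfolding component_number_def by (rule card_image_le)


lemma exI2: "P a b \<Longrightarrow> \<exists>x y. P x y"
  by blast

section \<open>Finitely many times on the circle\<close>

text \<open>
  The distance from \<open>s\<close> to the next time of \<open>T\<close> in direction \<open>d\<close>. Distances are measured in \<open>(0, 1]\<close>: if
  \<open>s\<close> itself is the next time, it is met after a full turn.
\<close>

definition gap :: "real set \<Rightarrow> real \<Rightarrow> real \<Rightarrow> real" where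
  "gap T d s = Min ((\<lambda>t. 1 - frac (d * (s - t))) ` T)"

definition next_time :: "real set \<Rightarrow> real \<Rightarrow> real \<Rightarrow> real" where
  "next_time T d s = frac (s + d * gap T d s)"

lemma frac_frac_add: "frac (frac a + b) = frac (a + b :: real)"
proof -
  have "frac a + b - frac (a + b) = of_int (\<lfloor>a + b\<rfloor> - \<lfloor>a\<rfloor>)" by (simp add: frac_def)
  then have "frac a + b - frac (a + b) \<in> \<int>" by (metis Ints_of_int)
  then show ?thesis unfolding frac_unique_iff by (simp add: frac_ge_0 frac_lt_1)
qed

lemma distance_along_circle:
  assumes d: "d \<in> {1, -1}" and t: "0 \<le> t" "t < 1"
  shows "frac (s + d * (1 - frac (d * (s - t)))) = (t::real)"
proof -
  have "s + d * (1 - frac (d * (s - t))) - t = d + d * of_int \<lfloor>d * (s - t)\<rfloor>"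
    using d by (auto simp: frac_def algebra_simps)
  also have "\<dots> \<in> \<int>" using d by auto
  finally show ?thesis unfolding frac_unique_iff using t by simp
qed

lemma distance_along_circle_unique:
  assumes d: "d \<in> {1, -1}" and q: "0 < q" "q \<le> 1" and t: "frac (s + d * q) = t"
  shows "q = 1 - frac (d * (s - t :: real))"
proof -
  have "d * (s - t) - (1 - q) = d * of_int \<lfloor>s + d * q\<rfloor> - 1"
    using d unfolding t[symmetric] by (auto simp: frac_def algebra_simps)
  also have "\<dots> \<in> \<int>" using d by auto
  finally have "frac (d * (s - t)) = 1 - q" unfolding frac_unique_iff using q by simp
  then show ?thesis by simp
qed

locale time_slices =
  fixes T :: "real set"
  assumes finite_T: "finite T" and T_ne: "T \<noteq> {}" and T_circle: "T \<subseteq> {0..<1}"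
begin

lemma frac_T: "t \<in> T \<Longrightarrow> frac t = t"
  using T_circle by (auto simp: frac_eq)

lemma gap_attained:
  obtains t where "t \<in> T" "gap T d s = 1 - frac (d * (s - t))"
proof -
  have "gap T d s \<in> (\<lambda>t. 1 - frac (d * (s - t))) ` T"
    unfolding gap_def using finite_T T_ne by (intro Min_in) auto
  then show ?thesis using that by blast
qed

lemma gap_pos: "0 < gap T d s" and gap_le_1: "gap T d s \<le> 1"
proof -
  obtain t where "gap T d s = 1 - frac (d * (s - t))" by (rule gap_attained)
  then show "0 < gap T d s" "gap T d s \<le> 1" by (simp_all add: frac_lt_1 frac_ge_0)
qed

lemma next_time_in:
  assumes d: "d \<in> {1, -1}"
  shows "next_time T d s \<in> T"
proof -
  obtain t where t: "t \<in> T" "gap T d s = 1 - frac (d * (s - t))" by (rule gap_attained)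
  have "0 \<le> t" "t < 1" using t(1) T_circle by auto
  from distance_along_circle[OF d this] show ?thesis unfolding next_time_def t(2) using t(1) by simp
qed

lemma gap_free:
  assumes d: "d \<in> {1, -1}" and q: "0 < q" "q < gap T d s"
  shows "frac (s + d * q) \<notin> T"
proof
  assume T: "frac (s + d * q) \<in> T"
  have "q = 1 - frac (d * (s - frac (s + d * q)))"
    by (rule distance_along_circle_unique[OF d q(1) _ refl]) (use q gap_le_1[of d s] in simp)
  also have "gap T d s \<le> \<dots>" unfolding gap_def using finite_T T by (intro Min_le) auto
  finally show False using q by simp
qed

lemma gap_eqI:
  assumes d: "d \<in> {1, -1}" and r: "0 < r" "frac (s + d * r) \<in> T"
    and free: "\<And>q. 0 < q \<Longrightarrow> q < r \<Longrightarrow> frac (s + d * q) \<notin> T"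
  shows "gap T d s = r"
  using gap_free[OF d r(1), of s] free[OF gap_pos] r(2) next_time_in[OF d, of s]
  unfolding next_time_def by (metis linorder_less_linear)

lemma frac_shift_next: "frac (next_time T d s + b) = frac (s + d * gap T d s + b)"
  unfolding next_time_def by (rule frac_frac_add)

lemma gap_back:
  assumes d: "d \<in> {1, -1}" and s: "s \<in> T"
  shows "gap T (- d) (next_time T d s) = gap T d s"
proof (rule gap_eqI)
  show "- d \<in> {1, -1}" using d by auto
  show "0 < gap T d s" by (rule gap_pos)
  have "frac (next_time T d s + - d * gap T d s) = s"
    unfolding frac_shift_next using frac_T[OF s] by simp
  then show "frac (next_time T d s + - d * gap T d s) \<in> T" using s by simp
  fix q assume q: "0 < q" "q < gap T d s"
  have "frac (next_time T d s + - d * q) = frac (s + d * (gap T d s - q))"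
    unfolding frac_shift_next by (simp add: algebra_simps)
  then show "frac (next_time T d s + - d * q) \<notin> T" using gap_free[OF d, of "gap T d s - q" s] q by simp
qed

lemma next_time_back:
  assumes d: "d \<in> {1, -1}" and s: "s \<in> T"
  shows "next_time T (- d) (next_time T d s) = s"
proof -
  have "next_time T (- d) (next_time T d s) = frac (next_time T d s + - d * gap T d s)"
    unfolding next_time_def[of T "- d"] gap_back[OF assms] ..
  then show ?thesis unfolding frac_shift_next using frac_T[OF s] by simp
qed

text \<open>
  A time strictly between two neighbours in \<open>T\<close> determines both of them.
\<close>

lemma between_times:
  assumes d: "d \<in> {1, -1}" and r: "0 < r" "r < gap T d s"
  shows "next_time T d (frac (s + d * r)) = next_time T d s"
    and "s \<in> T \<Longrightarrow> next_time T (- d) (frac (s + d * r)) = s"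
proof -
  have *: "frac (frac (s + d * r) + d * q) = frac (s + d * (r + q))" for q
    unfolding frac_frac_add by (simp add: algebra_simps)
  have "gap T d (frac (s + d * r)) = gap T d s - r"
  proof (rule gap_eqI[OF d])
    show "0 < gap T d s - r" using r by simp
    show "frac (frac (s + d * r) + d * (gap T d s - r)) \<in> T"
      unfolding * using next_time_in[OF d, of s] unfolding next_time_def by simp
    show "frac (frac (s + d * r) + d * q) \<notin> T" if "0 < q" "q < gap T d s - r" for q
      unfolding * using gap_free[OF d, of "r + q" s] r that by simp
  qed
  then show "next_time T d (frac (s + d * r)) = next_time T d s"
    unfolding next_time_def using *[of "gap T d s - r"] by simp
  assume s: "s \<in> T"
  have **: "frac (frac (s + d * r) + - d * q) = frac (s + d * (r - q))" for q
    unfolding frac_frac_add by (simp add: algebra_simps)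
  have "gap T (- d) (frac (s + d * r)) = r"
  proof (rule gap_eqI)
    show "- d \<in> {1, -1}" using d by auto
    show "frac (frac (s + d * r) + - d * r) \<in> T" unfolding ** using s frac_T by simp
    show "frac (frac (s + d * r) + - d * q) \<notin> T" if "0 < q" "q < r" for q
      unfolding ** using gap_free[OF d, of "r - q" s] r that by simp
  qed (rule r(1))
  then show "next_time T (- d) (frac (s + d * r)) = s"
    unfolding next_time_def using ** frac_T[OF s] by simp
qed

text \<open>
  In this form the next time depends only on the order of \<open>[0, 1)\<close>, not on distances.
\<close>

lemma next_time_up:
  assumes s: "s \<in> T"
  shows "next_time T 1 s = (if \<exists>t\<in>T. s < t then Min {t\<in>T. s < t} else Min T)"
proof -
  have s01: "0 \<le> s" "s < 1" using s T_circle by auto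
  show ?thesis
  proof (cases "\<exists>t\<in>T. s < t")
    case True
    let ?t = "Min {t\<in>T. s < t}"
    have "?t \<in> {t\<in>T. s < t}" using True finite_T by (intro Min_in) auto
    then have t: "?t \<in> T" "s < ?t" "?t < 1" using T_circle by auto
    have least: "?t \<le> t" if "t \<in> T" "s < t" for t using that finite_T by (intro Min_le) auto
    have "gap T 1 s = ?t - s"
    proof (rule gap_eqI)
      show "frac (s + 1 * (?t - s)) \<in> T" using t(1) frac_T by simp
      fix q assume q: "0 < q" "q < ?t - s"
      then have "frac (s + 1 * q) = s + q" using s01 t(3) by (simp add: frac_eq)
      then show "frac (s + 1 * q) \<notin> T" using least[of "s + q"] q by auto
    qed (use t(2) in auto)
    then show ?thesis using True t(1) frac_T unfolding next_time_def by simp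
  next
    case False
    let ?t = "Min T"
    have t: "?t \<in> T" using T_ne finite_T by (intro Min_in) auto
    have t01: "0 \<le> ?t" "?t < 1" using t T_circle by auto
    have least: "?t \<le> t" if "t \<in> T" for t using that finite_T by (intro Min_le) auto
    have wrap: "frac (s + 1 * (1 + x - s)) = frac x" for x :: real
      using frac_1_eq[of x] by (simp add: algebra_simps)
    have "gap T 1 s = 1 + ?t - s"
    proof (rule gap_eqI)
      show "0 < 1 + ?t - s" using s01 t01 by simp
      show "frac (s + 1 * (1 + ?t - s)) \<in> T" unfolding wrap using t frac_T by simp
      fix q assume q: "0 < q" "q < 1 + ?t - s"
      show "frac (s + 1 * q) \<notin> T"
      proof (cases "s + q < 1")
        case True
        then have "frac (s + 1 * q) = s + q" using s01 q by (simp add: frac_eq)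
        then show ?thesis using False q by auto
      next
        case w: False
        have "frac (s + 1 * q) = s + q - 1"
          unfolding frac_unique_iff using w q t01 by simp
        then show ?thesis using least[of "s + q - 1"] q by auto
      qed
    qed simp
    then have "next_time T 1 s = ?t" unfolding next_time_def using wrap[of ?t] t frac_T by simp
    then show ?thesis using False by simp
  qed
qed

end

text \<open>
  The downward direction follows from the upward one, because the two next-time maps are inverse
  to each other on \<open>T\<close>.
\<close>

lemma next_time_mono_image:
  assumes T: "time_slices T" and T': "time_slices (\<phi> ` T)" and mono: "strict_mono_on T \<phi>"
    and d: "d \<in> {1, -1}" and s: "s \<in> T"
  shows "next_time (\<phi> ` T) d (\<phi> s) = \<phi> (next_time T d s)"
proof -
  interpret T: time_slices T by fact
  interpret T': time_slices "\<phi> ` T" by fact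
  have less_iff: "\<phi> a < \<phi> b \<longleftrightarrow> a < b" if "a \<in> T" "b \<in> T" for a b
    using mono that by (metis linorder_less_linear order_less_asym strict_mono_onD)
  have Min_image: "Min (\<phi> ` S) = \<phi> (Min S)" if S: "S \<subseteq> T" "S \<noteq> {}" for S
  proof (rule Min_eqI)
    have fin: "finite S" using S T.finite_T finite_subset by blast
    have in_S: "Min S \<in> S" using S fin by (intro Min_in) auto
    show "finite (\<phi> ` S)" using fin by simp
    show "\<phi> (Min S) \<in> \<phi> ` S" using in_S by simp
    fix y assume "y \<in> \<phi> ` S"
    then obtain x where x: "x \<in> S" "y = \<phi> x" by auto
    have "Min S \<le> x" using fin x by (intro Min_le) auto
    then show "\<phi> (Min S) \<le> y" using less_iff[of x "Min S"] x S in_S by fastforce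
  qed
  have up: "next_time (\<phi> ` T) 1 (\<phi> t) = \<phi> (next_time T 1 t)" if t: "t \<in> T" for t
  proof -
    have "{y \<in> \<phi> ` T. \<phi> t < y} = \<phi> ` {x \<in> T. t < x}" using less_iff[OF t] by auto
    moreover have "(\<exists>y\<in>\<phi> ` T. \<phi> t < y) \<longleftrightarrow> (\<exists>x\<in>T. t < x)" using less_iff[OF t] by auto
    moreover have "Min (\<phi> ` {x \<in> T. t < x}) = \<phi> (Min {x \<in> T. t < x})" if "\<exists>x\<in>T. t < x"
      by (rule Min_image) (use that in auto)
    moreover have "Min (\<phi> ` T) = \<phi> (Min T)" by (rule Min_image) (use T.T_ne in auto)
    ultimately show ?thesis unfolding T.next_time_up[OF t] T'.next_time_up[OF imageI[OF t]] by simp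
  qed
  have down: "next_time (\<phi> ` T) (-1) (\<phi> s) = \<phi> (next_time T (-1) s)"
  proof -
    let ?t = "next_time T (-1) s"
    have t: "?t \<in> T" by (rule T.next_time_in) simp
    have "\<phi> s = next_time (\<phi> ` T) 1 (\<phi> ?t)"
      unfolding up[OF t] using T.next_time_back[of "-1" s] s by simp
    then show ?thesis using T'.next_time_back[of 1 "\<phi> ?t"] t by simp
  qed
  show ?thesis using d up[OF s] down by auto
qed

section \<open>Loops as components\<close>

text \<open>
  The triple \<open>(x, s, d)\<close> stands for the vertical segment leaving \<open>(x, s)\<close> in direction \<open>d\<close>, and at the same
  time for the state of a particle about to run along it.
\<close>

definition half_edges :: "'v set \<Rightarrow> real set \<Rightarrow> 'v state set" where
  "half_edges V T = V \<times> T \<times> {1, -1}"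

definition crossing :: "'v set set \<Rightarrow> 'v config \<Rightarrow> 'v \<Rightarrow> real \<Rightarrow> 'v \<Rightarrow> mark \<Rightarrow> bool" where
  "crossing E \<omega> x s y m \<longleftrightarrow> {x, y} \<in> E \<and> (s, m) \<in> \<omega> {x, y}"

text \<open>
  A particle that arrives along the half-edge \<open>(x, s, d)\<close> moves in direction \<open>- d\<close>, hence this sign; it
  continues along the partner.
\<close>

definition across :: "'v set set \<Rightarrow> 'v config \<Rightarrow> 'v state \<Rightarrow> 'v state" where
  "across E \<omega> = (\<lambda>(x, s, d).
     if \<exists>y m. crossing E \<omega> x s y m
     then (let (y, m) = (SOME (y, m). crossing E \<omega> x s y m) in (y, s, turn m (- d)))
     else (x, s, - d))"

definition along :: "real set \<Rightarrow> 'v state \<Rightarrow> 'v state" where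
  "along T = (\<lambda>(x, s, d). (x, next_time T d s, - d))"

locale loop_graph =
  fixes V :: "'v set" and E :: "'v set set"
  assumes finite_V: "finite V" and edges: "\<forall>e\<in>E. e \<subseteq> V \<and> card e = 2"

text \<open>
  Times without a mark are allowed in \<open>T\<close>, so that the time of an arbitrary state or of a new mark
  can be included without changing the configuration.
\<close>

locale sliced_config = loop_graph V E + time_slices T
  for V :: "'v set" and E and T +
  fixes \<omega> :: "'v config"
  assumes distinct: "distinct_times E \<omega>" and marks_T: "mark_times E \<omega> \<subseteq> T"
begin

lemma crossing_unique:
  assumes "crossing E \<omega> x s y m" "crossing E \<omega> x s y' m'"
  shows "y' = y" "m' = m"
  using assms distinct unfolding crossing_def distinct_times_def by (metis doubleton_eq_iff)+

lemma crossing_sym: "crossing E \<omega> x s y m \<Longrightarrow> crossing E \<omega> y s x m"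
  unfolding crossing_def by (simp add: insert_commute)

lemma crossing_neq: "crossing E \<omega> x s y m \<Longrightarrow> x \<noteq> y"
  using edges unfolding crossing_def by force

lemma crossing_V: "crossing E \<omega> x s y m \<Longrightarrow> x \<in> V \<and> y \<in> V \<and> s \<in> T"
  using edges marks_T unfolding crossing_def mark_times_def by fast

lemma across_crossing:
  assumes "crossing E \<omega> x s y m"
  shows "across E \<omega> (x, s, d) = (y, s, turn m (- d))"
proof -
  have "(SOME (y, m). crossing E \<omega> x s y m) = (y, m)"
    by (rule some_equality) (use assms crossing_unique in \<open>auto split: prod.splits\<close>)
  then show ?thesis using assms unfolding across_def by auto
qed

lemma across_regular:
  assumes "\<And>y m. \<not> crossing E \<omega> x s y m"
  shows "across E \<omega> (x, s, d) = (x, s, - d)"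
proof -
  have "\<not> (\<exists>y m. crossing E \<omega> x s y m)" using assms by blast
  then show ?thesis unfolding across_def by (simp only: prod.case if_False)
qed

lemma turn_direction: "d \<in> {1, -1} \<Longrightarrow> turn m d \<in> {1, -1}" "turn m (- turn m (- d)) = d"
  by (cases m; auto)+

lemma matching_across: "matching (half_edges V T) (across E \<omega>)"
  unfolding matching_def
proof (intro ballI)
  fix z assume "z \<in> half_edges V T"
  then obtain x s d where z: "z = (x, s, d)" "x \<in> V" "s \<in> T" "d \<in> {1, -1}"
    unfolding half_edges_def by auto
  then have d: "- d \<in> {1, -1}" "- d \<noteq> d" by auto
  show "across E \<omega> z \<in> half_edges V T \<and> across E \<omega> (across E \<omega> z) = z \<and> across E \<omega> z \<noteq> z"
  proof (cases "\<exists>y m. crossing E \<omega> x s y m")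
    case True
    then obtain y m where c: "crossing E \<omega> x s y m" by blast
    then show ?thesis
      using across_crossing[OF c] across_crossing[OF crossing_sym[OF c]] z crossing_V[OF c]
        crossing_neq[OF c] turn_direction(1)[OF d(1)] turn_direction(2)[of m d]
      unfolding half_edges_def by auto
  next
    case False
    then show ?thesis using across_regular[of x s] z d unfolding half_edges_def by auto
  qed
qed

lemma matching_along: "matching (half_edges V T) (along T)"
  unfolding matching_def half_edges_def along_def
  using next_time_in next_time_back[of 1] next_time_back[of "-1"] by auto

sublocale M: two_matchings "half_edges V T" "along T" "across E \<omega>"
  by (unfold_locales; (rule matching_across matching_along)?)
     (simp add: half_edges_def finite_V finite_T)


abbreviation (input) step :: "'v state \<Rightarrow> 'v state" where "step \<equiv> follow (along T) (across E \<omega>)"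

lemma step_crossing: "crossing E \<omega> x (next_time T d s) y m \<Longrightarrow> step (x, s, d) = (y, next_time T d s, turn m d)"
  by (simp add: follow_def along_def across_crossing)

lemma step_regular:
  assumes "\<And>y m. \<not> crossing E \<omega> x (next_time T d s) y m"
  shows "step (x, s, d) = (x, next_time T d s, d)"
  using across_regular[OF assms] by (simp add: follow_def along_def)

lemma unobstructed_iff:
  "unobstructed E \<omega> x s d r \<longleftrightarrow> (\<forall>q. 0 < q \<and> q < r \<longrightarrow> (\<forall>y m. \<not> crossing E \<omega> x (frac (s + d * q)) y m))"
proof -
  have *: "(\<exists>e m. e \<in> E \<and> x \<in> e \<and> (c, m) \<in> \<omega> e) \<longleftrightarrow> (\<exists>y m. crossing E \<omega> x c y m)" for c
  proof
    assume "\<exists>e m. e \<in> E \<and> x \<in> e \<and> (c, m) \<in> \<omega> e"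
    then obtain e m where e: "e \<in> E" "x \<in> e" "(c, m) \<in> \<omega> e" by blast
    then obtain y where "e = {x, y}" using edges by (metis card_2_iff insertE insert_commute singletonD)
    then show "\<exists>y m. crossing E \<omega> x c y m" using e unfolding crossing_def by blast
  qed (auto simp: crossing_def)
  show ?thesis unfolding unobstructed_def using * by blast
qed

lemma unobstructed_extend:
  assumes d: "d \<in> {1, -1}" and u: "unobstructed E \<omega> x s d r"
    and nc: "0 < r \<longrightarrow> (\<forall>y m. \<not> crossing E \<omega> x (frac (s + d * r)) y m)"
    and r': "r' \<le> gap T d (frac (s + d * r))"
  shows "unobstructed E \<omega> x s d (r + r')"
  unfolding unobstructed_iff
proof (intro allI impI)
  fix q y m assume q: "0 < q \<and> q < r + r'"
  consider "q < r" | "q = r" | "r < q" by linarith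
  then show "\<not> crossing E \<omega> x (frac (s + d * q)) y m"
  proof cases
    case 1
    then show ?thesis using u q unfolding unobstructed_iff by blast
  next
    case 2
    then show ?thesis using nc q by blast
  next
    case 3
    have "frac (frac (s + d * r) + d * (q - r)) \<notin> T" by (rule gap_free[OF d]) (use 3 q r' in auto)
    moreover have "frac (frac (s + d * r) + d * (q - r)) = frac (s + d * q)"
      unfolding frac_frac_add by (simp add: algebra_simps)
    ultimately show ?thesis using crossing_V by auto
  qed
qed

lemma jump_iff:
  "jump E \<omega> (x, s, d) z \<longleftrightarrow>
     (\<exists>r y m. 0 < r \<and> unobstructed E \<omega> x s d r \<and> crossing E \<omega> x (frac (s + d * r)) y m \<and>
        z = (y, frac (s + d * r), turn m d))"
  unfolding jump.simps crossing_def by blast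

text \<open>
  A particle without obstruction for a distance \<open>r\<close> makes some steps and then a part of one more. As it may
  run around the circle many times, the induction is on the number of smallest gaps that fit into \<open>r\<close>.
\<close>

lemma walk:
  assumes d: "d \<in> {1, -1}" and z: "s \<in> T" and r: "0 \<le> r" and u: "unobstructed E \<omega> x s d r"
  shows "\<exists>s' r'. in_orbit step (x, s, d) (x, s', d) \<and> s' \<in> T \<and> 0 \<le> r' \<and> r' \<le> gap T d s' \<and>
           frac (s' + d * r') = frac (s + d * r) \<and> (0 < r \<longrightarrow> 0 < r')"
proof -
  define \<delta> where "\<delta> = Min (gap T d ` T)"
  have "\<delta> \<in> gap T d ` T" unfolding \<delta>_def using finite_T T_ne by (intro Min_in) auto
  then have \<delta>: "0 < \<delta>" using gap_pos by auto
  have \<delta>_le: "\<delta> \<le> gap T d t" if "t \<in> T" for t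
    unfolding \<delta>_def using finite_T that by (intro Min_le) auto
  obtain N :: nat where "r / \<delta> < N" using reals_Archimedean2 by blast
  then have "r < N * \<delta>" using \<delta> by (simp add: field_simps)
  then show ?thesis
    using z r u
  proof (induction N arbitrary: s r)
    case 0
    then show ?case by simp
  next
    case (Suc N)
    show ?case
    proof (cases "r \<le> gap T d s")
      case True
      then show ?thesis using Suc.prems by (intro exI2[of _ s r]) (simp add: in_orbit_refl)
    next
      case False
      let ?g = "gap T d s" and ?n = "next_time T d s"
      have shift: "frac (?n + d * q) = frac (s + d * (?g + q))" for q
        unfolding frac_shift_next by (simp add: algebra_simps)
      have nc: "\<not> crossing E \<omega> x ?n y m" for y m
        using Suc.prems(4) gap_pos[of d s] False unfolding unobstructed_iff next_time_def by auto
      have st: "step (x, s, d) = (x, ?n, d)" by (rule step_regular[OF nc])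
      have u': "unobstructed E \<omega> x ?n d (r - ?g)"
        unfolding unobstructed_iff shift
      proof (intro allI impI)
        fix q y m assume "0 < q \<and> q < r - ?g"
        then show "\<not> crossing E \<omega> x (frac (s + d * (?g + q))) y m"
          using Suc.prems(4) gap_pos[of d s] unfolding unobstructed_iff by simp
      qed
      have lt: "r - ?g < N * \<delta>" using Suc.prems(1) \<delta>_le[OF Suc.prems(2)] by (simp add: algebra_simps)
      obtain s' r' where *: "in_orbit step (x, ?n, d) (x, s', d)" "s' \<in> T" "0 \<le> r'" "r' \<le> gap T d s'"
        "frac (s' + d * r') = frac (?n + d * (r - ?g))" "0 < r - ?g \<longrightarrow> 0 < r'"
        using Suc.IH[OF lt next_time_in[OF d] _ u'] False by auto
      have "in_orbit step (x, s, d) (x, ?n, d)" using in_orbit_step[OF in_orbit_refl, of step "(x, s, d)"] st by simp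
      from in_orbit_trans[OF this *(1)] show ?thesis
        using * False unfolding shift by (intro exI2[of _ s' r']) simp
    qed
  qed
qed

lemma partial_gap:
  assumes d: "d \<in> {1, -1}" and r: "0 < r" "r \<le> gap T d s" and in_T: "frac (s + d * r) \<in> T"
  shows "r = gap T d s" "frac (s + d * r) = next_time T d s"
proof -
  show "r = gap T d s" using gap_free[OF d r(1), of s] r in_T by force
  then show "frac (s + d * r) = next_time T d s" unfolding next_time_def by simp
qed

lemma jump_imp_orbit:
  assumes z: "z \<in> half_edges V T" and j: "jump E \<omega> z w"
  shows "in_orbit step z w"
proof -
  obtain x s d where z: "z = (x, s, d)" "s \<in> T" "d \<in> {1, -1}" using z unfolding half_edges_def by blast
  obtain r y m where r: "0 < r" "unobstructed E \<omega> x s d r" "crossing E \<omega> x (frac (s + d * r)) y m"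
      "w = (y, frac (s + d * r), turn m d)"
    using j unfolding z jump_iff by blast
  obtain s' r' where s': "in_orbit step z (x, s', d)" "0 < r'" "r' \<le> gap T d s'"
      "frac (s' + d * r') = frac (s + d * r)"
    using walk[OF z(3,2) _ r(2)] r(1) unfolding z(1) by auto
  have "frac (s' + d * r') \<in> T" unfolding s'(4) using crossing_V[OF r(3)] by simp
  from partial_gap(2)[OF z(3) s'(2,3) this] have "frac (s + d * r) = next_time T d s'" using s'(4) by simp
  then have "step (x, s', d) = w" using step_crossing[of x d s'] r(3,4) by simp
  then show ?thesis using in_orbit_step[OF s'(1)] by simp
qed

lemma orbit_in: "z \<in> half_edges V T \<Longrightarrow> in_orbit step z w \<Longrightarrow> w \<in> half_edges V T"
  unfolding in_orbit_def using M.step_in_D by blast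

lemma jumps_imp_orbit:
  assumes z: "z \<in> half_edges V T" and j: "(jump E \<omega>)\<^sup>*\<^sup>* z w"
  shows "in_orbit step z w"
  using j
proof (induction rule: rtranclp_induct)
  case (step w w')
  show ?case by (rule in_orbit_trans[OF step.IH jump_imp_orbit[OF orbit_in[OF z step.IH] step.hyps(2)]])
qed (rule in_orbit_refl)

text \<open>
  Jumps lead from mark to mark, steps from one time of \<open>T\<close> to the next. A state reached by steps
  therefore lies on the free run after some jump, at a distance \<open>r\<close> that is zero if the last
  step ended with a jump.
\<close>

lemma orbit_imp_jumps:
  assumes z: "z \<in> half_edges V T"
  shows "(step ^^ k) z = (x, s, d) \<Longrightarrow>
     \<exists>s0 r. (jump E \<omega>)\<^sup>*\<^sup>* z (x, s0, d) \<and> 0 \<le> r \<and> unobstructed E \<omega> x s0 d r \<and> s = frac (s0 + d * r) \<and>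
       (0 < r \<longrightarrow> (\<forall>y m. \<not> crossing E \<omega> x s y m))"
proof (induction k arbitrary: x s d)
  case 0
  then have "s \<in> T" using z unfolding half_edges_def by auto
  then show ?case using 0 frac_T by (intro exI2[of _ s 0]) (auto simp: unobstructed_iff)
next
  case (Suc k)
  obtain x' s' d' where w: "(step ^^ k) z = (x', s', d')" by (metis prod_cases3)
  have d': "d' \<in> {1, -1}" using M.step_in_D[OF z, of k] unfolding w half_edges_def by simp
  obtain s0 r where s0: "(jump E \<omega>)\<^sup>*\<^sup>* z (x', s0, d')" "0 \<le> r" "unobstructed E \<omega> x' s0 d' r"
      "s' = frac (s0 + d' * r)" "0 < r \<longrightarrow> (\<forall>y m. \<not> crossing E \<omega> x' s' y m)"
    using Suc.IH[OF w] by blast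
  let ?g = "gap T d' s'" and ?n = "next_time T d' s'"
  have shift: "frac (s' + d' * q) = frac (s0 + d' * (r + q))" for q
    unfolding s0(4) frac_frac_add by (simp add: algebra_simps)
  have n: "?n = frac (s0 + d' * (r + ?g))" unfolding next_time_def shift ..
  have u: "unobstructed E \<omega> x' s0 d' (r + ?g)"
    by (rule unobstructed_extend[OF d' s0(3)]) (use s0(4,5) in auto)
  have st: "step (x', s', d') = (x, s, d)" using Suc.prems w by simp
  show ?case
  proof (cases "\<exists>y m. crossing E \<omega> x' ?n y m")
    case True
    then obtain y m where c: "crossing E \<omega> x' ?n y m" by blast
    have xsd: "x = y" "s = ?n" "d = turn m d'" using step_crossing[OF c] st by auto
    have "jump E \<omega> (x', s0, d') (x, s, d)"
      unfolding jump_iff xsd by (rule exI[of _ "r + ?g"]) (use u c s0(2) gap_pos n in \<open>auto intro: add_nonneg_pos\<close>)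
    then have "(jump E \<omega>)\<^sup>*\<^sup>* z (x, s, d)" using s0(1) by (rule rtranclp.rtrancl_into_rtrancl[rotated])
    moreover have "s \<in> T" unfolding xsd by (rule next_time_in[OF d'])
    ultimately show ?thesis using frac_T by (intro exI2[of _ s 0]) (auto simp: unobstructed_iff)
  next
    case False
    then have nc: "\<And>y m. \<not> crossing E \<omega> x' ?n y m" by blast
    have xsd: "x = x'" "s = ?n" "d = d'" using step_regular[OF nc] st by auto
    show ?thesis
      by (rule exI[of _ s0], rule exI[of _ "r + ?g"])
         (use s0(1,2) u n nc gap_pos[of d' s'] in \<open>auto simp: xsd\<close>)
  qed
qed

lemma passes_iff:
  assumes z: "z \<in> half_edges V T"
  shows "passes E \<omega> z x c d \<longleftrightarrow>
    (\<exists>s r. in_orbit step z (x, s, d) \<and> 0 \<le> r \<and> r \<le> gap T d s \<and> c = frac (s + d * r))"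
proof
  assume "passes E \<omega> z x c d"
  then obtain s r where s: "(jump E \<omega>)\<^sup>*\<^sup>* z (x, s, d)" "0 \<le> r" "unobstructed E \<omega> x s d r" "c = frac (s + d * r)"
    unfolding passes_def by blast
  note o = jumps_imp_orbit[OF z s(1)]
  have "(x, s, d) \<in> half_edges V T" by (rule orbit_in[OF z o])
  then have sd: "s \<in> T" "d \<in> {1, -1}" unfolding half_edges_def by auto
  obtain s' r' where *: "in_orbit step (x, s, d) (x, s', d)" "0 \<le> r'" "r' \<le> gap T d s'"
      "frac (s' + d * r') = frac (s + d * r)"
    using walk[OF sd(2,1) s(2,3)] by blast
  have "in_orbit step z (x, s', d)" by (rule in_orbit_trans[OF o *(1)])
  then show "\<exists>s r. in_orbit step z (x, s, d) \<and> 0 \<le> r \<and> r \<le> gap T d s \<and> c = frac (s + d * r)"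
    using * s(4) by (intro exI2[of _ s' r']) simp
next
  assume "\<exists>s r. in_orbit step z (x, s, d) \<and> 0 \<le> r \<and> r \<le> gap T d s \<and> c = frac (s + d * r)"
  then obtain s r k where s: "(step ^^ k) z = (x, s, d)" "0 \<le> r" "r \<le> gap T d s" "c = frac (s + d * r)"
    unfolding in_orbit_def by metis
  have d: "d \<in> {1, -1}" using M.step_in_D[OF z, of k] unfolding s(1) half_edges_def by simp
  obtain s0 r0 where s0: "(jump E \<omega>)\<^sup>*\<^sup>* z (x, s0, d)" "0 \<le> r0" "unobstructed E \<omega> x s0 d r0"
      "s = frac (s0 + d * r0)" "0 < r0 \<longrightarrow> (\<forall>y m. \<not> crossing E \<omega> x s y m)"
    using orbit_imp_jumps[OF z s(1)] by blast
  have shift: "frac (s + d * q) = frac (s0 + d * (r0 + q))" for q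
    unfolding s0(4) frac_frac_add by (simp add: algebra_simps)
  have "unobstructed E \<omega> x s0 d (r0 + r)"
    by (rule unobstructed_extend[OF d s0(3)]) (use s0(4,5) s(3) in auto)
  then show "passes E \<omega> z x c d"
    unfolding passes_def using s0(1,2) s(2,4) shift by (intro exI2[of _ s0 "r0 + r"]) simp
qed

definition segment :: "'v state \<Rightarrow> ('v \<times> real) set" where
  "segment = (\<lambda>(x, s, d). {(x, frac (s + d * r)) | r. 0 \<le> r \<and> r \<le> gap T d s})"

lemma loop_of_segments:
  assumes z: "z \<in> half_edges V T"
  shows "loop_of E \<omega> z = (\<Union>w\<in>{w. in_orbit step z w}. segment w)"
  unfolding loop_of_def passes_iff[OF z] segment_def by (auto split: prod.splits)

lemma segment_along:
  assumes z: "z \<in> half_edges V T"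
  shows "segment (along T z) = segment z"
proof -
  obtain x s d where zz: "z = (x, s, d)" "s \<in> T" "d \<in> {1, -1}" using z unfolding half_edges_def by blast
  let ?g = "gap T d s"
  have shift: "frac (next_time T d s + - d * r) = frac (s + d * (?g - r))" for r
    unfolding frac_shift_next by (simp add: algebra_simps)
  have "{(x, frac (s + d * (?g - r))) | r. 0 \<le> r \<and> r \<le> ?g} = {(x, frac (s + d * r)) | r. 0 \<le> r \<and> r \<le> ?g}"
    (is "?A = ?B")
  proof (intro equalityI subsetI)
    fix p assume "p \<in> ?A"
    then obtain r where "p = (x, frac (s + d * (?g - r)))" "0 \<le> r" "r \<le> ?g" by blast
    then show "p \<in> ?B" by (intro CollectI exI[of _ "?g - r"]) simp
  next
    fix p assume "p \<in> ?B"
    then obtain r where "p = (x, frac (s + d * r))" "0 \<le> r" "r \<le> ?g" by blast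
    then show "p \<in> ?A" by (intro CollectI exI[of _ "?g - r"]) simp
  qed
  then show ?thesis
    unfolding zz(1) segment_def along_def prod.case gap_back[OF zz(3,2)] shift .
qed

lemma loop_of_orbit:
  assumes z: "z \<in> half_edges V T" and o: "in_orbit step z w"
  shows "loop_of E \<omega> w = loop_of E \<omega> z"
proof -
  have "{v. in_orbit step w v} = {v. in_orbit step z v}"
    using in_orbit_trans[OF o] in_orbit_trans[OF M.in_orbit_sym[OF z o]] by blast
  then show ?thesis using loop_of_segments[OF z] loop_of_segments[OF orbit_in[OF z o]] by simp
qed

lemma loop_of_along:
  assumes z: "z \<in> half_edges V T"
  shows "loop_of E \<omega> (along T z) = loop_of E \<omega> z"
proof -
  have sub: "loop_of E \<omega> z \<subseteq> loop_of E \<omega> (along T z)" if z: "z \<in> half_edges V T" for z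
  proof
    fix p assume "p \<in> loop_of E \<omega> z"
    then obtain w where w: "in_orbit step z w" "p \<in> segment w" unfolding loop_of_segments[OF z] by blast
    have "in_orbit step (along T z) (along T w)" by (rule M.in_orbit_reversal(1)[OF z w(1)])
    moreover have "p \<in> segment (along T w)" using w(2) segment_along[OF orbit_in[OF z w(1)]] by simp
    ultimately show "p \<in> loop_of E \<omega> (along T z)" unfolding loop_of_segments[OF M.\<alpha>D(1)[OF z]] by blast
  qed
  show ?thesis using sub[OF z] sub[OF M.\<alpha>D(1)[OF z]] z by simp
qed

text \<open>
  A loop determines its component: an interior point of a segment lies on no other segment, and the
  two half-edges of a segment are linked.
\<close>

lemma loop_of_eq_iff:
  assumes z: "z \<in> half_edges V T" and w: "w \<in> half_edges V T"
  shows "loop_of E \<omega> z = loop_of E \<omega> w \<longleftrightarrow> linked (along T) (across E \<omega>) z w"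
proof
  assume "linked (along T) (across E \<omega>) z w"
  then consider "in_orbit step z w" | "in_orbit step z (across E \<omega> w)"
    using M.linked_iff_orbit[OF z w] by blast
  then show "loop_of E \<omega> z = loop_of E \<omega> w"
  proof cases
    case 1
    then show ?thesis using loop_of_orbit[OF z] by simp
  next
    case 2
    have aw: "along T w \<in> half_edges V T" using w by simp
    have "step (along T w) = across E \<omega> w" using w by (simp add: follow_def)
    then have "in_orbit step (along T w) (across E \<omega> w)" using in_orbit_step[OF in_orbit_refl] by metis
    then have "loop_of E \<omega> (across E \<omega> w) = loop_of E \<omega> w"
      using loop_of_orbit[OF aw] loop_of_along[OF w] by simp
    then show ?thesis using loop_of_orbit[OF z 2] by simp
  qed
next
  assume eq: "loop_of E \<omega> z = loop_of E \<omega> w"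
  obtain x s d where ww: "w = (x, s, d)" "s \<in> T" "d \<in> {1, -1}" using w unfolding half_edges_def by blast
  define g where "g = gap T d s / 2"
  have g: "0 < g" "g < gap T d s" using gap_pos[of d s] unfolding g_def by simp_all
  let ?c = "frac (s + d * g)"
  have "(x, ?c) \<in> segment w" unfolding ww(1) segment_def prod.case using g by (intro CollectI exI[of _ g]) simp
  then have "(x, ?c) \<in> loop_of E \<omega> z" unfolding eq loop_of_segments[OF w] using in_orbit_refl by fast
  then obtain s' d' r where o: "in_orbit step z (x, s', d')" and r: "0 \<le> r" "r \<le> gap T d' s'" "?c = frac (s' + d' * r)"
    unfolding loop_of_segments[OF z] segment_def by auto
  have "(x, s', d') \<in> half_edges V T" by (rule orbit_in[OF z o])
  then have s': "s' \<in> T" "d' \<in> {1, -1}" unfolding half_edges_def by auto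
  have c: "?c \<notin> T" by (rule gap_free[OF ww(3) g])
  have "r \<noteq> 0" using c r(3) s'(1) frac_T by auto
  moreover have "r \<noteq> gap T d' s'" using c r(3) next_time_in[OF s'(2), of s'] unfolding next_time_def by auto
  ultimately have r': "0 < r" "r < gap T d' s'" using r by auto
  note c1 = between_times[OF ww(3) g] and c2 = between_times[OF s'(2) r', folded r(3)]
  show "linked (along T) (across E \<omega>) z w"
  proof (cases "d' = d")
    case True
    then have "s' = s" using c1(2)[OF ww(2)] c2(2)[OF s'(1)] by simp
    then show ?thesis using in_orbit_imp_linked[OF o] ww True by simp
  next
    case False
    then have d': "d' = - d" using ww(3) s'(2) by auto
    have "s' = next_time T d s" using c1(1) c2(2)[OF s'(1)] unfolding d' by simp
    then have "(x, s', d') = along T w" unfolding ww(1) along_def d' by simp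
    then have "linked (along T) (across E \<omega>) z (along T w)" using in_orbit_imp_linked[OF o] by simp
    from linked_trans[OF this linked_fst] show ?thesis using w by simp
  qed
qed

end

lemma sliced_config_insert:
  assumes "sliced_config V E T \<omega>" "0 \<le> s" "s < 1"
  shows "sliced_config V E (insert s T) \<omega>"
proof -
  interpret sliced_config V E T \<omega> by fact
  show ?thesis
    by unfold_locales (use finite_T T_circle distinct marks_T assms in auto)
qed

context sliced_config
begin

text \<open>
  With the time of the state included in \<open>T\<close>, one step back leads to a time that was in \<open>T\<close> before.
\<close>

lemma loop_through_state:
  assumes z: "z \<in> states V"
  shows "\<exists>w\<in>half_edges V T. loop_of E \<omega> w = loop_of E \<omega> z"
proof -
  obtain x s d where zz: "z = (x, s, d)" "x \<in> V" "0 \<le> s" "s < 1" "d \<in> {1, -1}"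
    using z unfolding states_def by auto
  show ?thesis
  proof (cases "s \<in> T")
    case True
    then show ?thesis using zz unfolding half_edges_def by blast
  next
    case False
    interpret T': sliced_config V E "insert s T" \<omega>
      by (rule sliced_config_insert[OF _ zz(3,4)]) unfold_locales
    let ?p = "next_time (insert s T) (- d) s"
    let ?w = "(x, ?p, d)"
    have d: "- d \<in> {1, -1}" using zz(5) by auto
    have p_in: "?p \<in> insert s T" by (rule T'.next_time_in[OF d])
    have w': "?w \<in> half_edges V (insert s T)" using zz p_in unfolding half_edges_def by auto
    have pn: "next_time (insert s T) d ?p = s" using T'.next_time_back[OF d, of s] by simp
    have "\<not> crossing E \<omega> x s y m" for y m using crossing_V[of x s y m] False by blast
    then have "T'.step ?w = z" using T'.step_regular[of x d ?p] unfolding pn zz(1) by blast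
    then have "in_orbit T'.step ?w z" using in_orbit_step[OF in_orbit_refl] by metis
    then have l: "loop_of E \<omega> z = loop_of E \<omega> ?w" by (rule T'.loop_of_orbit[OF w'])
    have "?p \<noteq> s"
    proof
      assume ps: "?p = s"
      obtain t where t: "t \<in> T" using T_ne by blast
      let ?q = "1 - frac (- d * (s - t))"
      have ft: "frac (s + - d * ?q) = t" by (rule distance_along_circle[OF d]) (use t T_circle in auto)
      have q1: "0 < ?q" "?q \<le> 1" using frac_lt_1[of "- d * (s - t)"] frac_ge_0[of "- d * (s - t)"] by simp_all
      have qg: "?q \<noteq> gap (insert s T) (- d) s" using ft ps t False unfolding next_time_def by auto
      have "\<not> ?q < gap (insert s T) (- d) s" using T'.gap_free[OF d q1(1), of s] ft t by auto
      then have g: "gap (insert s T) (- d) s < ?q" using qg by simp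
      then have g1: "gap (insert s T) (- d) s < 1" using q1(2) by (rule less_le_trans)
      have "frac (s + - d * gap (insert s T) (- d) s) = s" using ps unfolding next_time_def .
      from distance_along_circle_unique[OF d T'.gap_pos T'.gap_le_1 this] show False using g1 by simp
    qed
    then have "?w \<in> half_edges V T" using w' unfolding half_edges_def by auto
    then show ?thesis using l by auto
  qed
qed

lemma half_edges_states: "half_edges V T \<subseteq> states V"
  using T_circle unfolding half_edges_def states_def by auto

lemma loops_half_edges: "loops V E \<omega> = loop_of E \<omega> ` half_edges V T"
proof
  show "loops V E \<omega> \<subseteq> loop_of E \<omega> ` half_edges V T"
    unfolding loops_def using loop_through_state by (metis (no_types, lifting) image_iff image_subsetI)
  show "loop_of E \<omega> ` half_edges V T \<subseteq> loops V E \<omega>"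
    unfolding loops_def using half_edges_states by (rule image_mono)
qed

lemma loop_number_component_number:
  "loop_number V E \<omega> = component_number (half_edges V T) (along T) (across E \<omega>)"
proof -
  have *: "card (f ` H) = card (g ` H)" if "\<And>x y. x \<in> H \<Longrightarrow> y \<in> H \<Longrightarrow> f x = f y \<longleftrightarrow> g x = g y"
    for f :: "'v state \<Rightarrow> 'c" and g :: "'v state \<Rightarrow> 'd" and H
  proof -
    have "bij_betw (\<lambda>v. g (inv_into H f v)) (f ` H) (g ` H)"
    proof (rule bij_betw_imageI)
      have inv: "inv_into H f (f x) \<in> H" "f (inv_into H f (f x)) = f x" if "x \<in> H" for x
        using that by (auto intro: inv_into_into f_inv_into_f)
      have g: "g (inv_into H f (f x)) = g x" if "x \<in> H" for x
        using \<open>\<And>x y. x \<in> H \<Longrightarrow> y \<in> H \<Longrightarrow> f x = f y \<longleftrightarrow> g x = g y\<close>[OF inv(1)[OF that] that] inv(2)[OF that] by simp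
      show "inj_on (\<lambda>v. g (inv_into H f v)) (f ` H)"
        by (rule inj_onI) (use g that in auto)
      show "(\<lambda>v. g (inv_into H f v)) ` f ` H = g ` H"
        unfolding image_image by (rule image_cong[OF refl g])
    qed
    then show ?thesis by (rule bij_betw_same_card)
  qed
  show ?thesis
    unfolding loop_number_def loops_half_edges component_number_def
    by (rule *) (simp add: loop_of_eq_iff class_eq_iff[OF M.linked_equivalence])
qed

lemma passes_regular:
  assumes z: "z \<in> half_edges V T" and s: "s \<in> T" "s \<notin> mark_times E \<omega>"
  shows "passes E \<omega> z x s d \<longleftrightarrow> in_orbit step z (x, s, d)"
proof
  assume "passes E \<omega> z x s d"
  then obtain s' r where o: "in_orbit step z (x, s', d)" and r: "0 \<le> r" "r \<le> gap T d s'" "s = frac (s' + d * r)"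
    unfolding passes_iff[OF z] by blast
  have "(x, s', d) \<in> half_edges V T" by (rule orbit_in[OF z o])
  then have s': "s' \<in> T" "d \<in> {1, -1}" unfolding half_edges_def by auto
  show "in_orbit step z (x, s, d)"
  proof (cases "r = 0")
    case True
    then show ?thesis using o r(3) frac_T[OF s'(1)] by simp
  next
    case False
    then have n: "s = next_time T d s'" using partial_gap(2)[OF s'(2) _ r(2)] r s(1) by simp
    have "\<not> crossing E \<omega> x s y m" for y m
      using s(2) unfolding crossing_def mark_times_def by blast
    then have "step (x, s', d) = (x, s, d)" using step_regular[of x d s'] unfolding n by blast
    then show ?thesis using in_orbit_step[OF o] by simp
  qed
next
  assume "in_orbit step z (x, s, d)"
  then show "passes E \<omega> z x s d"
    unfolding passes_iff[OF z] using frac_T[OF s(1)] gap_pos[of d s] by (intro exI2[of _ s 0]) simp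
qed

text \<open>
  The state \<open>z\<close> may be at any time; including this time in \<open>T\<close> makes it a half-edge. Passing is
  independent of \<open>T\<close>, which allows to return to the original set.
\<close>

lemma common_loop_iff:
  assumes s: "s \<in> T" "s \<notin> mark_times E \<omega>" and x: "x \<in> V" and d: "d \<in> {1, -1}"
  shows "(\<exists>z\<in>states V. passes E \<omega> z x s d \<and> passes E \<omega> z y s d') \<longleftrightarrow> in_orbit step (x, s, d) (y, s, d')"
proof
  assume "\<exists>z\<in>states V. passes E \<omega> z x s d \<and> passes E \<omega> z y s d'"
  then obtain z where z: "z \<in> states V" "passes E \<omega> z x s d" "passes E \<omega> z y s d'" by blast
  obtain a c b where zz: "z = (a, c, b)" "a \<in> V" "0 \<le> c" "c < 1" "b \<in> {1, -1}"
    using z(1) unfolding states_def by auto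
  interpret T': sliced_config V E "insert c T" \<omega>
    by (rule sliced_config_insert[OF _ zz(3,4)]) unfold_locales
  have z': "z \<in> half_edges V (insert c T)" using zz unfolding half_edges_def by auto
  have s': "s \<in> insert c T" using s by simp
  have o: "in_orbit T'.step z (x, s, d)" "in_orbit T'.step z (y, s, d')"
    using z(2,3) T'.passes_regular[OF z' s' s(2)] by auto
  have "in_orbit T'.step (x, s, d) (y, s, d')"
    by (rule in_orbit_trans[OF T'.M.in_orbit_sym[OF z' o(1)] o(2)])
  moreover have "(x, s, d) \<in> half_edges V (insert c T)" by (rule T'.orbit_in[OF z' o(1)])
  ultimately have "passes E \<omega> (x, s, d) y s d'" using T'.passes_regular[OF _ s' s(2)] by blast
  moreover have "(x, s, d) \<in> half_edges V T" using s x d unfolding half_edges_def by auto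
  ultimately show "in_orbit step (x, s, d) (y, s, d')" using passes_regular[OF _ s] by blast
next
  assume o: "in_orbit step (x, s, d) (y, s, d')"
  have z: "(x, s, d) \<in> half_edges V T" using s x d unfolding half_edges_def by auto
  have "passes E \<omega> (x, s, d) x s d" "passes E \<omega> (x, s, d) y s d'"
    by (simp_all add: passes_regular[OF z s] o in_orbit_refl)
  then show "\<exists>z\<in>states V. passes E \<omega> z x s d \<and> passes E \<omega> z y s d'" using z half_edges_states by blast
qed

end


section \<open>The effect of one additional mark\<close>

definition add_mark :: "'v set \<Rightarrow> real \<times> mark \<Rightarrow> 'v config \<Rightarrow> 'v config" where
  "add_mark e p \<omega> = (\<lambda>e'. if e' = e then insert p (\<omega> e) else \<omega> e')"

lemma passes_direction:
  assumes z: "z \<in> states V" and p: "passes E \<omega> z x c d"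
  shows "d \<in> {1, -1}"
proof -
  obtain s where "(jump E \<omega>)\<^sup>*\<^sup>* z (x, s, d)" using p unfolding passes_def by blast
  then have "snd (snd (x, s, d)) \<in> {1, -1}"
  proof (induction rule: rtranclp_induct)
    case base
    then show ?case using z unfolding states_def by auto
  next
    case (step y w)
    from step.hyps(2) step.IH show ?case
    proof cases
      case (1 r x s d y' m)
      then show ?thesis using step.IH by (cases m) auto
    qed
  qed
  then show ?thesis by simp
qed

context sliced_config
begin

context
  fixes e a b s
  assumes e: "e \<in> E" "e = {a, b}" "a \<noteq> b" and s: "s \<in> T" "s \<notin> mark_times E \<omega>"
begin

lemma new_mark_V: "a \<in> V" "b \<in> V"
  using e edges by auto

lemma regular_slice: "\<not> crossing E \<omega> x s y m"
  using s(2) unfolding crossing_def mark_times_def by blast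

lemma across_slice: "across E \<omega> (x, s, d) = (x, s, - d)"
  by (rule across_regular[OF regular_slice])

lemma add_mark_sliced: "sliced_config V E T (add_mark e (s, m) \<omega>)"
proof unfold_locales
  have *: "m1 \<in> add_mark e (s, m) \<omega> e1 \<longleftrightarrow> m1 \<in> \<omega> e1 \<or> e1 = e \<and> m1 = (s, m)" for m1 e1
    unfolding add_mark_def by auto
  have no: "(s, m1) \<notin> \<omega> e1" if "e1 \<in> E" for m1 e1
    using s(2) that unfolding mark_times_def by blast
  show "distinct_times E (add_mark e (s, m) \<omega>)"
    unfolding distinct_times_def *
  proof (intro ballI allI impI)
    fix e1 e2 c m1 m2
    assume e12: "e1 \<in> E" "e2 \<in> E"
      and c: "((c, m1) \<in> \<omega> e1 \<or> e1 = e \<and> (c, m1) = (s, m)) \<and> ((c, m2) \<in> \<omega> e2 \<or> e2 = e \<and> (c, m2) = (s, m))"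
    show "e1 = e2 \<and> m1 = m2"
    proof (cases "c = s")
      case True
      then show ?thesis using c no e12 by auto
    next
      case False
      then have "(c, m1) \<in> \<omega> e1" "(c, m2) \<in> \<omega> e2" using c by auto
      then show ?thesis using distinct e12 unfolding distinct_times_def by blast
    qed
  qed
  show "mark_times E (add_mark e (s, m) \<omega>) \<subseteq> T"
    using marks_T s(1) unfolding mark_times_def * by auto
qed

lemma crossing_add_mark:
  "crossing E (add_mark e (s, m) \<omega>) x c y k \<longleftrightarrow> crossing E \<omega> x c y k \<or> ({x, y} = e \<and> c = s \<and> k = m)"
  unfolding crossing_def add_mark_def using e(1) by auto

lemma across_add_mark_new:
  "across E (add_mark e (s, m) \<omega>) (a, s, d) = (b, s, turn m (- d))"
  "across E (add_mark e (s, m) \<omega>) (b, s, d) = (a, s, turn m (- d))"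
proof -
  have "crossing E (add_mark e (s, m) \<omega>) a s b m" "crossing E (add_mark e (s, m) \<omega>) b s a m"
    unfolding crossing_add_mark using e(2) by (simp_all add: insert_commute)
  then show "across E (add_mark e (s, m) \<omega>) (a, s, d) = (b, s, turn m (- d))"
    "across E (add_mark e (s, m) \<omega>) (b, s, d) = (a, s, turn m (- d))"
    by (simp_all add: sliced_config.across_crossing[OF add_mark_sliced])
qed

lemma across_add_mark_old:
  assumes "c \<noteq> s \<or> x \<notin> {a, b}"
  shows "across E (add_mark e (s, m) \<omega>) (x, c, d) = across E \<omega> (x, c, d)"
proof -
  have eq: "crossing E (add_mark e (s, m) \<omega>) x c y k \<longleftrightarrow> crossing E \<omega> x c y k" for y k
    using assms e(2) unfolding crossing_add_mark by auto
  show ?thesis unfolding across_def prod.case eq ..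
qed

text \<open>
  A particle that goes upwards at \<open>a\<close> jumps at the new mark to \<open>b\<close> and leaves along \<open>q\<close>. The new mark thus
  turns the pairs \<open>{p, across p}, {q, across q}\<close> into \<open>{p, across q}, {q, across p}\<close>.
\<close>

lemma loop_number_rewire:
  fixes m :: mark
  defines "p \<equiv> (a, s, 1)" and "q \<equiv> (b, s, turn m 1)"
  shows "in_orbit step p q \<Longrightarrow> loop_number V E (add_mark e (s, m) \<omega>) = loop_number V E \<omega> + 1"
    and "\<not> in_orbit step p q \<Longrightarrow>
      loop_number V E (add_mark e (s, m) \<omega>) + of_bool (\<not> linked (along T) (across E \<omega>) p q) = loop_number V E \<omega>"
proof -
  let ?\<beta>' = "across E (add_mark e (s, m) \<omega>)"
  interpret S': sliced_config V E T "add_mark e (s, m) \<omega>" by (rule add_mark_sliced)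
  have MM: "two_matchings (half_edges V T) (along T) (across E \<omega>)"
    "two_matchings (half_edges V T) (along T) ?\<beta>'"
    by unfold_locales
  have turn1: "turn m 1 \<in> {1, -1}" by (cases m) auto
  have pq: "p \<in> half_edges V T" "q \<in> half_edges V T" "q \<noteq> p" "q \<noteq> across E \<omega> p"
    using new_mark_V s(1) e(3) turn1 unfolding p_def q_def half_edges_def across_slice by auto
  have new: "?\<beta>' p = across E \<omega> q" "?\<beta>' q = across E \<omega> p"
    unfolding p_def q_def across_slice across_add_mark_new by (cases m; simp)+
  have old: "?\<beta>' x = across E \<omega> x" if x: "x \<in> half_edges V T" "x \<notin> {p, q, across E \<omega> p, across E \<omega> q}" for x
  proof -
    obtain v c d where v: "x = (v, c, d)" "d \<in> {1, -1}" using x(1) unfolding half_edges_def by blast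
    have "c \<noteq> s \<or> v \<notin> {a, b}"
      using x(2) v(2) unfolding v(1) p_def q_def across_slice by (cases m) auto
    then show ?thesis unfolding v(1) by (rule across_add_mark_old)
  qed
  note rw = component_number_rewire[OF MM pq(1,2) new old, folded loop_number_component_number S'.loop_number_component_number]
    and rl = rewire_linked[OF MM pq new old]
  show "loop_number V E (add_mark e (s, m) \<omega>) = loop_number V E \<omega> + 1" if "in_orbit step p q"
    using rw rl that in_orbit_imp_linked[OF that] by simp
  show "loop_number V E (add_mark e (s, m) \<omega>) + of_bool (\<not> linked (along T) (across E \<omega>) p q) = loop_number V E \<omega>"
    if "\<not> in_orbit step p q"
    using rw rl that by simp
qed

lemma orbit_slice:
  assumes "x \<in> V" "d \<in> {1, -1}" "in_orbit step (x, s, d) (y, s, d')"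
  shows "in_orbit step (y, s, d') (x, s, d)" "in_orbit step (x, s, - d) (y, s, - d')"
proof -
  have x: "(x, s, d) \<in> half_edges V T" using assms s unfolding half_edges_def by auto
  show "in_orbit step (y, s, d') (x, s, d)" by (rule M.in_orbit_sym[OF x assms(3)])
  show "in_orbit step (x, s, - d) (y, s, - d')"
    using M.in_orbit_reversal(2)[OF x assms(3)] unfolding across_slice .
qed

text \<open>
  Reversing the traversal makes the first direction equal to 1, and cyclicity of orbits exchanges the
  two ends of the edge.
\<close>

lemma slice_orbit_iff:
  assumes c: "c \<in> {1, -1}"
  shows "(\<exists>x y d. e = {x, y} \<and> x \<noteq> y \<and> (\<exists>z\<in>states V. passes E \<omega> z x s d \<and> passes E \<omega> z y s (c * d)))
      \<longleftrightarrow> in_orbit step (a, s, 1) (b, s, c)" (is "?L \<longleftrightarrow> ?R")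
proof
  assume ?L
  then obtain x y d z where xy: "e = {x, y}" and z: "z \<in> states V" "passes E \<omega> z x s d" "passes E \<omega> z y s (c * d)" by blast
  have d: "d \<in> {1, -1}" by (rule passes_direction[OF z(1,2)])
  have V: "x \<in> V" "y \<in> V" using xy e new_mark_V by (metis doubleton_eq_iff)+
  have o: "in_orbit step (x, s, d) (y, s, c * d)" using common_loop_iff[OF s V(1) d] z by blast
  have o1: "in_orbit step (x, s, 1) (y, s, c)" using o orbit_slice(2)[OF V(1) d o] d by auto
  have o2: "in_orbit step (y, s, c) (x, s, 1)" using orbit_slice(1)[OF V(1) _ o1] by simp
  have "in_orbit step (y, s, 1) (x, s, c)" using o2 orbit_slice(2)[OF V(2) c o2] c by auto
  then show ?R using o1 xy e(2) by (auto simp: doubleton_eq_iff)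
next
  assume ?R
  then have "\<exists>z\<in>states V. passes E \<omega> z a s 1 \<and> passes E \<omega> z b s (c * 1)"
    using common_loop_iff[OF s new_mark_V(1), of 1] by simp
  then show ?L using e by blast
qed

lemma I_plus_iff: "I_plus V E \<omega> e s = of_bool (in_orbit step (a, s, 1) (b, s, 1))"
  using slice_orbit_iff[of 1] s(2) unfolding I_plus_def by simp

lemma I_minus_iff: "I_minus V E \<omega> e s = of_bool (in_orbit step (a, s, 1) (b, s, -1))"
  using slice_orbit_iff[of "-1"] s(2) unfolding I_minus_def by simp

text \<open>
  A cross splits the loop if upward motion at \<open>a\<close> leads to upward motion at \<open>b\<close>, a bar if it leads to downward
  motion at \<open>b\<close>. Not both can happen, since an orbit does not contain a half-edge together with
  its reversal. If neither happens, \<open>a\<close> and \<open>b\<close> are in different loops.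
\<close>

lemma loop_number_add_mark_cases:
  "(I_plus V E \<omega> e s = 1 \<and> I_minus V E \<omega> e s = 0 \<and>
      loop_number V E (add_mark e (s, Cross) \<omega>) = loop_number V E \<omega> + 1 \<and>
      loop_number V E (add_mark e (s, Bar) \<omega>) = loop_number V E \<omega>) \<or>
   (I_plus V E \<omega> e s = 0 \<and> I_minus V E \<omega> e s = 1 \<and>
      loop_number V E (add_mark e (s, Cross) \<omega>) = loop_number V E \<omega> \<and>
      loop_number V E (add_mark e (s, Bar) \<omega>) = loop_number V E \<omega> + 1) \<or>
   (I_plus V E \<omega> e s = 0 \<and> I_minus V E \<omega> e s = 0 \<and>
      loop_number V E (add_mark e (s, Cross) \<omega>) + 1 = loop_number V E \<omega> \<and>
      loop_number V E (add_mark e (s, Bar) \<omega>) + 1 = loop_number V E \<omega>)"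
proof -
  let ?p = "(a, s, 1)"
  let ?P = "in_orbit step ?p (b, s, 1)" and ?M = "in_orbit step ?p (b, s, -1)"
  have p: "?p \<in> half_edges V T" and q: "(b, s, 1) \<in> half_edges V T" "(b, s, -1) \<in> half_edges V T"
    using new_mark_V s unfolding half_edges_def by auto
  have not_both: "\<not> (?P \<and> ?M)"
  proof
    assume "?P \<and> ?M"
    then have "in_orbit step (b, s, 1) (b, s, -1)"
      using in_orbit_trans[OF M.in_orbit_sym[OF p]] by blast
    then show False
      using M.reversal_notin_orbit[OF q(1)] unfolding in_orbit_def across_slice by metis
  qed
  have linked: "linked (along T) (across E \<omega>) ?p (b, s, 1) \<longleftrightarrow> ?P \<or> ?M"
    "linked (along T) (across E \<omega>) ?p (b, s, -1) \<longleftrightarrow> ?P \<or> ?M"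
    using M.linked_iff_orbit[OF p q(1)] M.linked_iff_orbit[OF p q(2)] unfolding across_slice by auto
  note C = loop_number_rewire[of Cross] and B = loop_number_rewire[of Bar]
  note CB = C[unfolded turn.simps linked] B[unfolded turn.simps linked]
  show ?thesis
    unfolding I_plus_iff I_minus_iff
    using not_both CB by (cases ?P; cases ?M) auto
qed

end

text \<open>
  Order-preserving changes of time are isomorphisms of the pairs of matchings.
\<close>

lemma loop_number_time_change:
  assumes mono: "strict_mono_on T \<phi>" and img: "\<phi> ` T \<subseteq> {0..<1}"
    and \<omega>': "\<And>e. e \<in> E \<Longrightarrow> \<omega>' e = map_prod \<phi> id ` \<omega> e"
  shows "loop_number V E \<omega>' = loop_number V E \<omega>"
proof -
  have inj: "inj_on \<phi> T" using mono by (rule strict_mono_on_imp_inj_on)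
  have mark: "(s, m) \<in> \<omega>' e \<longleftrightarrow> (\<exists>c\<in>T. s = \<phi> c \<and> (c, m) \<in> \<omega> e)" if "e \<in> E" for s m e
    unfolding \<omega>'[OF that] using marks_T that unfolding mark_times_def by force
  interpret S': sliced_config V E "\<phi> ` T" \<omega>'
  proof unfold_locales
    show "distinct_times E \<omega>'"
      unfolding distinct_times_def
    proof (intro ballI allI impI)
      fix e1 e2 c m1 m2 assume e12: "e1 \<in> E" "e2 \<in> E" and c: "(c, m1) \<in> \<omega>' e1 \<and> (c, m2) \<in> \<omega>' e2"
      then obtain c1 c2 where "c1 \<in> T" "c = \<phi> c1" "(c1, m1) \<in> \<omega> e1" "c2 \<in> T" "c = \<phi> c2" "(c2, m2) \<in> \<omega> e2"
        using mark by meson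
      then show "e1 = e2 \<and> m1 = m2"
        using inj_onD[OF inj, of c1 c2] distinct e12 unfolding distinct_times_def by blast
    qed
    show "mark_times E \<omega>' \<subseteq> \<phi> ` T" unfolding mark_times_def using mark by auto
  qed (use finite_T T_ne img in auto)
  let ?\<Phi> = "\<lambda>(x, s, d). (x, \<phi> s, d)"
  have crossing: "crossing E \<omega>' x (\<phi> s) y m \<longleftrightarrow> crossing E \<omega> x s y m" if "s \<in> T" for x s y m
    unfolding crossing_def using mark that inj_onD[OF inj _ that] by blast
  have half: "half_edges V (\<phi> ` T) = ?\<Phi> ` half_edges V T"
    unfolding half_edges_def by (auto simp: image_iff)
  have "component_number (?\<Phi> ` half_edges V T) (along (\<phi> ` T)) (across E \<omega>')
      = component_number (half_edges V T) (along T) (across E \<omega>)"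
  proof (rule component_number_bij)
    show "two_matchings (half_edges V T) (along T) (across E \<omega>)" by unfold_locales
    show "inj_on ?\<Phi> (half_edges V T)"
      by (rule inj_onI) (auto simp: half_edges_def dest: inj_onD[OF inj])
    fix z assume "z \<in> half_edges V T"
    then obtain x s d where z: "z = (x, s, d)" "s \<in> T" "d \<in> {1, -1}" unfolding half_edges_def by blast
    have "next_time (\<phi> ` T) d (\<phi> s) = \<phi> (next_time T d s)"
      by (rule next_time_mono_image[OF _ _ mono z(3,2)]) unfold_locales
    then show "along (\<phi> ` T) (?\<Phi> z) = ?\<Phi> (along T z)" unfolding z along_def by simp
    show "across E \<omega>' (?\<Phi> z) = ?\<Phi> (across E \<omega> z)"
    proof (cases "\<exists>y m. crossing E \<omega> x s y m")
      case True
      then obtain y m where c: "crossing E \<omega> x s y m" by blast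
      then have c': "crossing E \<omega>' x (\<phi> s) y m" using crossing[OF z(2)] by simp
      show ?thesis unfolding z using across_crossing[OF c] S'.across_crossing[OF c'] by simp
    next
      case False
      then have "\<And>y m. \<not> crossing E \<omega> x s y m" "\<And>y m. \<not> crossing E \<omega>' x (\<phi> s) y m"
        using crossing[OF z(2)] by simp_all
      then show ?thesis unfolding z using across_regular[of x s d] S'.across_regular[of x "\<phi> s" d] by simp
    qed
  qed
  then show ?thesis
    unfolding loop_number_component_number S'.loop_number_component_number half .
qed

lemma loop_number_le: "loop_number V E \<omega> \<le> 2 * card V * card T"
proof -
  have "loop_number V E \<omega> \<le> card (half_edges V T)"
    unfolding loop_number_component_number by (rule component_number_le[OF M.finite_D])
  also have "card (half_edges V T) = 2 * card V * card T"
    unfolding half_edges_def by (simp add: card_cartesian_product)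
  finally show ?thesis .
qed

end


section \<open>Configurations and void events\<close>

lemma eventually_inj_on_floor:
  assumes "finite S"
  shows "\<forall>\<^sub>F k in sequentially. inj_on (\<lambda>s. \<lfloor>2 ^ k * s :: real\<rfloor>) S"
proof -
  have *: "\<forall>\<^sub>F k in sequentially. s < t \<longrightarrow> \<lfloor>2 ^ k * s\<rfloor> < \<lfloor>2 ^ k * t\<rfloor>" for s t :: real
  proof (cases "s < t")
    case True
    obtain n where n: "1 / (t - s) < 2 ^ n" using real_arch_pow[of 2 "1 / (t - s)"] by auto
    have "\<forall>\<^sub>F k in sequentially. 1 / (t - s) \<le> (2 ^ k :: real)"
    proof (rule eventually_sequentiallyI)
      fix k assume "n \<le> k"
      then have "2 ^ n \<le> (2 ^ k :: real)" by (intro power_increasing) auto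
      then show "1 / (t - s) \<le> (2 ^ k :: real)" using n by linarith
    qed
    then show ?thesis
    proof eventually_elim
      case (elim k)
      then have "2 ^ k * s + 1 \<le> 2 ^ k * t" using True by (simp add: field_simps)
      then have "\<lfloor>2 ^ k * s + 1\<rfloor> \<le> \<lfloor>2 ^ k * t\<rfloor>" by (rule floor_mono)
      then show ?case by simp
    qed
  qed simp
  have "\<forall>\<^sub>F k in sequentially. \<forall>s\<in>S. \<forall>t\<in>S. s < t \<longrightarrow> \<lfloor>2 ^ k * s\<rfloor> < \<lfloor>2 ^ k * t\<rfloor>"
    using * assms by (simp add: eventually_ball_finite_distrib)
  then show ?thesis
  proof eventually_elim
    case (elim k)
    show ?case
    proof (rule inj_onI)
      fix s t assume st: "s \<in> S" "t \<in> S" "\<lfloor>2 ^ k * s\<rfloor> = \<lfloor>2 ^ k * t\<rfloor>"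
      then show "s = t" using elim by (cases s t rule: linorder_cases) fastforce+
    qed
  qed
qed

text \<open>
  All mark intensities have this sigma-algebra, so their spaces of configurations coincide.
\<close>

definition mark_space :: "(real \<times> mark) measure" where
  "mark_space = circle \<Otimes>\<^sub>M count_space UNIV"

lemma space_circle: "space circle = {0..<1}"
  unfolding circle_def by (simp add: space_restrict_space)

lemma sets_circleI: "A \<in> sets borel \<Longrightarrow> A \<subseteq> {0..<1} \<Longrightarrow> A \<in> sets circle"
  unfolding circle_def by (subst sets_restrict_space_iff) auto

lemma space_mark_space: "space mark_space = {0..<1} \<times> UNIV"
  unfolding mark_space_def by (simp add: space_pair_measure space_circle)

lemma sets_mark_intensity: "sets (mark_intensity t u) = sets mark_space"
  unfolding mark_intensity_def mark_space_def
  by (rule sets_pair_measure_cong) (simp_all add: sets_point_measure)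

lemma configurations_mark_intensity: "configurations (mark_intensity t u) = configurations mark_space"
  unfolding configurations_def sets_mark_intensity sets_eq_imp_space_eq[OF sets_mark_intensity] ..

abbreviation mark_configs :: "(real \<times> mark) set measure" where
  "mark_configs \<equiv> configurations mark_space"

lemma space_mark_configs:
  "space mark_configs = {\<eta>. finite \<eta> \<and> \<eta> \<subseteq> {0..<1} \<times> UNIV}"
  unfolding configurations_def by (subst space_measure_of) (auto simp: space_mark_space)

lemma sets_count_event:
  assumes "B \<in> sets mark_space"
  shows "{\<eta> \<in> space mark_configs. card (\<eta> \<inter> B) = k} \<in> sets mark_configs"
proof -
  have "{\<eta>. finite \<eta> \<and> \<eta> \<subseteq> space mark_space \<and> card (\<eta> \<inter> B) = k} \<in> sets mark_configs"
    unfolding configurations_def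
    by (subst sets_measure_of) (use assms in \<open>auto intro!: sigma_sets.Basic\<close>)
  then show ?thesis unfolding space_mark_configs space_mark_space by (simp add: conj_assoc)
qed

lemma void_event_eq:
  "{\<eta> \<in> space mark_configs. \<eta> \<inter> B = {}} = {\<eta> \<in> space mark_configs. card (\<eta> \<inter> B) = 0}"
  by (auto simp: space_mark_configs)

lemma sets_void_event:
  "B \<in> sets mark_space \<Longrightarrow> {\<eta> \<in> space mark_configs. \<eta> \<inter> B = {}} \<in> sets mark_configs"
  unfolding void_event_eq by (rule sets_count_event)

definition cell :: "nat \<Rightarrow> int \<Rightarrow> mark \<Rightarrow> (real \<times> mark) set" where
  "cell k j m = {s \<in> {0..<1}. \<lfloor>2 ^ k * s\<rfloor> = j} \<times> {m}"

lemma sets_cell: "cell k j m \<in> sets mark_space"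
proof -
  have "{s. \<lfloor>2 ^ k * s :: real\<rfloor> = j} \<in> sets borel"
    using measurable_sets_borel[of "\<lambda>s::real. \<lfloor>2 ^ k * s\<rfloor>" "count_space UNIV" "{j}"]
    by (simp add: vimage_def)
  moreover have "{s \<in> {0..<1}. \<lfloor>2 ^ k * s :: real\<rfloor> = j} = {0..<1} \<inter> {s. \<lfloor>2 ^ k * s :: real\<rfloor> = j}" by auto
  ultimately have "{s \<in> {0..<1}. \<lfloor>2 ^ k * s :: real\<rfloor> = j} \<in> sets borel" by simp
  then show ?thesis unfolding cell_def mark_space_def by (intro pair_measureI sets_circleI) auto
qed

lemma UNIV_mark: "UNIV = {Cross, Bar}"
  using mark.exhaust by auto

lemma finite_UNIV_mark: "finite (UNIV :: mark set)"
  unfolding UNIV_mark by simp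

lemma cell_index_range:
  assumes "0 \<le> s" "s < (1::real)"
  shows "\<lfloor>2 ^ k * s\<rfloor> \<in> {0..<2 ^ k}"
proof -
  have "2 ^ k * s < 2 ^ k" using assms by simp
  then have "\<lfloor>2 ^ k * s\<rfloor> < 2 ^ k" by (simp add: floor_less_iff)
  then show ?thesis using assms by simp
qed

text \<open>
  Fine cells contain at most one point each, so counting points amounts to counting occupied cells.
\<close>

lemma card_eq_limit_of_cells:
  assumes \<eta>: "finite \<eta>" "\<eta> \<subseteq> {0..<1} \<times> UNIV"
  shows "\<forall>\<^sub>F k in sequentially.
    real (card \<eta>) = (\<Sum>j\<in>{0..<2 ^ k}. \<Sum>m\<in>UNIV. of_bool (\<eta> \<inter> cell k j m \<noteq> {}))"
proof -
  have "\<forall>\<^sub>F k in sequentially. inj_on (\<lambda>s. \<lfloor>2 ^ k * s :: real\<rfloor>) (fst ` \<eta>)"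
    by (rule eventually_inj_on_floor) (use \<eta> in simp)
  then show ?thesis
  proof eventually_elim
    case (elim k)
    let ?c = "\<lambda>(s, m). (\<lfloor>2 ^ k * s :: real\<rfloor>, m :: mark)"
    have "inj_on ?c \<eta>"
    proof (rule inj_onI)
      fix p q assume pq: "p \<in> \<eta>" "q \<in> \<eta>" "?c p = ?c q"
      then have "fst p = fst q" using inj_onD[OF elim, of "fst p" "fst q"] by (auto split: prod.splits)
      then show "p = q" using pq(3) by (auto split: prod.splits)
    qed
    then have "card \<eta> = card (?c ` \<eta>)" by (simp add: card_image)
    also have "?c ` \<eta> = {x \<in> {0..<2 ^ k} \<times> UNIV. \<eta> \<inter> cell k (fst x) (snd x) \<noteq> {}}"
    proof (intro equalityI subsetI)
      fix x assume "x \<in> ?c ` \<eta>"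
      then obtain s m where sm: "(s, m) \<in> \<eta>" "x = (\<lfloor>2 ^ k * s\<rfloor>, m)" by auto
      then have s: "0 \<le> s" "s < 1" using \<eta> by auto
      have "(s, m) \<in> \<eta> \<inter> cell k (fst x) (snd x)" using sm s unfolding cell_def by simp
      then show "x \<in> {x \<in> {0..<2 ^ k} \<times> UNIV. \<eta> \<inter> cell k (fst x) (snd x) \<noteq> {}}"
        using cell_index_range[OF s, of k] sm by auto
    next
      fix x assume "x \<in> {x \<in> {0..<2 ^ k} \<times> UNIV. \<eta> \<inter> cell k (fst x) (snd x) \<noteq> {}}"
      then obtain p where "p \<in> \<eta>" "p \<in> cell k (fst x) (snd x)" by blast
      then show "x \<in> ?c ` \<eta>" unfolding cell_def by (intro image_eqI[of _ _ p]) auto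
    qed
    also have "real (card \<dots>) = (\<Sum>x\<in>{0..<2 ^ k} \<times> UNIV. of_bool (\<eta> \<inter> cell k (fst x) (snd x) \<noteq> {}))"
      by (subst sum_of_bool_eq) (auto simp: finite_UNIV_mark Int_def)
    also have "\<dots> = (\<Sum>j\<in>{0..<2 ^ k}. \<Sum>m\<in>UNIV. of_bool (\<eta> \<inter> cell k j m \<noteq> {}))"
      by (simp add: sum.cartesian_product case_prod_unfold)
    finally show ?case .
  qed
qed

text \<open>
  The void events generate the sigma-algebra of the counting events, because the numbers of points are limits
  of numbers of occupied cells.
\<close>

lemma measurable_mark_configsI:
  assumes f: "\<And>x. x \<in> space M \<Longrightarrow> finite (f x) \<and> f x \<subseteq> {0..<1} \<times> UNIV"
    and void: "\<And>B. B \<in> sets mark_space \<Longrightarrow> {x \<in> space M. f x \<inter> B = {}} \<in> sets M"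
  shows "f \<in> measurable M mark_configs"
  unfolding configurations_def
proof (rule measurable_measure_of)
  show "f \<in> space M \<rightarrow> {\<eta>. finite \<eta> \<and> \<eta> \<subseteq> space mark_space}"
    using f by (auto simp: space_mark_space)
  fix A assume "A \<in> {{\<eta>. finite \<eta> \<and> \<eta> \<subseteq> space mark_space \<and> card (\<eta> \<inter> B) = k} | B k. B \<in> sets mark_space}"
  then obtain B k where A: "A = {\<eta>. finite \<eta> \<and> \<eta> \<subseteq> space mark_space \<and> card (\<eta> \<inter> B) = k}" and B: "B \<in> sets mark_space"
    by blast
  define N where "N i x = (\<Sum>j\<in>{0..<2 ^ i}. \<Sum>m\<in>UNIV. of_bool (f x \<inter> B \<inter> cell i j m \<noteq> {}) :: real)" for i x
  have meas: "N i \<in> borel_measurable M" for i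
  proof -
    have "(\<lambda>x. of_bool (f x \<inter> B \<inter> cell i j m \<noteq> {}) :: real) \<in> borel_measurable M" for j m
    proof -
      have "{x \<in> space M. f x \<inter> (B \<inter> cell i j m) = {}} \<in> sets M"
        by (rule void) (use B sets_cell in auto)
      then have "Measurable.pred M (\<lambda>x. f x \<inter> B \<inter> cell i j m \<noteq> {})"
        by (simp add: Int_assoc pred_def[symmetric])
      then show ?thesis by measurable
    qed
    then show ?thesis unfolding N_def by (intro borel_measurable_sum)
  qed
  have "(\<lambda>x. real (card (f x \<inter> B))) \<in> borel_measurable M"
  proof (rule borel_measurable_LIMSEQ_real[OF _ meas])
    fix x assume x: "x \<in> space M"
    have "\<forall>\<^sub>F i in sequentially. real (card (f x \<inter> B)) = N i x"
      unfolding N_def by (rule card_eq_limit_of_cells) (use f[OF x] in auto)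
    then show "(\<lambda>i. N i x) \<longlonglongrightarrow> real (card (f x \<inter> B))"
      by (intro tendsto_eventually) (auto elim!: eventually_mono)
  qed
  then have "{x \<in> space M. real (card (f x \<inter> B)) = real k} \<in> sets M" by measurable
  moreover have "f -` A \<inter> space M = {x \<in> space M. real (card (f x \<inter> B)) = real k}"
    unfolding A using f by (auto simp: space_mark_space)
  ultimately show "f -` A \<inter> space M \<in> sets M" by simp
qed (auto)

abbreviation graph_configs :: "'v set set \<Rightarrow> 'v config measure" where
  "graph_configs E \<equiv> Pi\<^sub>M E (\<lambda>_. mark_configs)"

lemma space_graph_configs:
  "space (graph_configs E) = (\<Pi>\<^sub>E e\<in>E. {\<eta>. finite \<eta> \<and> \<eta> \<subseteq> {0..<1} \<times> UNIV})"
  by (simp add: space_PiM space_mark_configs)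

definition void_event :: "'v set set \<Rightarrow> ('v set \<Rightarrow> (real \<times> mark) set) \<Rightarrow> 'v config set" where
  "void_event E B = {\<omega> \<in> space (graph_configs E). \<forall>e\<in>E. \<omega> e \<inter> B e = {}}"

lemma void_event_PiE:
  "void_event E B = (\<Pi>\<^sub>E e\<in>E. {\<eta> \<in> space mark_configs. \<eta> \<inter> B e = {}})"
  unfolding void_event_def space_PiM PiE_def Pi_def by blast

lemma sets_graph_void_event:
  assumes "finite E" "\<And>e. e \<in> E \<Longrightarrow> B e \<in> sets mark_space"
  shows "void_event E B \<in> sets (graph_configs E)"
  unfolding void_event_PiE using assms by (intro sets_PiM_I_finite sets_void_event)

lemma graph_configs_measurableI:
  assumes f: "\<And>x. x \<in> space M \<Longrightarrow> f x \<in> space (graph_configs E)"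
    and void: "\<And>e B. e \<in> E \<Longrightarrow> B \<in> sets mark_space \<Longrightarrow> {x \<in> space M. f x e \<inter> B = {}} \<in> sets M"
  shows "f \<in> measurable M (graph_configs E)"
proof -
  have "(\<lambda>x e. f x e) \<in> measurable M (graph_configs E)"
  proof (rule measurable_PiM_single')
    show "(\<lambda>x. f x e) \<in> measurable M mark_configs" if "e \<in> E" for e
      by (rule measurable_mark_configsI[OF _ void[OF that]])
         (use f that in \<open>auto simp: space_graph_configs\<close>)
    show "(\<lambda>x e. f x e) \<in> space M \<rightarrow> (\<Pi>\<^sub>E e\<in>E. space mark_configs)"
      using f by (simp add: space_PiM)
  qed
  then show ?thesis .
qed

text \<open>
  The intersection of two void events is the void event of the union, so they form a generator to which
  the uniqueness theorem for measures applies.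
\<close>

lemma measure_eq_graph_void_events:
  assumes E: "finite E" and M: "finite_measure M" "sets M = sets (graph_configs E)"
    and N: "sets N = sets (graph_configs E)"
    and eq: "\<And>B. (\<And>e. e \<in> E \<Longrightarrow> B e \<in> sets mark_space) \<Longrightarrow> emeasure M (void_event E B) = emeasure N (void_event E B)"
  shows "M = N"
proof -
  interpret M: finite_measure M by fact
  let ?\<Omega> = "space (graph_configs E)"
  define G where "G = {void_event E B | B. \<forall>e\<in>E. B e \<in> sets mark_space}"
  have G: "G \<subseteq> Pow ?\<Omega>" unfolding G_def void_event_def by blast
  have G_sets: "G \<subseteq> sets (graph_configs E)"
    unfolding G_def using sets_graph_void_event[OF E] by blast
  have "Int_stable G"
  proof (rule Int_stableI)
    fix a b assume "a \<in> G" "b \<in> G"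
    then obtain A B where AB: "a = void_event E A" "b = void_event E B"
      "\<forall>e\<in>E. A e \<in> sets mark_space" "\<forall>e\<in>E. B e \<in> sets mark_space" unfolding G_def by blast
    have "a \<inter> b = void_event E (\<lambda>e. A e \<union> B e)" unfolding AB void_event_def by auto
    then show "a \<inter> b \<in> G" unfolding G_def using AB(3,4) by (intro CollectI exI[of _ "\<lambda>e. A e \<union> B e"]) auto
  qed
  have gen: "sets (graph_configs E) = sigma_sets ?\<Omega> G"
  proof
    show "sigma_sets ?\<Omega> G \<subseteq> sets (graph_configs E)"
      by (rule sets.sigma_sets_subset[OF G_sets])
    have "(\<lambda>\<omega>. \<omega>) \<in> measurable (sigma ?\<Omega> G) (graph_configs E)"
    proof (rule graph_configs_measurableI)
      fix e B assume eB: "e \<in> E" "B \<in> sets mark_space"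
      have "{\<omega> \<in> ?\<Omega>. \<omega> e \<inter> B = {}} = void_event E (\<lambda>e'. if e' = e then B else {})"
        unfolding void_event_def using eB by auto
      also have "\<dots> \<in> G" unfolding G_def using eB by (intro CollectI exI[of _ "\<lambda>e'. if e' = e then B else {}"]) auto
      finally show "{x \<in> space (sigma ?\<Omega> G). x e \<inter> B = {}} \<in> sets (sigma ?\<Omega> G)"
        using G by (simp add: space_measure_of sets_measure_of sigma_sets.Basic)
    qed (use G in \<open>simp add: space_measure_of\<close>)
    then show "sets (graph_configs E) \<subseteq> sigma_sets ?\<Omega> G"
    proof (intro subsetI)
      fix A assume A: "A \<in> sets (graph_configs E)"
      assume id: "(\<lambda>\<omega>. \<omega>) \<in> measurable (sigma ?\<Omega> G) (graph_configs E)"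
      from measurable_sets[OF id A] have "A \<inter> ?\<Omega> \<in> sigma_sets ?\<Omega> G"
        using G by (simp add: space_measure_of sets_measure_of)
      then show "A \<in> sigma_sets ?\<Omega> G" using sets.sets_into_space[OF A] by (simp add: Int_absorb2)
    qed
  qed
  have top: "?\<Omega> \<in> G" unfolding G_def void_event_def by (intro CollectI exI[of _ "\<lambda>_. {}"]) auto
  show ?thesis
  proof (rule measure_eqI_generator_eq[OF \<open>Int_stable G\<close> G, where A = "\<lambda>_::nat. ?\<Omega>"])
    show "emeasure M X = emeasure N X" if "X \<in> G" for X using that eq unfolding G_def by blast
    show "sets M = sigma_sets ?\<Omega> G" "sets N = sigma_sets ?\<Omega> G" using M(2) N gen by simp_all
    show "range (\<lambda>_::nat. ?\<Omega>) \<subseteq> G" using top by simp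
  qed simp_all
qed


section \<open>The Poisson law as a mixture of independent samples\<close>

lemma prob_space_circle: "prob_space circle"
proof (rule prob_spaceI)
  have "emeasure circle (space circle) = emeasure lborel ({0..<1} :: real set)"
    unfolding space_circle unfolding circle_def by (subst emeasure_restrict_space) auto
  then show "emeasure circle (space circle) = 1" by simp
qed

definition mark_weight :: "real \<Rightarrow> mark \<Rightarrow> real" where
  "mark_weight u m = (case m of Cross \<Rightarrow> u | Bar \<Rightarrow> 1 - u)"

lemma mark_weight_measure:
  "point_measure UNIV (\<lambda>m. case m of Cross \<Rightarrow> ennreal u | Bar \<Rightarrow> ennreal (1 - u))
     = point_measure UNIV (\<lambda>m. ennreal (mark_weight u m))"
proof -
  have "(\<lambda>m. case m of Cross \<Rightarrow> ennreal u | Bar \<Rightarrow> ennreal (1 - u)) = (\<lambda>m. ennreal (mark_weight u m))"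
    by (rule ext) (simp add: mark_weight_def split: mark.split)
  then show ?thesis by simp
qed

locale mark_law =
  fixes u :: real
  assumes u: "0 \<le> u" "u \<le> 1"
begin

abbreviation types :: "mark measure" where
  "types \<equiv> point_measure UNIV (\<lambda>m. ennreal (mark_weight u m))"

lemma mark_weight_nonneg: "0 \<le> mark_weight u m"
  using u by (simp add: mark_weight_def split: mark.split)

lemma prob_space_types: "prob_space types"
proof (rule prob_spaceI)
  have "emeasure types UNIV = (\<Sum>m\<in>UNIV. ennreal (mark_weight u m))"
    by (rule emeasure_point_measure_finite) (simp_all add: finite_UNIV_mark)
  also have "\<dots> = ennreal u + ennreal (1 - u)" unfolding UNIV_mark by (simp add: mark_weight_def)
  also have "\<dots> = 1" using u by (simp flip: ennreal_plus)
  finally show "emeasure types (space types) = 1" by (simp add: space_point_measure)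
qed

definition mark_distribution :: "(real \<times> mark) measure" where
  "mark_distribution = circle \<Otimes>\<^sub>M types"

lemma mark_distribution_eq: "mark_distribution = mark_intensity 1 u"
  unfolding mark_distribution_def mark_intensity_def mark_weight_measure by (simp add: scale_measure_1)

lemma sets_mark_distribution [measurable_cong]: "sets mark_distribution = sets mark_space"
  unfolding mark_distribution_eq by (rule sets_mark_intensity)

lemma space_mark_distribution: "space mark_distribution = {0..<1} \<times> UNIV"
  using sets_eq_imp_space_eq[OF sets_mark_distribution] space_mark_space by simp

sublocale circle: prob_space circle by (rule prob_space_circle)
sublocale types: prob_space types by (rule prob_space_types)
sublocale circle_types: pair_prob_space circle types ..

sublocale mark_distribution: prob_space mark_distribution
  unfolding mark_distribution_def by unfold_locales

lemma emeasure_mark_intensity: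
  assumes "0 \<le> t" "B \<in> sets mark_space"
  shows "emeasure (mark_intensity t u) B = ennreal t * emeasure mark_distribution B"
proof -
  have B: "B \<in> sets (circle \<Otimes>\<^sub>M types)" "B \<in> sets (scale_measure (ennreal t) circle \<Otimes>\<^sub>M types)"
    using assms(2) sets_mark_distribution sets_mark_intensity[of t u]
    unfolding mark_distribution_def mark_intensity_def mark_weight_measure by auto
  have "emeasure (mark_intensity t u) B = (\<integral>\<^sup>+ s. emeasure types (Pair s -` B) \<partial>scale_measure (ennreal t) circle)"
    unfolding mark_intensity_def mark_weight_measure by (rule types.emeasure_pair_measure_alt[OF B(2)])
  also have "\<dots> = ennreal t * (\<integral>\<^sup>+ s. emeasure types (Pair s -` B) \<partial>circle)"
    by (rule nn_integral_scale_measure) (rule types.measurable_emeasure_Pair[OF B(1)])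
  also have "\<dots> = ennreal t * emeasure mark_distribution B"
    unfolding mark_distribution_def by (simp add: types.emeasure_pair_measure_alt[OF B(1)])
  finally show ?thesis .
qed

lemma integral_mark_distribution:
  fixes f :: "real \<times> mark \<Rightarrow> real"
  assumes f: "f \<in> borel_measurable mark_space" and bound: "\<And>s m. 0 \<le> s \<Longrightarrow> s < 1 \<Longrightarrow> \<bar>f (s, m)\<bar> \<le> c"
  shows "(LINT p|mark_distribution. f p) = (LINT s|circle. u * f (s, Cross) + (1 - u) * f (s, Bar))"
    and "\<And>m. integrable circle (\<lambda>s. f (s, m))"
proof -
  have f': "f \<in> borel_measurable (circle \<Otimes>\<^sub>M types)"
    using f sets_mark_distribution unfolding mark_distribution_def by (simp cong: measurable_cong_sets)
  have "integrable (circle \<Otimes>\<^sub>M types) f"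
  proof (rule finite_measure.integrable_const_bound[where B = c])
    show "finite_measure (circle \<Otimes>\<^sub>M types)" by unfold_locales
    show "AE x in circle \<Otimes>\<^sub>M types. norm (f x) \<le> c"
      by (rule AE_I2) (use bound in \<open>auto simp: space_pair_measure space_circle\<close>)
  qed (rule f')
  then have "(LINT p|(circle \<Otimes>\<^sub>M types). f p) = (LINT s|circle. LINT m|types. f (s, m))"
    by (rule circle_types.integral_fst'[symmetric])
  also have "\<dots> = (LINT s|circle. u * f (s, Cross) + (1 - u) * f (s, Bar))"
  proof (rule Bochner_Integration.integral_cong[OF refl])
    fix s
    have "(LINT m|types. f (s, m)) = (\<Sum>m\<in>UNIV. mark_weight u m *\<^sub>R f (s, m))"
      by (rule lebesgue_integral_point_measure_finite) (simp_all add: finite_UNIV_mark mark_weight_nonneg)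
    then show "(LINT m|types. f (s, m)) = u * f (s, Cross) + (1 - u) * f (s, Bar)"
      unfolding UNIV_mark by (simp add: mark_weight_def)
  qed
  finally show "(LINT p|mark_distribution. f p) = (LINT s|circle. u * f (s, Cross) + (1 - u) * f (s, Bar))"
    unfolding mark_distribution_def .
  show "integrable circle (\<lambda>s. f (s, m))" for m
  proof (rule circle.integrable_const_bound[where B = c])
    show "AE s in circle. norm (f (s, m)) \<le> c"
      by (rule AE_I2) (use bound in \<open>auto simp: space_circle\<close>)
    show "(\<lambda>s. f (s, m)) \<in> borel_measurable circle"
      by (rule measurable_compose[OF _ f]) (simp add: mark_space_def)
  qed
qed

lemma void_probability:
  assumes P: "poisson_process_law (mark_intensity t u) P" and t: "0 \<le> t" and B: "B \<in> sets mark_space"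
  shows "emeasure P {\<eta> \<in> space mark_configs. \<eta> \<inter> B = {}} = ennreal (exp (- t * measure mark_distribution B))"
proof -
  interpret P: prob_space P using P unfolding poisson_process_law_def by blast
  have sets: "sets P = sets mark_configs"
    using P unfolding poisson_process_law_def configurations_mark_intensity by blast
  have "measure P {\<eta> \<in> space P. card (\<eta> \<inter> B) = 0} = exp (- measure (mark_intensity t u) B)"
    using P B unfolding poisson_process_law_def sets_mark_intensity by auto
  moreover have "measure (mark_intensity t u) B = t * measure mark_distribution B"
    unfolding measure_def emeasure_mark_intensity[OF t B] using t by (simp add: enn2real_mult)
  ultimately show ?thesis
    unfolding void_event_eq sets_eq_imp_space_eq[OF sets] P.emeasure_eq_measure by simp
qed

end

locale graph_sampling = mark_law u for u :: real +
  fixes E :: "'v set set"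
  assumes finite_E: "finite E" and E_ne: "E \<noteq> {}"
begin

definition point_law :: "('v set \<times> real \<times> mark) measure" where
  "point_law = measure_pmf (pmf_of_set E) \<Otimes>\<^sub>M mark_distribution"

definition edge_marks :: "nat \<Rightarrow> (nat \<Rightarrow> 'v set \<times> real \<times> mark) \<Rightarrow> 'v config" where
  "edge_marks n x = (\<lambda>e\<in>E. {p. \<exists>i<n. x i = (e, p)})"

definition insert_point :: "'v set \<times> real \<times> mark \<Rightarrow> 'v config \<Rightarrow> 'v config" where
  "insert_point y \<omega> = (\<lambda>e\<in>E. if e = fst y then insert (snd y) (\<omega> e) else \<omega> e)"

sublocale edge_mark: pair_prob_space "measure_pmf (pmf_of_set E)" mark_distribution ..

sublocale point: prob_space point_law
  unfolding point_law_def by unfold_locales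

sublocale points: sequence_space point_law ..

abbreviation "point_seqs \<equiv> \<Pi>\<^sub>M i\<in>(UNIV::nat set). point_law"

lemma sets_point_law [measurable_cong]:
  "sets point_law = sets (count_space UNIV \<Otimes>\<^sub>M mark_space)"
  unfolding point_law_def by (rule sets_pair_measure_cong) (simp_all add: sets_mark_distribution)

lemma space_point_law: "space point_law = UNIV \<times> {0..<1} \<times> UNIV"
  unfolding point_law_def by (simp add: space_pair_measure space_mark_distribution)

lemma space_point_seqs: "space point_seqs = {x. \<forall>i. x i \<in> UNIV \<times> {0..<1} \<times> UNIV}"
  by (auto simp: space_PiM space_point_law PiE_iff extensional_def)

lemma edge_marks_space:
  assumes "x \<in> space point_seqs"
  shows "edge_marks n x \<in> space (graph_configs E)"
proof -
  have "finite {p. \<exists>i<n. x i = (e, p)}" for e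
    by (rule finite_subset[of _ "(\<lambda>i. snd (x i)) ` {..<n}"]) (force simp: image_iff)+
  moreover have "{p. \<exists>i<n. x i = (e, p)} \<subseteq> {0..<1} \<times> UNIV" for e
  proof
    fix p assume "p \<in> {p. \<exists>i<n. x i = (e, p)}"
    then obtain i where "x i = (e, p)" by blast
    then show "p \<in> {0..<1} \<times> UNIV" using assms unfolding space_point_seqs by (metis (no_types, lifting) mem_Collect_eq mem_Sigma_iff)
  qed
  ultimately show ?thesis unfolding space_graph_configs edge_marks_def by auto
qed

lemma edge_marks_measurable: "edge_marks n \<in> measurable point_seqs (graph_configs E)"
proof (rule graph_configs_measurableI)
  fix e :: "'v set" and B :: "(real \<times> mark) set" assume eB: "e \<in> E" "B \<in> sets mark_space"
  have [measurable]: "{e} \<times> B \<in> sets point_law"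
    unfolding sets_point_law using eB by (intro pair_measureI) auto
  have "{x \<in> space point_seqs. edge_marks n x e \<inter> B = {}} = {x \<in> space point_seqs. \<forall>i\<in>{..<n}. x i \<notin> {e} \<times> B}"
  proof -
    have "{p. \<exists>i<n. x i = (e, p)} \<inter> B = {} \<longleftrightarrow> (\<forall>i\<in>{..<n}. x i \<notin> {e} \<times> B)" for x :: "nat \<Rightarrow> 'v set \<times> real \<times> mark"
    proof
      assume d: "{p. \<exists>i<n. x i = (e, p)} \<inter> B = {}"
      show "\<forall>i\<in>{..<n}. x i \<notin> {e} \<times> B"
      proof (intro ballI notI)
        fix i assume "i \<in> {..<n}" "x i \<in> {e} \<times> B"
        then obtain b where "i < n" "x i = (e, b)" "b \<in> B" by blast
        then show False using d by blast
      qed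
    next
      assume a: "\<forall>i\<in>{..<n}. x i \<notin> {e} \<times> B"
      show "{p. \<exists>i<n. x i = (e, p)} \<inter> B = {}"
      proof (intro equals0I)
        fix p assume "p \<in> {p. \<exists>i<n. x i = (e, p)} \<inter> B"
        then obtain i where "i < n" "x i = (e, p)" "p \<in> B" by blast
        then show False using a by force
      qed
    qed
    then show ?thesis unfolding edge_marks_def using eB(1) by simp
  qed
  also have "\<dots> \<in> sets point_seqs"
    by measurable
  finally show "{x \<in> space point_seqs. edge_marks n x e \<inter> B = {}} \<in> sets point_seqs" .
qed (rule edge_marks_space)

lemma insert_point_space:
  "y \<in> space point_law \<Longrightarrow> \<omega> \<in> space (graph_configs E) \<Longrightarrow>
     insert_point y \<omega> \<in> space (graph_configs E)"
  unfolding space_graph_configs insert_point_def space_point_law by (auto simp: PiE_iff)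

lemma insert_point_measurable:
  "(\<lambda>(\<omega>, y). insert_point y \<omega>) \<in> measurable (graph_configs E \<Otimes>\<^sub>M point_law) (graph_configs E)"
proof (rule graph_configs_measurableI)
  fix e :: "'v set" and B :: "(real \<times> mark) set" assume eB: "e \<in> E" "B \<in> sets mark_space"
  let ?M = "graph_configs E \<Otimes>\<^sub>M point_law"
  have A: "void_event E (\<lambda>e'. if e' = e then B else {}) \<in> sets (graph_configs E)"
    by (rule sets_graph_void_event[OF finite_E]) (use eB in auto)
  have C: "- ({e} \<times> B) \<inter> space point_law \<in> sets point_law"
  proof -
    have "{e} \<times> B \<in> sets point_law"
      unfolding sets_point_law using eB by (intro pair_measureI) auto
    then show ?thesis by (simp add: Compl_eq_Diff_UNIV Diff_Int_distrib2)
  qed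
  have "{z \<in> space ?M. (case z of (\<omega>, y) \<Rightarrow> insert_point y \<omega>) e \<inter> B = {}}
      = void_event E (\<lambda>e'. if e' = e then B else {}) \<times> (- ({e} \<times> B) \<inter> space point_law)"
    unfolding void_event_def insert_point_def using eB by (auto simp: space_pair_measure split: if_splits)
  also have "\<dots> \<in> sets ?M" using A C by (rule pair_measureI)
  finally show "{z \<in> space ?M. (case z of (\<omega>, y) \<Rightarrow> insert_point y \<omega>) e \<inter> B = {}} \<in> sets ?M" .
qed (auto simp: space_pair_measure intro!: insert_point_space)

text \<open>
  The first point of the sequence is regarded as inserted after the others.
\<close>

lemma edge_marks_Suc: "edge_marks (Suc n) (case_nat y x) = insert_point y (edge_marks n x)"
  unfolding edge_marks_def insert_point_def
proof (rule restrict_ext)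
  fix e assume "e \<in> E"
  then have r: "(\<lambda>e\<in>E. {p. \<exists>i<n. x i = (e, p)}) e = {p. \<exists>i<n. x i = (e, p)}" by (rule restrict_apply')
  show "{p. \<exists>i<Suc n. case_nat y x i = (e, p)} =
      (if e = fst y then insert (snd y) ((\<lambda>e\<in>E. {p. \<exists>i<n. x i = (e, p)}) e)
       else (\<lambda>e\<in>E. {p. \<exists>i<n. x i = (e, p)}) e)"
    unfolding r by (cases y) (auto simp: less_Suc_eq_0_disj)
qed

text \<open>
  Written out because the rate 0 is needed, for the right derivative at intensity 0.
\<close>

definition poisson_weight :: "real \<Rightarrow> nat \<Rightarrow> real" where
  "poisson_weight r n = exp (- r) * r ^ n / fact n"

lemma poisson_weight_nonneg: "0 \<le> r \<Longrightarrow> 0 \<le> poisson_weight r n"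
  by (simp add: poisson_weight_def)

lemma poisson_weight_geometric_sums: "(\<lambda>n. poisson_weight r n * c ^ n) sums exp (r * c - r)"
proof -
  have "(\<lambda>n. exp (- r) * ((r * c) ^ n /\<^sub>R fact n)) sums (exp (- r) * exp (r * c))"
    by (rule sums_mult[OF exp_converges])
  moreover have "(\<lambda>n. exp (- r) * ((r * c) ^ n /\<^sub>R fact n)) = (\<lambda>n. poisson_weight r n * c ^ n)"
    by (rule ext) (simp add: poisson_weight_def power_mult_distrib divide_inverse)
  moreover have "exp (- r) * exp (r * c) = exp (r * c - r)" by (simp add: mult_exp_exp)
  ultimately show ?thesis by simp
qed

definition count_law :: "real \<Rightarrow> nat measure" where
  "count_law r = density (count_space UNIV) (\<lambda>n. ennreal (poisson_weight r n))"

lemma sets_count_law [measurable_cong]: "sets (count_law r) = sets (count_space UNIV)"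
  by (simp add: count_law_def)

lemma emeasure_count_law:
  assumes r: "0 \<le> r" and c: "0 \<le> c"
  shows "(\<integral>\<^sup>+ n. ennreal (c ^ n) \<partial>count_law r) = ennreal (exp (r * c - r))"
proof -
  have "(\<integral>\<^sup>+ n. ennreal (c ^ n) \<partial>count_law r) = (\<integral>\<^sup>+ n. ennreal (poisson_weight r n) * ennreal (c ^ n) \<partial>count_space UNIV)"
    unfolding count_law_def by (rule nn_integral_density) auto
  also have "\<dots> = (\<Sum>n. ennreal (poisson_weight r n * c ^ n))"
    using poisson_weight_nonneg[OF r] c by (simp add: nn_integral_count_space_nat ennreal_mult)
  also have "\<dots> = ennreal (exp (r * c - r))"
    using poisson_weight_geometric_sums[of r c] poisson_weight_nonneg[OF r] c
    by (intro suminf_ennreal_eq) auto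
  finally show ?thesis .
qed

lemma prob_space_count_law: "0 \<le> r \<Longrightarrow> prob_space (count_law r)"
  using emeasure_count_law[of r 1] by (intro prob_spaceI) (simp add: nn_integral_const)

lemma edge_marks_pair_measurable:
  "(\<lambda>(n, x). edge_marks n x) \<in> measurable (count_law r \<Otimes>\<^sub>M point_seqs) (graph_configs E)"
proof -
  have "(\<lambda>(n, x). edge_marks n x) \<in> measurable (count_space UNIV \<Otimes>\<^sub>M point_seqs) (graph_configs E)"
    by (rule measurable_pair_measure_countable1) (auto intro: edge_marks_measurable)
  then show ?thesis by (simp add: sets_count_law cong: measurable_cong_sets sets_pair_measure_cong)
qed

definition mark_probability :: "('v set \<Rightarrow> (real \<times> mark) set) \<Rightarrow> real" where
  "mark_probability B = (\<Sum>e\<in>E. measure mark_distribution (B e)) / card E"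

lemma measure_point_avoid:
  assumes B: "\<And>e. e \<in> E \<Longrightarrow> B e \<in> sets mark_space"
  defines "A \<equiv> {y \<in> space point_law. fst y \<in> E \<longrightarrow> snd y \<notin> B (fst y)}"
  shows "A \<in> sets point_law" "emeasure point_law A = ennreal (1 - mark_probability B)"
    "0 \<le> 1 - mark_probability B"
proof -
  let ?H = "\<Union>e\<in>E. {e} \<times> B e"
  have H: "{e} \<times> B e \<in> sets point_law" if "e \<in> E" for e
    unfolding sets_point_law using B[OF that] by (intro pair_measureI) auto
  then have H': "?H \<in> sets point_law" using finite_E by (intro sets.finite_UN) auto
  have A: "A = space point_law - ?H" unfolding A_def by auto
  show "A \<in> sets point_law" unfolding A using H' by simp
  have "measure point_law ?H = (\<Sum>e\<in>E. measure point_law ({e} \<times> B e))"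
    by (rule point.finite_measure_finite_Union[OF finite_E]) (use H in \<open>auto simp: disjoint_family_on_def\<close>)
  also have "\<dots> = (\<Sum>e\<in>E. measure mark_distribution (B e) / card E)"
  proof (rule sum.cong[OF refl])
    fix e assume e: "e \<in> E"
    have Be: "B e \<in> sets mark_distribution" using B[OF e] sets_mark_distribution by simp
    have "measure point_law ({e} \<times> B e) = measure (measure_pmf (pmf_of_set E)) {e} * measure mark_distribution (B e)"
      unfolding point_law_def measure_def
      using mark_distribution.emeasure_pair_measure_Times[of "{e}" "measure_pmf (pmf_of_set E)" "B e"] Be
      by (simp add: enn2real_mult)
    also have "measure (measure_pmf (pmf_of_set E)) {e} = 1 / card E"
      using e finite_E E_ne by (simp add: measure_pmf_single)
    finally show "measure point_law ({e} \<times> B e) = measure mark_distribution (B e) / card E" by simp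
  qed
  also have "\<dots> = mark_probability B" unfolding mark_probability_def by (simp add: sum_divide_distrib)
  finally have m: "measure point_law ?H = mark_probability B" .
  have "measure point_law A = 1 - mark_probability B"
    unfolding A using point.prob_compl[OF H'] m by simp
  then show "emeasure point_law A = ennreal (1 - mark_probability B)"
    by (simp add: point.emeasure_eq_measure)
  show "0 \<le> 1 - mark_probability B" using m point.prob_le_1[of ?H] by simp
qed

lemma emeasure_sequence_avoid:
  assumes A: "A \<in> sets point_law"
  shows "emeasure point_seqs {x \<in> space point_seqs. \<forall>i<n. x i \<in> A} = emeasure point_law A ^ n"
proof -
  have "emeasure point_seqs (prod_emb UNIV (\<lambda>_. point_law) {..<n} (\<Pi>\<^sub>E i\<in>{..<n}. A)) = (\<Prod>i\<in>{..<n}. emeasure point_law A)"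
    by (rule points.emeasure_PiM_emb) (use A in auto)
  moreover have "prod_emb UNIV (\<lambda>_. point_law) {..<n} (\<Pi>\<^sub>E i\<in>{..<n}. A) = {x \<in> space point_seqs. \<forall>i<n. x i \<in> A}"
    unfolding prod_emb_def space_PiM by (auto simp: PiE_iff)
  ultimately show ?thesis by simp
qed

text \<open>
  Let \<open>r\<close> be the total intensity and \<open>p\<close> the probability that a random point hits the set to be avoided.
  For the Poisson processes the void probability is \<open>exp (- r p)\<close>. For \<open>N\<close> independent points it is the
  expectation of \<open>(1 - p) ^ N\<close>, which has the same value for a Poisson variable \<open>N\<close> of mean \<open>r\<close>.
\<close>

lemma graph_law_eq_mixture:
  assumes P: "poisson_process_law (mark_intensity t u) P" and t: "0 \<le> t"
  shows "(\<Pi>\<^sub>M e\<in>E. P) = distr (count_law (t * card E) \<Otimes>\<^sub>M point_seqs) (graph_configs E) (\<lambda>(n, x). edge_marks n x)"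
    (is "?\<rho> = ?Q")
proof -
  interpret P: prob_space P using P unfolding poisson_process_law_def by blast
  have setsP: "sets P = sets mark_configs"
    using P unfolding poisson_process_law_def configurations_mark_intensity by blast
  have sets\<rho>: "sets ?\<rho> = sets (graph_configs E)" by (rule sets_PiM_cong[OF refl setsP])
  interpret PP: product_prob_space "\<lambda>_. P" E by unfold_locales
  interpret N: prob_space "count_law (t * card E)" by (rule prob_space_count_law) (use t in simp)
  interpret NS: pair_prob_space "count_law (t * card E)" point_seqs ..
  show ?thesis
  proof (rule measure_eq_graph_void_events[OF finite_E])
    show "finite_measure ?\<rho>" by unfold_locales
    show "sets ?\<rho> = sets (graph_configs E)" by (rule sets\<rho>)
    show "sets ?Q = sets (graph_configs E)" by simp
    fix B assume B: "\<And>e. e \<in> E \<Longrightarrow> B e \<in> sets mark_space"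
    let ?v = "\<lambda>e. {\<eta> \<in> space mark_configs. \<eta> \<inter> B e = {}}"
    have "emeasure ?\<rho> (void_event E B) = (\<Prod>e\<in>E. emeasure P (?v e))"
      unfolding void_event_PiE by (rule PP.emeasure_PiM[OF finite_E]) (use B setsP sets_void_event in auto)
    also have "\<dots> = (\<Prod>e\<in>E. ennreal (exp (- t * measure mark_distribution (B e))))"
      by (rule prod.cong[OF refl]) (rule void_probability[OF P t B])
    also have "\<dots> = ennreal (exp (\<Sum>e\<in>E. - t * measure mark_distribution (B e)))"
      by (simp add: prod_ennreal exp_sum[OF finite_E])
    also have "(\<Sum>e\<in>E. - t * measure mark_distribution (B e)) = - (t * card E) * mark_probability B"
    proof -
      have "(\<Sum>e\<in>E. - t * measure mark_distribution (B e)) = - t * (\<Sum>e\<in>E. measure mark_distribution (B e))"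
        by (simp only: sum_distrib_left)
      moreover have "real (card E) \<noteq> 0" using finite_E E_ne by simp
      ultimately show ?thesis unfolding mark_probability_def by simp
    qed
    finally have 1: "emeasure ?\<rho> (void_event E B) = ennreal (exp (- (t * card E) * mark_probability B))" .
    let ?A = "{y \<in> space point_law. fst y \<in> E \<longrightarrow> snd y \<notin> B (fst y)}"
    have A: "?A \<in> sets point_law" "emeasure point_law ?A = ennreal (1 - mark_probability B)"
      "0 \<le> 1 - mark_probability B"
      by (rule measure_point_avoid, erule B)+
    have V: "void_event E B \<in> sets (graph_configs E)" by (rule sets_graph_void_event[OF finite_E B])
    have ind: "indicator (void_event E B) \<in> borel_measurable (graph_configs E)"
      using V by (rule borel_measurable_indicator)
    have "emeasure ?Q (void_event E B) = (\<integral>\<^sup>+ \<omega>. indicator (void_event E B) \<omega> \<partial>?Q)"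
      by (rule nn_integral_indicator[symmetric]) (simp only: sets_distr V)
    also have "\<dots> = (\<integral>\<^sup>+ z. indicator (void_event E B) (case z of (n, x) \<Rightarrow> edge_marks n x) \<partial>(count_law (t * card E) \<Otimes>\<^sub>M point_seqs))"
      by (rule nn_integral_distr[OF edge_marks_pair_measurable]) (simp only: measurable_distr_eq1 ind)
    also have "\<dots> = (\<integral>\<^sup>+ n. \<integral>\<^sup>+ x. indicator (void_event E B) (edge_marks n x) \<partial>point_seqs \<partial>count_law (t * card E))"
      unfolding points.nn_integral_fst[OF measurable_compose[OF edge_marks_pair_measurable ind], symmetric] prod.case ..
    also have "\<dots> = (\<integral>\<^sup>+ n. ennreal ((1 - mark_probability B) ^ n) \<partial>count_law (t * card E))"
    proof (rule nn_integral_cong)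
      fix n
      have "(\<integral>\<^sup>+ x. indicator (void_event E B) (edge_marks n x) \<partial>point_seqs)
          = (\<integral>\<^sup>+ x. indicator {x \<in> space point_seqs. \<forall>i<n. x i \<in> ?A} x \<partial>point_seqs)"
      proof (rule nn_integral_cong)
        fix x assume x: "x \<in> space point_seqs"
        have xs: "x i \<in> space point_law" for i using x by (simp add: space_PiM PiE_iff)
        have "edge_marks n x \<in> void_event E B \<longleftrightarrow> (\<forall>i<n. x i \<in> ?A)"
        proof
          assume v: "edge_marks n x \<in> void_event E B"
          show "\<forall>i<n. x i \<in> ?A"
          proof (intro allI impI)
            fix i assume i: "i < n"
            obtain e p where ep: "x i = (e, p)" by (cases "x i")
            have "p \<notin> B e" if "e \<in> E"
            proof
              assume "p \<in> B e"
              moreover have "p \<in> edge_marks n x e" unfolding edge_marks_def using that i ep by auto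
              ultimately show False using v that unfolding void_event_def by blast
            qed
            then show "x i \<in> ?A" using xs[of i] ep by simp
          qed
        next
          assume a: "\<forall>i<n. x i \<in> ?A"
          show "edge_marks n x \<in> void_event E B"
            unfolding void_event_def
          proof (intro CollectI conjI ballI)
            show "edge_marks n x \<in> space (graph_configs E)" by (rule edge_marks_space[OF x])
            fix e assume e: "e \<in> E"
            show "edge_marks n x e \<inter> B e = {}" unfolding edge_marks_def using a e by fastforce
          qed
        qed
        then show "indicator (void_event E B) (edge_marks n x) = (indicator {x \<in> space point_seqs. \<forall>i<n. x i \<in> ?A} x :: ennreal)"
          using x by (simp add: indicator_def)
      qed
      also have "\<dots> = emeasure point_seqs {x \<in> space point_seqs. \<forall>i<n. x i \<in> ?A}"
        by (rule nn_integral_indicator) (use A(1) in measurable)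
      also have "\<dots> = emeasure point_law ?A ^ n"
        by (rule emeasure_sequence_avoid[OF A(1)])
      also have "\<dots> = ennreal ((1 - mark_probability B) ^ n)"
        unfolding A(2) by (rule ennreal_power[OF A(3)])
      finally show "(\<integral>\<^sup>+ x. indicator (void_event E B) (edge_marks n x) \<partial>point_seqs) = ennreal ((1 - mark_probability B) ^ n)" .
    qed
    also have "\<dots> = ennreal (exp ((t * card E) * (1 - mark_probability B) - t * card E))"
      by (rule emeasure_count_law) (use t A(3) in auto)
    finally have 2: "emeasure ?Q (void_event E B) = ennreal (exp ((t * card E) * (1 - mark_probability B) - t * card E))" .
    have "(t * card E) * (1 - mark_probability B) - t * card E = - (t * card E) * mark_probability B"
      by (simp add: algebra_simps)
    then show "emeasure ?\<rho> (void_event E B) = emeasure ?Q (void_event E B)" using 1 2 by simp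
  qed
qed

end


section \<open>Differentiation in the intensity\<close>

context graph_sampling
begin

definition sample_mean :: "('v config \<Rightarrow> real) \<Rightarrow> nat \<Rightarrow> real" where
  "sample_mean F n = (LINT x|point_seqs. F (edge_marks n x))"

definition insertion_mean :: "('v config \<Rightarrow> real) \<Rightarrow> 'v config \<Rightarrow> real" where
  "insertion_mean F \<omega> = (LINT y|point_law. F (insert_point y \<omega>))"

text \<open>
  A growth condition under which the expectations are entire functions of the intensity. It holds for
  \<open>\<theta> ^ \<lambda>\<close>, since the loop number grows at most linearly in the number of marks.
\<close>

definition geometrically_bounded :: "('v config \<Rightarrow> real) \<Rightarrow> bool" where
  "geometrically_bounded F \<longleftrightarrow>
     (\<exists>C c. 0 \<le> C \<and> 1 \<le> c \<and> (\<forall>n. \<forall>x\<in>space point_seqs. \<bar>F (edge_marks n x)\<bar> \<le> C * c ^ n))"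

lemma integrable_sample:
  assumes F: "F \<in> borel_measurable (graph_configs E)" and b: "\<And>x. x \<in> space point_seqs \<Longrightarrow> \<bar>F (edge_marks n x)\<bar> \<le> C"
  shows "integrable point_seqs (\<lambda>x. F (edge_marks n x))" "\<bar>sample_mean F n\<bar> \<le> C"
proof -
  show i: "integrable point_seqs (\<lambda>x. F (edge_marks n x))"
    by (rule points.integrable_const_bound[where B = C])
       (use b measurable_compose[OF edge_marks_measurable F] in \<open>auto intro!: AE_I2\<close>)
  have "\<bar>sample_mean F n\<bar> \<le> (LINT x|point_seqs. \<bar>F (edge_marks n x)\<bar>)"
    unfolding sample_mean_def using integral_norm_bound[of point_seqs "\<lambda>x. F (edge_marks n x)"] by simp
  also have "\<dots> \<le> C"
    by (rule points.integral_le_const) (use i b in \<open>auto intro!: AE_I2\<close>)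
  finally show "\<bar>sample_mean F n\<bar> \<le> C" .
qed

lemma integral_graph_law:
  assumes P: "poisson_process_law (mark_intensity t u) P" and t: "0 \<le> t"
    and F: "F \<in> borel_measurable (graph_configs E)" and b: "geometrically_bounded F"
  shows "integrable (\<Pi>\<^sub>M e\<in>E. P) F"
    and "(\<lambda>n. poisson_weight (t * card E) n * sample_mean F n) sums (LINT \<omega>|(\<Pi>\<^sub>M e\<in>E. P). F \<omega>)"
proof -
  let ?r = "t * card E"
  have r: "0 \<le> ?r" using t by simp
  obtain C c where C: "0 \<le> C" "1 \<le> c" "\<And>n x. x \<in> space point_seqs \<Longrightarrow> \<bar>F (edge_marks n x)\<bar> \<le> C * c ^ n"
    using b unfolding geometrically_bounded_def by blast
  interpret N: prob_space "count_law ?r" by (rule prob_space_count_law[OF r])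
  interpret NS: pair_prob_space "count_law ?r" point_seqs ..
  note meas = measurable_compose[OF edge_marks_pair_measurable F, of ?r]
  note law = graph_law_eq_mixture[OF P t]
  have c_int: "integrable (count_law ?r) (\<lambda>n. C * c ^ n)"
  proof (rule integrable_mult_right, rule integrableI_nonneg)
    show "(\<integral>\<^sup>+ n. ennreal (c ^ n) \<partial>count_law ?r) < \<infinity>"
      using emeasure_count_law[OF r, of c] C(2) by simp
  qed (use C(2) in \<open>auto simp: count_law_def\<close>)
  have int_pair: "integrable (count_law ?r \<Otimes>\<^sub>M point_seqs) (\<lambda>z. F (case z of (n, x) \<Rightarrow> edge_marks n x))"
  proof (rule NS.Fubini_integrable[OF meas])
    show "AE n in count_law ?r. integrable point_seqs (\<lambda>x. F (case (n, x) of (n, x) \<Rightarrow> edge_marks n x))"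
      by (rule AE_I2) (use integrable_sample(1)[OF F C(3)] in simp)
    show "integrable (count_law ?r) (\<lambda>n. LINT x|point_seqs. norm (F (case (n, x) of (n, x) \<Rightarrow> edge_marks n x)))"
    proof (rule Bochner_Integration.integrable_bound[OF c_int])
      show "AE n in count_law ?r. norm (LINT x|point_seqs. norm (F (case (n, x) of (n, x) \<Rightarrow> edge_marks n x))) \<le> norm (C * c ^ n)"
      proof (rule AE_I2)
        fix n
        have "integrable point_seqs (\<lambda>x. \<bar>F (edge_marks n x)\<bar>)"
          using integrable_sample(1)[OF F C(3)] by (rule integrable_abs)
        then have "(LINT x|point_seqs. \<bar>F (edge_marks n x)\<bar>) \<le> C * c ^ n"
          by (rule points.integral_le_const) (use C(3) in \<open>auto intro!: AE_I2\<close>)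
        moreover have "0 \<le> (LINT x|point_seqs. \<bar>F (edge_marks n x)\<bar>)" by (rule integral_nonneg_AE) simp
        ultimately show "norm (LINT x|point_seqs. norm (F (case (n, x) of (n, x) \<Rightarrow> edge_marks n x))) \<le> norm (C * c ^ n)"
          by simp
      qed
    qed (simp add: count_law_def)
  qed
  show "integrable (\<Pi>\<^sub>M e\<in>E. P) F"
    unfolding law by (subst integrable_distr_eq[OF edge_marks_pair_measurable F]) (use int_pair in \<open>simp add: case_prod_unfold\<close>)
  have "(LINT \<omega>|(\<Pi>\<^sub>M e\<in>E. P). F \<omega>) = (LINT z|(count_law ?r \<Otimes>\<^sub>M point_seqs). F (case z of (n, x) \<Rightarrow> edge_marks n x))"
    unfolding law by (rule integral_distr[OF edge_marks_pair_measurable F])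
  also have "\<dots> = (LINT n|count_law ?r. sample_mean F n)"
    using NS.integral_fst'[OF int_pair] unfolding sample_mean_def by simp
  also have "\<dots> = (LINT n|count_space UNIV. poisson_weight ?r n *\<^sub>R sample_mean F n)"
    unfolding count_law_def by (rule integral_density) (use poisson_weight_nonneg[OF r] in auto)
  finally have eq: "(LINT \<omega>|(\<Pi>\<^sub>M e\<in>E. P). F \<omega>) = (LINT n|count_space UNIV. poisson_weight ?r n *\<^sub>R sample_mean F n)" .
  have "integrable (count_space UNIV) (\<lambda>n. poisson_weight ?r n *\<^sub>R sample_mean F n)"
    unfolding integrable_count_space_nat_iff
  proof (rule summable_comparison_test')
    show "summable (\<lambda>n. C * (poisson_weight ?r n * c ^ n))"
      by (rule summable_mult[OF sums_summable[OF poisson_weight_geometric_sums]])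
    fix n :: nat
    have "poisson_weight ?r n * \<bar>sample_mean F n\<bar> \<le> poisson_weight ?r n * (C * c ^ n)"
      by (rule mult_left_mono[OF integrable_sample(2)[OF F C(3)] poisson_weight_nonneg[OF r]])
    then show "norm (norm (poisson_weight ?r n *\<^sub>R sample_mean F n)) \<le> C * (poisson_weight ?r n * c ^ n)"
      using poisson_weight_nonneg[OF r, of n] by (simp add: abs_mult mult_ac)
  qed
  from sums_integral_count_space_nat[OF this]
  show "(\<lambda>n. poisson_weight ?r n * sample_mean F n) sums (LINT \<omega>|(\<Pi>\<^sub>M e\<in>E. P). F \<omega>)"
    unfolding eq by simp
qed

lemma case_nat_point_seqs:
  "y \<in> space point_law \<Longrightarrow> x \<in> space point_seqs \<Longrightarrow> case_nat y x \<in> space point_seqs"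
  by (auto simp: space_PiM PiE_iff split: nat.split)

lemma insertion_mean_measurable:
  assumes F: "F \<in> borel_measurable (graph_configs E)"
  shows "insertion_mean F \<in> borel_measurable (graph_configs E)"
proof -
  have "(\<lambda>(\<omega>, y). F (insert_point y \<omega>)) \<in> borel_measurable (graph_configs E \<Otimes>\<^sub>M point_law)"
    using measurable_compose[OF insert_point_measurable F] by (simp add: case_prod_unfold)
  then show ?thesis
    unfolding insertion_mean_def by (rule point.borel_measurable_lebesgue_integral)
qed

text \<open>
  A sequence of independent points is again one after a further independent point is put in front of it.
\<close>

lemma sample_mean_Suc:
  assumes F: "F \<in> borel_measurable (graph_configs E)" and b: "geometrically_bounded F"
  shows "sample_mean F (Suc n) = sample_mean (insertion_mean F) n"
proof -
  obtain C c where C: "0 \<le> C" "1 \<le> c" "\<And>n x. x \<in> space point_seqs \<Longrightarrow> \<bar>F (edge_marks n x)\<bar> \<le> C * c ^ n"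
    using b unfolding geometrically_bounded_def by blast
  interpret PS: pair_prob_space point_law point_seqs ..
  have cn: "(\<lambda>(y, x). case_nat y x) \<in> measurable (point_law \<Otimes>\<^sub>M point_seqs) point_seqs"
    by measurable
  have "sample_mean F (Suc n) = (LINT x|distr (point_law \<Otimes>\<^sub>M point_seqs) point_seqs (\<lambda>(y, x). case_nat y x). F (edge_marks (Suc n) x))"
    unfolding points.PiM_iter sample_mean_def ..
  also have "\<dots> = (LINT z|(point_law \<Otimes>\<^sub>M point_seqs). F (edge_marks (Suc n) (case z of (y, x) \<Rightarrow> case_nat y x)))"
    by (rule integral_distr[OF cn measurable_compose[OF edge_marks_measurable F]])
  also have "\<dots> = (LINT z|(point_law \<Otimes>\<^sub>M point_seqs). (case z of (y, x) \<Rightarrow> F (insert_point y (edge_marks n x))))"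
    by (rule Bochner_Integration.integral_cong[OF refl]) (auto simp: edge_marks_Suc split: prod.split)
  also have "\<dots> = (LINT x|point_seqs. LINT y|point_law. F (insert_point y (edge_marks n x)))"
  proof (rule PS.integral_snd[symmetric])
    show "integrable (point_law \<Otimes>\<^sub>M point_seqs) (\<lambda>(y, x). F (insert_point y (edge_marks n x)))"
    proof (rule PS.P.integrable_const_bound[where B = "C * c ^ Suc n"])
      show "AE z in point_law \<Otimes>\<^sub>M point_seqs. norm (case z of (y, x) \<Rightarrow> F (insert_point y (edge_marks n x))) \<le> C * c ^ Suc n"
      proof (rule AE_I2)
        fix z assume "z \<in> space (point_law \<Otimes>\<^sub>M point_seqs)"
        then obtain y x where z: "z = (y, x)" "y \<in> space point_law" "x \<in> space point_seqs"
          by (auto simp: space_pair_measure)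
        show "norm (case z of (y, x) \<Rightarrow> F (insert_point y (edge_marks n x))) \<le> C * c ^ Suc n"
          using C(3)[OF case_nat_point_seqs[OF z(2,3)], of "Suc n"] unfolding z(1) edge_marks_Suc by simp
      qed
      have "(\<lambda>z. F (edge_marks (Suc n) (case z of (y, x) \<Rightarrow> case_nat y x))) \<in> borel_measurable (point_law \<Otimes>\<^sub>M point_seqs)"
        by (rule measurable_compose[OF cn measurable_compose[OF edge_marks_measurable F]])
      then show "(\<lambda>(y, x). F (insert_point y (edge_marks n x))) \<in> borel_measurable (point_law \<Otimes>\<^sub>M point_seqs)"
        by (simp add: case_prod_unfold edge_marks_Suc)
    qed
  qed
  finally show ?thesis unfolding sample_mean_def insertion_mean_def .
qed

lemma insertion_mean_bounded:
  assumes F: "F \<in> borel_measurable (graph_configs E)" and b: "geometrically_bounded F"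
  shows "geometrically_bounded (insertion_mean F)"
proof -
  obtain C c where C: "0 \<le> C" "1 \<le> c" "\<And>n x. x \<in> space point_seqs \<Longrightarrow> \<bar>F (edge_marks n x)\<bar> \<le> C * c ^ n"
    using b unfolding geometrically_bounded_def by blast
  have "\<bar>insertion_mean F (edge_marks n x)\<bar> \<le> (C * c) * c ^ n" if x: "x \<in> space point_seqs" for n x
  proof -
    have bd: "\<bar>F (insert_point y (edge_marks n x))\<bar> \<le> (C * c) * c ^ n" if "y \<in> space point_law" for y
      using C(3)[OF case_nat_point_seqs[OF that x], of "Suc n"] unfolding edge_marks_Suc by (simp add: mult_ac)
    have "(\<lambda>y. F (insert_point y (edge_marks n x))) \<in> borel_measurable point_law"
      using measurable_compose[OF measurable_Pair1'[OF edge_marks_space[OF x]] measurable_compose[OF insert_point_measurable F]]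
      by simp
    then have i: "integrable point_law (\<lambda>y. F (insert_point y (edge_marks n x)))"
      by (intro point.integrable_const_bound[where B = "(C * c) * c ^ n"]) (use bd in \<open>auto intro!: AE_I2\<close>)
    have "\<bar>insertion_mean F (edge_marks n x)\<bar> \<le> (LINT y|point_law. \<bar>F (insert_point y (edge_marks n x))\<bar>)"
      unfolding insertion_mean_def using integral_norm_bound[of point_law "\<lambda>y. F (insert_point y (edge_marks n x))"] by simp
    also have "\<dots> \<le> (C * c) * c ^ n"
      by (rule point.integral_le_const) (use i bd in \<open>auto intro!: AE_I2\<close>)
    finally show ?thesis .
  qed
  moreover have "0 \<le> C * c" using C by simp
  ultimately show ?thesis unfolding geometrically_bounded_def using C(2) by blast
qed

text \<open>
  With \<open>r = \<tau> * card E\<close> and \<open>a\<^sub>n = sample_mean F n\<close>, the expectation is \<open>exp (- r)\<close> times the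
  sum of \<open>a\<^sub>n * r ^ n / fact n\<close>. Differentiating the power series shifts the coefficients,
  and \<open>sample_mean_Suc\<close> turns the shift into an insertion; the derivative of the exponential gives the
  term \<open>- F \<omega>\<close>.
\<close>

theorem derivative_of_poisson_expectation:
  assumes P: "\<And>\<tau>. 0 \<le> \<tau> \<Longrightarrow> poisson_process_law (mark_intensity \<tau> u) (P \<tau>)" and t: "0 \<le> t"
    and F: "F \<in> borel_measurable (graph_configs E)" and b: "geometrically_bounded F"
  shows "((\<lambda>\<tau>. LINT \<omega>|(\<Pi>\<^sub>M e\<in>E. P \<tau>). F \<omega>) has_real_derivative
     card E * (LINT \<omega>|(\<Pi>\<^sub>M e\<in>E. P t). insertion_mean F \<omega> - F \<omega>)) (at t within {0..})"
proof -
  obtain C c where C: "0 \<le> C" "1 \<le> c" "\<And>n x. x \<in> space point_seqs \<Longrightarrow> \<bar>F (edge_marks n x)\<bar> \<le> C * c ^ n"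
    using b unfolding geometrically_bounded_def by blast
  let ?K = "real (card E)"
  let ?a = "\<lambda>n. sample_mean F n / fact n"
  have a_le: "\<bar>sample_mean F n\<bar> \<le> C * c ^ n" for n by (rule integrable_sample(2)[OF F C(3)])
  have summ: "summable (\<lambda>n. ?a n * y ^ n)" for y :: real
  proof (rule summable_comparison_test')
    show "summable (\<lambda>n. C * ((c * \<bar>y\<bar>) ^ n /\<^sub>R fact n))"
      by (rule summable_mult[OF sums_summable[OF exp_converges]])
    fix n :: nat
    have "\<bar>sample_mean F n\<bar> * (\<bar>y\<bar> ^ n / fact n) \<le> (C * c ^ n) * (\<bar>y\<bar> ^ n / fact n)"
      by (rule mult_right_mono[OF a_le]) simp
    then show "norm (?a n * y ^ n) \<le> C * ((c * \<bar>y\<bar>) ^ n /\<^sub>R fact n)"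
      by (simp add: abs_mult power_abs power_mult_distrib divide_inverse mult_ac)
  qed
  let ?A = "\<lambda>x. \<Sum>n. ?a n * x ^ n"
  have diffs: "diffs ?a n = sample_mean (insertion_mean F) n / fact n" for n
    unfolding diffs_def sample_mean_Suc[OF F b, symmetric] by simp
  have A': "(?A has_real_derivative (\<Sum>n. sample_mean (insertion_mean F) n / fact n * x ^ n)) (at x)" for x
    using termdiffs_strong_converges_everywhere[of ?a x] summ unfolding diffs by blast
  have series: "(LINT \<omega>|(\<Pi>\<^sub>M e\<in>E. P \<tau>). G \<omega>) = exp (- (\<tau> * ?K)) * (\<Sum>n. sample_mean G n / fact n * (\<tau> * ?K) ^ n)"
    if \<tau>: "0 \<le> \<tau>" and G: "G \<in> borel_measurable (graph_configs E)" "geometrically_bounded G" for \<tau> G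
  proof -
    have cancel: "exp x * (exp (- x) * w) = w" "exp (- x) * (exp x * w) = w" for x w :: real
      by (simp_all add: mult_exp_exp flip: mult.assoc)
    note s = integral_graph_law(2)[OF P[OF \<tau>] \<tau> G]
    have eq: "poisson_weight (\<tau> * ?K) n * sample_mean G n = exp (- (\<tau> * ?K)) * (sample_mean G n / fact n * (\<tau> * ?K) ^ n)" for n
      by (simp add: poisson_weight_def)
    from s have "(\<lambda>n. exp (- (\<tau> * ?K)) * (sample_mean G n / fact n * (\<tau> * ?K) ^ n)) sums (LINT \<omega>|(\<Pi>\<^sub>M e\<in>E. P \<tau>). G \<omega>)"
      unfolding eq .
    then have "(\<lambda>n. exp (\<tau> * ?K) * (exp (- (\<tau> * ?K)) * (sample_mean G n / fact n * (\<tau> * ?K) ^ n))) sums (exp (\<tau> * ?K) * (LINT \<omega>|(\<Pi>\<^sub>M e\<in>E. P \<tau>). G \<omega>))"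
      by (rule sums_mult)
    then have "(\<Sum>n. sample_mean G n / fact n * (\<tau> * ?K) ^ n) = exp (\<tau> * ?K) * (LINT \<omega>|(\<Pi>\<^sub>M e\<in>E. P \<tau>). G \<omega>)"
      unfolding cancel by (rule sums_unique[symmetric])
    then show ?thesis by (simp only: cancel)
  qed
  let ?G = "\<lambda>\<tau>. exp (- (\<tau> * ?K)) * ?A (\<tau> * ?K)"
  note iF = insertion_mean_measurable[OF F] insertion_mean_bounded[OF F b]
  let ?S = "\<Sum>n. sample_mean (insertion_mean F) n / fact n * (t * ?K) ^ n"
  have inner: "((\<lambda>\<tau>. ?A (\<tau> * ?K)) has_real_derivative ?S * ?K) (at t)"
    by (rule DERIV_chain2[where f = ?A and g = "\<lambda>\<tau>. \<tau> * ?K", OF A']) (auto intro!: derivative_eq_intros)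
  have outer: "((\<lambda>\<tau>. exp (- (\<tau> * ?K))) has_real_derivative - ?K * exp (- (t * ?K))) (at t)"
    by (auto intro!: derivative_eq_intros)
  have "(?G has_real_derivative (- ?K * exp (- (t * ?K)) * ?A (t * ?K) + ?S * ?K * exp (- (t * ?K)))) (at t)"
    by (rule DERIV_mult[OF outer inner])
  also have "- ?K * exp (- (t * ?K)) * ?A (t * ?K) + ?S * ?K * exp (- (t * ?K))
      = ?K * ((LINT \<omega>|(\<Pi>\<^sub>M e\<in>E. P t). insertion_mean F \<omega>) - (LINT \<omega>|(\<Pi>\<^sub>M e\<in>E. P t). F \<omega>))"
    unfolding series[OF t F b] series[OF t iF] by (simp add: algebra_simps)
  also have "(LINT \<omega>|(\<Pi>\<^sub>M e\<in>E. P t). insertion_mean F \<omega>) - (LINT \<omega>|(\<Pi>\<^sub>M e\<in>E. P t). F \<omega>)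
      = (LINT \<omega>|(\<Pi>\<^sub>M e\<in>E. P t). insertion_mean F \<omega> - F \<omega>)"
    by (rule Bochner_Integration.integral_diff[symmetric])
       (rule integral_graph_law(1)[OF P[OF t] t], use F b iF in auto)+
  finally have "(?G has_real_derivative ?K * (LINT \<omega>|(\<Pi>\<^sub>M e\<in>E. P t). insertion_mean F \<omega> - F \<omega>)) (at t within {0..})"
    by (rule has_field_derivative_at_within)
  then show ?thesis
    by (rule has_field_derivative_transform_within[of _ _ _ _ 1]) (use t series[OF _ F b] in auto)
qed

end


section \<open>Measurability of the loop number\<close>

lemma mark_times_Union: "mark_times E \<omega> = (\<Union>e\<in>E. fst ` \<omega> e)"
  unfolding mark_times_def by force

lemma (in loop_graph) finite_edges: "finite E"
  using finite_V edges by (meson Sup_le_iff finite_Sup finite_UnionD finite_subset)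

lemma (in loop_graph) sliced_configI:
  assumes \<omega>: "\<omega> \<in> space (graph_configs E)" and d: "distinct_times E \<omega>"
    and T: "finite T" "T \<noteq> {}" "T \<subseteq> {0..<1}" "mark_times E \<omega> \<subseteq> T"
  shows "sliced_config V E T \<omega>"
  by unfold_locales (use d T in auto)

lemma mark_times_finite:
  assumes "finite E" "\<omega> \<in> space (graph_configs E)"
  shows "finite (mark_times E \<omega>)" "mark_times E \<omega> \<subseteq> {0..<1}"
proof -
  have \<omega>: "finite (\<omega> e)" "\<omega> e \<subseteq> {0..<1} \<times> UNIV" if "e \<in> E" for e
    using assms(2) that by (auto simp: space_graph_configs PiE_iff)
  show "finite (mark_times E \<omega>)" unfolding mark_times_Union using assms(1) \<omega>(1) by simp
  show "mark_times E \<omega> \<subseteq> {0..<1}" unfolding mark_times_Union using \<omega>(2) by fastforce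
qed

definition time_cell :: "nat \<Rightarrow> int \<Rightarrow> (real \<times> mark) set" where
  "time_cell k j = cell k j Cross \<union> cell k j Bar"

lemma mem_time_cell: "(s, m) \<in> time_cell k j \<longleftrightarrow> 0 \<le> s \<and> s < 1 \<and> \<lfloor>2 ^ k * s\<rfloor> = j"
  unfolding time_cell_def cell_def by (cases m) auto

text \<open>
  Two marks at one time are in one cell on every scale, whereas distinct times are separated by fine cells.
\<close>

lemma distinct_times_iff_cells:
  assumes E: "finite E" and \<omega>: "\<omega> \<in> space (graph_configs E)"
  shows "distinct_times E \<omega> \<longleftrightarrow> (\<exists>k. \<forall>j\<in>{0..<2 ^ k}. (\<Sum>e\<in>E. card (\<omega> e \<inter> time_cell k j)) \<le> 1)"
proof -
  have \<omega>e: "finite (\<omega> e)" "\<omega> e \<subseteq> {0..<1} \<times> UNIV" if "e \<in> E" for e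
    using \<omega> that by (auto simp: space_graph_configs PiE_iff)
  let ?S = "\<lambda>k j. SIGMA e:E. \<omega> e \<inter> time_cell k j"
  have fin: "finite (?S k j)" for k j using E \<omega>e by auto
  have card: "(\<Sum>e\<in>E. card (\<omega> e \<inter> time_cell k j)) \<le> 1 \<longleftrightarrow> (\<forall>p\<in>?S k j. \<forall>q\<in>?S k j. p = q)" for k j
  proof -
    have "card (?S k j) = (\<Sum>e\<in>E. card (\<omega> e \<inter> time_cell k j))"
      by (rule card_SigmaI) (use E \<omega>e in auto)
    then show ?thesis using card_le_Suc0_iff_eq[OF fin] by (metis One_nat_def)
  qed
  show ?thesis
    unfolding card
  proof
    assume d: "distinct_times E \<omega>"
    have "\<forall>\<^sub>F k in sequentially. inj_on (\<lambda>s. \<lfloor>2 ^ k * s :: real\<rfloor>) (mark_times E \<omega>)"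
      by (rule eventually_inj_on_floor) (rule mark_times_finite(1)[OF E \<omega>])
    then obtain k where inj: "inj_on (\<lambda>s. \<lfloor>2 ^ k * s :: real\<rfloor>) (mark_times E \<omega>)"
      using eventually_happens[of _ sequentially] by auto
    have "\<forall>j\<in>{0..<2 ^ k}. \<forall>p\<in>?S k j. \<forall>q\<in>?S k j. p = q"
    proof (intro ballI)
      fix j p q assume p: "p \<in> ?S k j" and q: "q \<in> ?S k j"
      obtain e s m where pp: "p = (e, (s, m))" by (metis prod_cases3)
      obtain e' s' m' where qq: "q = (e', (s', m'))" by (metis prod_cases3)
      have 1: "e \<in> E" "(s, m) \<in> \<omega> e" "(s, m) \<in> time_cell k j" using p pp by auto
      have 2: "e' \<in> E" "(s', m') \<in> \<omega> e'" "(s', m') \<in> time_cell k j" using q qq by auto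
      have "s \<in> mark_times E \<omega>" "s' \<in> mark_times E \<omega>" using 1 2 unfolding mark_times_def by auto
      moreover have "\<lfloor>2 ^ k * s\<rfloor> = \<lfloor>2 ^ k * s'\<rfloor>" using 1(3) 2(3) unfolding mem_time_cell by simp
      ultimately have "s = s'" using inj_onD[OF inj] by blast
      then have "e = e' \<and> m = m'" using d 1 2 unfolding distinct_times_def by blast
      then show "p = q" using pp qq \<open>s = s'\<close> by simp
    qed
    then show "\<exists>k. \<forall>j\<in>{0..<2 ^ k}. \<forall>p\<in>?S k j. \<forall>q\<in>?S k j. p = q" by blast
  next
    assume "\<exists>k. \<forall>j\<in>{0..<2 ^ k}. \<forall>p\<in>?S k j. \<forall>q\<in>?S k j. p = q"
    then obtain k where k: "\<forall>j\<in>{0..<2 ^ k}. \<forall>p\<in>?S k j. \<forall>q\<in>?S k j. p = q" ..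
    show "distinct_times E \<omega>"
      unfolding distinct_times_def
    proof (intro ballI allI impI)
      fix e e' s m m' assume e: "e \<in> E" "e' \<in> E" and s: "(s, m) \<in> \<omega> e \<and> (s, m') \<in> \<omega> e'"
      then have s01: "0 \<le> s" "s < 1" using \<omega>e(2)[OF e(1)] by auto
      have "(e, (s, m)) \<in> ?S k \<lfloor>2 ^ k * s\<rfloor>" "(e', (s, m')) \<in> ?S k \<lfloor>2 ^ k * s\<rfloor>"
        using e s s01 by (auto simp: mem_time_cell)
      then have "(e, (s, m)) = (e', (s, m'))"
        by (rule bspec[OF bspec[OF bspec[OF k cell_index_range[OF s01]]]])
      then show "e = e' \<and> m = m'" by simp
    qed
  qed
qed

lemma count_measurable:
  assumes e: "e \<in> E" and B: "B \<in> sets mark_space"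
  shows "(\<lambda>\<omega>. card (\<omega> e \<inter> B)) \<in> measurable (graph_configs E) (count_space UNIV)"
proof (rule measurable_compose[OF measurable_component_singleton[OF e]])
  show "(\<lambda>\<eta>. card (\<eta> \<inter> B)) \<in> measurable mark_configs (count_space UNIV)"
    unfolding measurable_count_space_eq2_countable
  proof (intro conjI ballI)
    fix k :: nat
    have "(\<lambda>\<eta>. card (\<eta> \<inter> B)) -` {k} \<inter> space mark_configs = {\<eta> \<in> space mark_configs. card (\<eta> \<inter> B) = k}"
      by auto
    then show "(\<lambda>\<eta>. card (\<eta> \<inter> B)) -` {k} \<inter> space mark_configs \<in> sets mark_configs"
      using sets_count_event[OF B] by simp
  qed auto
qed

lemma sets_distinct_times:
  assumes E: "finite E"
  shows "{\<omega> \<in> space (graph_configs E). distinct_times E \<omega>} \<in> sets (graph_configs E)"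
proof -
  have [measurable]: "(\<lambda>\<omega>. card (\<omega> e \<inter> time_cell k j)) \<in> measurable (graph_configs E) (count_space UNIV)" if "e \<in> E" for e k j
    by (rule count_measurable[OF that]) (unfold time_cell_def, intro sets.Un sets_cell)
  have sum: "{\<omega> \<in> space (graph_configs E). (\<Sum>e\<in>E. card (\<omega> e \<inter> time_cell k j)) \<le> 1} \<in> sets (graph_configs E)" for k j
    by measurable
  have "{\<omega> \<in> space (graph_configs E). distinct_times E \<omega>}
     = {\<omega> \<in> space (graph_configs E). \<exists>k. \<forall>j\<in>{0..<2 ^ k}. (\<Sum>e\<in>E. card (\<omega> e \<inter> time_cell k j)) \<le> 1}"
    using distinct_times_iff_cells[OF E] by blast
  also have "\<dots> \<in> sets (graph_configs E)"
    by (intro sets.sets_Collect_countable_Ex sets.sets_Collect_finite_All' sum) auto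
  finally show ?thesis .
qed

definition cell_pattern :: "'v set set \<Rightarrow> nat \<Rightarrow> 'v config \<Rightarrow> ('v set \<times> int \<times> mark) set" where
  "cell_pattern E k \<omega> = {(e, j, m) \<in> E \<times> {0..<2 ^ k} \<times> UNIV. \<omega> e \<inter> cell k j m \<noteq> {}}"

text \<open>
  The marks moved to the left ends of their cells.
\<close>

definition grid_config :: "nat \<Rightarrow> ('v set \<times> int \<times> mark) set \<Rightarrow> 'v config" where
  "grid_config k X = (\<lambda>e. {(of_int j / 2 ^ k, m) | j m. (e, j, m) \<in> X})"

lemma cell_pattern_measurable:
  fixes E :: "'v set set"
  assumes E: "finite E"
  shows "cell_pattern E k \<in> measurable (graph_configs E) (count_space (Pow (E \<times> {0..<2 ^ k :: int} \<times> (UNIV :: mark set))))"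
proof -
  let ?X = "E \<times> {0..<2 ^ k :: int} \<times> (UNIV :: mark set)"
  have fin: "finite ?X" using E finite_UNIV_mark by simp
  then have finP: "finite (Pow ?X)" by simp
  have void: "{\<omega> \<in> space (graph_configs E). \<omega> e \<inter> cell k j m = {}} \<in> sets (graph_configs E)" if e: "e \<in> E" for e j m
  proof -
    have "{\<omega> \<in> space (graph_configs E). \<omega> e \<inter> cell k j m = {}} = void_event E (\<lambda>e'. if e' = e then cell k j m else {})"
      unfolding void_event_def using e by auto
    also have "\<dots> \<in> sets (graph_configs E)"
      by (rule sets_graph_void_event[OF E]) (simp add: sets_cell)
    finally show ?thesis .
  qed
  show ?thesis
    unfolding measurable_count_space_eq2[OF finP]
  proof (intro conjI ballI)
    show "cell_pattern E k \<in> space (graph_configs E) \<rightarrow> Pow ?X" unfolding cell_pattern_def by auto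
    fix A assume A: "A \<in> Pow ?X"
    have "cell_pattern E k -` {A} \<inter> space (graph_configs E)
      = {\<omega> \<in> space (graph_configs E). \<forall>x\<in>?X. (case x of (e, j, m) \<Rightarrow> \<omega> e \<inter> cell k j m \<noteq> {}) \<longleftrightarrow> x \<in> A}"
    proof -
      have *: "{x \<in> X. Q x} = A \<longleftrightarrow> (\<forall>x\<in>X. Q x \<longleftrightarrow> x \<in> A)" if "A \<subseteq> X" for X Q and A :: "('v set \<times> int \<times> mark) set"
        using that by blast
      have **: "cell_pattern E k \<omega> = {x \<in> ?X. case x of (e, j, m) \<Rightarrow> \<omega> e \<inter> cell k j m \<noteq> {}}" for \<omega>
        unfolding cell_pattern_def by auto
      have "cell_pattern E k \<omega> = A \<longleftrightarrow> (\<forall>x\<in>?X. (case x of (e, j, m) \<Rightarrow> \<omega> e \<inter> cell k j m \<noteq> {}) \<longleftrightarrow> x \<in> A)" for \<omega>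
        unfolding ** by (rule *) (use A in simp)
      then show ?thesis by (simp only: vimage_def Int_def mem_Collect_eq singleton_iff conj_commute)
    qed
    also have "\<dots> \<in> sets (graph_configs E)"
    proof (cases "?X = {}")
      case False
      show ?thesis
      proof (rule sets.sets_Collect_finite_All'[OF _ fin False])
        fix x assume x: "x \<in> ?X"
        obtain e j m where xx: "x = (e, j, m)" by (metis prod_cases3)
        have v: "{\<omega> \<in> space (graph_configs E). \<omega> e \<inter> cell k j m = {}} \<in> sets (graph_configs E)"
          by (rule void) (use x xx in simp)
        show "{\<omega> \<in> space (graph_configs E). (case x of (e, j, m) \<Rightarrow> \<omega> e \<inter> cell k j m \<noteq> {}) \<longleftrightarrow> x \<in> A} \<in> sets (graph_configs E)"
          using v sets.sets_Collect_neg[OF v] unfolding xx by (cases "x \<in> A") (simp_all add: xx)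
      qed
    qed simp
    finally show "cell_pattern E k -` {A} \<inter> space (graph_configs E) \<in> sets (graph_configs E)" .
  qed
qed

context loop_graph
begin

lemma eventually_loop_number_grid:
  assumes \<omega>: "\<omega> \<in> space (graph_configs E)" and d: "distinct_times E \<omega>"
  shows "\<forall>\<^sub>F k in sequentially. loop_number V E (grid_config k (cell_pattern E k \<omega>)) = loop_number V E \<omega>"
proof -
  let ?T = "insert 0 (mark_times E \<omega>)"
  note mt = mark_times_finite[OF finite_edges \<omega>]
  have "\<forall>\<^sub>F k in sequentially. inj_on (\<lambda>s. \<lfloor>2 ^ k * s :: real\<rfloor>) ?T"
    by (rule eventually_inj_on_floor) (use mt in simp)
  then show ?thesis
  proof eventually_elim
    case (elim k)
    interpret S: sliced_config V E ?T \<omega> by (rule sliced_configI[OF \<omega> d]) (use mt in auto)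
    let ?\<phi> = "\<lambda>s::real. of_int \<lfloor>2 ^ k * s\<rfloor> / 2 ^ k :: real"
    have T01: "0 \<le> s" "s < 1" if "s \<in> ?T" for s using that mt(2) by auto
    show ?case
    proof (rule S.loop_number_time_change)
      show "strict_mono_on ?T ?\<phi>"
      proof (rule strict_mono_onI)
        fix r s assume rs: "r \<in> ?T" "s \<in> ?T" "r < s"
        have "\<lfloor>2 ^ k * r\<rfloor> \<le> \<lfloor>2 ^ k * s\<rfloor>" using rs by (intro floor_mono) simp
        moreover have "\<lfloor>2 ^ k * r\<rfloor> \<noteq> \<lfloor>2 ^ k * s\<rfloor>" using inj_onD[OF elim _ rs(1,2)] rs(3) by blast
        ultimately show "?\<phi> r < ?\<phi> s" by (simp add: divide_strict_right_mono)
      qed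
      show "?\<phi> ` ?T \<subseteq> {0..<1}"
      proof
        fix y assume "y \<in> ?\<phi> ` ?T"
        then obtain s where s: "s \<in> ?T" "y = ?\<phi> s" by blast
        have j: "\<lfloor>2 ^ k * s\<rfloor> \<in> {0..<2 ^ k}" by (rule cell_index_range[OF T01[OF s(1)]])
        then have "real_of_int \<lfloor>2 ^ k * s\<rfloor> < real_of_int (2 ^ k)" by (subst of_int_less_iff) simp
        then show "y \<in> {0..<1}" using j unfolding s(2) by simp
      qed
      fix e assume e: "e \<in> E"
      have \<omega>e: "\<omega> e \<subseteq> {0..<1} \<times> UNIV" using \<omega> e by (auto simp: space_graph_configs PiE_iff)
      show "grid_config k (cell_pattern E k \<omega>) e = map_prod ?\<phi> id ` \<omega> e"
      proof (intro equalityI subsetI)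
        fix p assume "p \<in> grid_config k (cell_pattern E k \<omega>) e"
        then obtain j m where jm: "p = (of_int j / 2 ^ k, m)" "\<omega> e \<inter> cell k j m \<noteq> {}"
          unfolding grid_config_def cell_pattern_def by auto
        then obtain s where "(s, m) \<in> \<omega> e" "\<lfloor>2 ^ k * s\<rfloor> = j" unfolding cell_def by auto
        then show "p \<in> map_prod ?\<phi> id ` \<omega> e" unfolding jm(1) by (intro image_eqI[of _ _ "(s, m)"]) auto
      next
        fix p assume "p \<in> map_prod ?\<phi> id ` \<omega> e"
        then obtain s m where sm: "(s, m) \<in> \<omega> e" "p = (?\<phi> s, m)" by auto
        then have s: "0 \<le> s" "s < 1" using \<omega>e by auto
        have "(s, m) \<in> \<omega> e \<inter> cell k \<lfloor>2 ^ k * s\<rfloor> m" using sm s unfolding cell_def by auto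
        then have "(e, \<lfloor>2 ^ k * s\<rfloor>, m) \<in> cell_pattern E k \<omega>"
          unfolding cell_pattern_def using e cell_index_range[OF s] by auto
        then show "p \<in> grid_config k (cell_pattern E k \<omega>) e" unfolding grid_config_def sm(2) by blast
      qed
    qed
  qed
qed

text \<open>
  Extension by 0 beyond the sample space of \<open>config_law\<close>, so that it can be integrated against the full product law.
\<close>

definition loop_functional :: "(nat \<Rightarrow> real) \<Rightarrow> 'v config \<Rightarrow> real" where
  "loop_functional g \<omega> = (if distinct_times E \<omega> then g (loop_number V E \<omega>) else 0)"

lemma loop_functional_measurable: "loop_functional g \<in> borel_measurable (graph_configs E)"
proof (rule borel_measurable_LIMSEQ_real)
  let ?f = "\<lambda>k \<omega>. if distinct_times E \<omega> then g (loop_number V E (grid_config k (cell_pattern E k \<omega>))) else 0"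
  show "?f k \<in> borel_measurable (graph_configs E)" for k
  proof (rule measurable_If)
    show "(\<lambda>\<omega>. g (loop_number V E (grid_config k (cell_pattern E k \<omega>)))) \<in> borel_measurable (graph_configs E)"
      by (rule measurable_compose[OF cell_pattern_measurable[OF finite_edges]]) simp
  qed (use sets_distinct_times[OF finite_edges] in auto)
  fix \<omega> assume \<omega>: "\<omega> \<in> space (graph_configs E)"
  show "(\<lambda>k. ?f k \<omega>) \<longlonglongrightarrow> loop_functional g \<omega>"
  proof (cases "distinct_times E \<omega>")
    case True
    have "\<forall>\<^sub>F k in sequentially. ?f k \<omega> = loop_functional g \<omega>"
      using eventually_loop_number_grid[OF \<omega> True] by eventually_elim (simp add: loop_functional_def True)
    then show ?thesis by (rule tendsto_eventually)
  qed (simp add: loop_functional_def)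
qed

lemma loop_number_cong:
  assumes \<omega>: "\<omega> \<in> space (graph_configs E)" and d: "distinct_times E \<omega>"
    and eq: "\<And>e. e \<in> E \<Longrightarrow> \<omega>' e = \<omega> e"
  shows "loop_number V E \<omega>' = loop_number V E \<omega>"
proof -
  interpret S: sliced_config V E "insert 0 (mark_times E \<omega>)" \<omega>
    by (rule sliced_configI[OF \<omega> d]) (use mark_times_finite[OF finite_edges \<omega>] in auto)
  show ?thesis
    by (rule S.loop_number_time_change[of id])
       (use eq mark_times_finite[OF finite_edges \<omega>] in \<open>auto simp: strict_mono_on_def map_prod.id\<close>)
qed

end


section \<open>The derivative of a function of the loop number\<close>

lemma distinct_times_cong:
  assumes "\<And>e. e \<in> E \<Longrightarrow> \<omega>' e = \<omega> e"
  shows "distinct_times E \<omega>' \<longleftrightarrow> distinct_times E \<omega>"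
  using assms unfolding distinct_times_def by simp

lemma AE_circle_notin_finite: "finite S \<Longrightarrow> AE s in circle. s \<notin> S"
proof -
  assume "finite S"
  then have "AE s in lborel. s \<notin> S" by (intro AE_not_in finite_imp_null_set_lborel)
  then show ?thesis unfolding circle_def by (subst AE_restrict_space_iff) (auto elim!: eventually_mono)
qed

lemma integral_config_law:
  fixes f :: "'v config \<Rightarrow> real"
  assumes E: "finite E" and P: "sets P = sets mark_configs"
  shows "(LINT \<omega>|config_law E P. f \<omega>) = (LINT \<omega>|(\<Pi>\<^sub>M e\<in>E. P). (if distinct_times E \<omega> then f \<omega> else 0))"
    and "(\<lambda>\<omega>. (if distinct_times E \<omega> then f \<omega> else 0)) \<in> borel_measurable (graph_configs E) \<Longrightarrow> f \<in> borel_measurable (config_law E P)"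
proof -
  have sets: "sets (\<Pi>\<^sub>M e\<in>E. P) = sets (graph_configs E)" by (rule sets_PiM_cong[OF refl P])
  have "{\<omega>. distinct_times E \<omega>} \<inter> space (\<Pi>\<^sub>M e\<in>E. P) = {\<omega> \<in> space (graph_configs E). distinct_times E \<omega>}"
    using sets_eq_imp_space_eq[OF sets] by blast
  then have D: "{\<omega>. distinct_times E \<omega>} \<inter> space (\<Pi>\<^sub>M e\<in>E. P) \<in> sets (\<Pi>\<^sub>M e\<in>E. P)"
    using sets_distinct_times[OF E] sets by simp
  have ind: "(\<lambda>\<omega>. indicator {\<omega>. distinct_times E \<omega>} \<omega> *\<^sub>R f \<omega>) = (\<lambda>\<omega>. (if distinct_times E \<omega> then f \<omega> else 0))"
    by (auto simp: indicator_def)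
  show "(LINT \<omega>|config_law E P. f \<omega>) = (LINT \<omega>|(\<Pi>\<^sub>M e\<in>E. P). (if distinct_times E \<omega> then f \<omega> else 0))"
    unfolding config_law_def integral_restrict_space[OF D] ind ..
  assume "(\<lambda>\<omega>. (if distinct_times E \<omega> then f \<omega> else 0)) \<in> borel_measurable (graph_configs E)"
  then show "f \<in> borel_measurable (config_law E P)"
    unfolding config_law_def borel_measurable_restrict_space_iff[OF D] ind
    by (simp cong: measurable_cong_sets add: sets)
qed

locale random_loops = loop_graph V E + graph_sampling u E
  for V :: "'v set" and E and u

context random_loops
begin

lemma loop_functional_le:
  assumes g: "\<And>k. \<bar>g k\<bar> \<le> C * c ^ k" and C: "0 \<le> C" "1 \<le> c"
    and \<omega>: "\<omega> \<in> space (graph_configs E)" and n: "card (mark_times E \<omega>) \<le> n"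
  shows "\<bar>loop_functional g \<omega>\<bar> \<le> C * c ^ (2 * card V * (n + 1))"
proof (cases "distinct_times E \<omega>")
  case True
  note mt = mark_times_finite[OF finite_edges \<omega>]
  interpret S: sliced_config V E "insert 0 (mark_times E \<omega>)" \<omega>
    by (rule sliced_configI[OF \<omega> True]) (use mt in auto)
  have "card (insert 0 (mark_times E \<omega>)) \<le> n + 1" using n card_insert_le_m1[of "n + 1" "mark_times E \<omega>" 0] by simp
  then have "loop_number V E \<omega> \<le> 2 * card V * (n + 1)"
    using S.loop_number_le by (meson le_trans mult_le_mono2)
  then have "c ^ loop_number V E \<omega> \<le> c ^ (2 * card V * (n + 1))" by (rule power_increasing[OF _ C(2)])
  then have "C * c ^ loop_number V E \<omega> \<le> C * c ^ (2 * card V * (n + 1))" using C(1) by (rule mult_left_mono)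
  then show ?thesis using g[of "loop_number V E \<omega>"] True unfolding loop_functional_def by simp
qed (use C in \<open>simp add: loop_functional_def\<close>)

lemma loop_functional_bounded:
  assumes g: "\<And>k. \<bar>g k\<bar> \<le> C * c ^ k" and C: "0 \<le> C" "1 \<le> c"
  shows "geometrically_bounded (loop_functional g)"
proof -
  let ?d = "c ^ (2 * card V)"
  have "\<bar>loop_functional g (edge_marks n x)\<bar> \<le> (C * ?d) * ?d ^ n" if x: "x \<in> space point_seqs" for n x
  proof -
    have "mark_times E (edge_marks n x) \<subseteq> (\<lambda>i. fst (snd (x i))) ` {..<n}"
      unfolding mark_times_def edge_marks_def by force
    then have "card (mark_times E (edge_marks n x)) \<le> n"
      using surj_card_le[of "{..<n}"] by fastforce
    from loop_functional_le[OF g C edge_marks_space[OF x] this] show ?thesis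
      unfolding power_mult[of c "2 * card V" "n + 1"] by simp
  qed
  moreover have "1 \<le> ?d" using C(2) by (rule one_le_power)
  ultimately show ?thesis unfolding geometrically_bounded_def
    by (intro exI[of _ "C * ?d"] exI[of _ ?d]) (use C in auto)
qed

lemma insert_point_add_mark: "e' \<in> E \<Longrightarrow> add_mark e p \<omega> e' = insert_point (e, p) \<omega> e'"
  by (simp add: add_mark_def insert_point_def)

lemma insert_point_not_distinct:
  assumes "\<not> distinct_times E \<omega>"
  shows "\<not> distinct_times E (insert_point y \<omega>)"
proof -
  have "\<omega> e \<subseteq> insert_point y \<omega> e" if "e \<in> E" for e using that unfolding insert_point_def by auto
  then show ?thesis using assms unfolding distinct_times_def by (metis (full_types) subsetD)
qed

lemma loop_functional_insert_measurable:
  assumes \<omega>: "\<omega> \<in> space (graph_configs E)" and e: "e \<in> E"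
  shows "(\<lambda>y. loop_functional g (insert_point y \<omega>)) \<in> borel_measurable point_law"
    and "(\<lambda>p. loop_functional g (insert_point (e, p) \<omega>)) \<in> borel_measurable mark_space"
proof -
  show 1: "(\<lambda>y. loop_functional g (insert_point y \<omega>)) \<in> borel_measurable point_law"
    using measurable_compose[OF measurable_Pair1'[OF \<omega>] measurable_compose[OF insert_point_measurable loop_functional_measurable]]
    by simp
  have "Pair e \<in> measurable mark_space (count_space UNIV \<Otimes>\<^sub>M mark_space)" by simp
  then have "Pair e \<in> measurable mark_space point_law"
    by (simp cong: measurable_cong_sets add: sets_point_law)
  from measurable_compose[OF this 1]
  show "(\<lambda>p. loop_functional g (insert_point (e, p) \<omega>)) \<in> borel_measurable mark_space" .
qed

context
  fixes \<omega> :: "'v config"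
  assumes \<omega>: "\<omega> \<in> space (graph_configs E)" and d: "distinct_times E \<omega>"
begin

lemma sliced_at:
  assumes "0 \<le> s" "s < 1"
  shows "sliced_config V E (insert s (mark_times E \<omega>)) \<omega>"
  by (rule sliced_configI[OF \<omega> d]) (use mark_times_finite[OF finite_edges \<omega>] assms in auto)

lemma edge_doubleton:
  assumes "e \<in> E" obtains a b where "e = {a, b}" "a \<noteq> b"
  using edges assms by (metis card_2_iff)

lemma loop_functional_insert:
  assumes e: "e \<in> E" and s: "0 \<le> s" "s < 1" "s \<notin> mark_times E \<omega>"
  shows "loop_functional g (insert_point (e, (s, m)) \<omega>) = g (loop_number V E (add_mark e (s, m) \<omega>))"
proof -
  interpret S: sliced_config V E "insert s (mark_times E \<omega>)" \<omega> by (rule sliced_at[OF s(1,2)])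
  obtain a b where ab: "e = {a, b}" "a \<noteq> b" using edge_doubleton[OF e] .
  interpret S': sliced_config V E "insert s (mark_times E \<omega>)" "add_mark e (s, m) \<omega>"
    by (rule S.add_mark_sliced[OF e ab _ s(3)]) simp
  have sp: "insert_point (e, (s, m)) \<omega> \<in> space (graph_configs E)"
    by (rule insert_point_space[OF _ \<omega>]) (use s in \<open>simp add: space_point_law\<close>)
  have dd: "distinct_times E (insert_point (e, (s, m)) \<omega>)"
    using S'.distinct distinct_times_cong[of E "add_mark e (s, m) \<omega>", OF insert_point_add_mark] by blast
  show ?thesis
    unfolding loop_functional_def using dd loop_number_cong[OF sp dd insert_point_add_mark] by simp
qed

lemma I_integrable:
  assumes e: "e \<in> E"
  shows "integrable circle (I_plus V E \<omega> e)" "integrable circle (I_minus V E \<omega> e)"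
proof -
  let ?h = "\<lambda>m s. loop_functional real (insert_point (e, (s, m)) \<omega>)"
  have h: "?h m \<in> borel_measurable circle" for m
    by (rule measurable_compose[OF _ loop_functional_insert_measurable(2)[OF \<omega> e], of "\<lambda>s. (s, m)"])
       (simp add: mark_space_def)
  have reg: "Measurable.pred circle (\<lambda>s. s \<notin> mark_times E \<omega>)"
  proof -
    have "mark_times E \<omega> \<in> sets circle"
      using mark_times_finite[OF finite_edges \<omega>] by (intro sets_circleI) (auto intro: finite_imp_closed borel_closed)
    then show ?thesis by (simp add: pred_def[symmetric])
  qed
  have cases: "I_plus V E \<omega> e s = of_bool (s \<notin> mark_times E \<omega> \<and> ?h Cross s = real (loop_number V E \<omega> + 1)) \<and>
      I_minus V E \<omega> e s = of_bool (s \<notin> mark_times E \<omega> \<and> ?h Bar s = real (loop_number V E \<omega> + 1))"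
    if "s \<in> space circle" for s
  proof (cases "s \<in> mark_times E \<omega>")
    case True
    then show ?thesis unfolding I_plus_def I_minus_def by simp
  next
    case False
    have s: "0 \<le> s" "s < 1" using that unfolding space_circle by auto
    interpret S: sliced_config V E "insert s (mark_times E \<omega>)" \<omega> by (rule sliced_at[OF s])
    obtain a b where ab: "e = {a, b}" "a \<noteq> b" using edge_doubleton[OF e] .
    show ?thesis
      using S.loop_number_add_mark_cases[OF e ab _ False] False
      unfolding loop_functional_insert[OF e s False] by auto
  qed
  have meas: "f \<in> borel_measurable circle"
    if "\<And>s. s \<in> space circle \<Longrightarrow> f s = of_bool (s \<notin> mark_times E \<omega> \<and> ?h m s = real (loop_number V E \<omega> + 1))"
    for f :: "real \<Rightarrow> real" and m
  proof (subst measurable_cong[OF that])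
    show "(\<lambda>s. of_bool (s \<notin> mark_times E \<omega> \<and> ?h m s = real (loop_number V E \<omega> + 1)) :: real) \<in> borel_measurable circle"
      using reg h[of m] by measurable
  qed
  have [measurable]: "I_plus V E \<omega> e \<in> borel_measurable circle" "I_minus V E \<omega> e \<in> borel_measurable circle"
    by (rule meas[of _ Cross], use cases in blast) (rule meas[of _ Bar], use cases in blast)
  show "integrable circle (I_plus V E \<omega> e)" "integrable circle (I_minus V E \<omega> e)"
    by (rule circle.integrable_const_bound[where B = 1]; simp add: I_plus_def I_minus_def)+
qed

text \<open>
  For almost every time \<open>s\<close> the three cases of \<open>loop_number_add_mark_cases\<close> apply. If neither indicator is 1,
  the loop number is at least 1 before the merger, so \<open>down\<close> can be used at its predecessor.
\<close>

lemma insertion_mean_loop_functional: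
  assumes g: "\<And>k. \<bar>g k\<bar> \<le> C * c ^ k" and C: "0 \<le> C" "1 \<le> c"
    and up: "\<And>k. g (Suc k) - g k = \<theta> * \<psi> k" and down: "\<And>k. g (Suc k) - g k = \<psi> (Suc k)"
  shows "card E * (insertion_mean (loop_functional g) \<omega> - loop_functional g \<omega>)
    = \<psi> (loop_number V E \<omega>) * ((1 + \<theta> * u) * J_plus V E \<omega> + (1 + \<theta> * (1 - u)) * J_minus V E \<omega> - card E)"
proof -
  let ?F = "loop_functional g" and ?l = "loop_number V E \<omega>"
  note mt = mark_times_finite[OF finite_edges \<omega>]
  define B where "B = C * c ^ (2 * card V * (card (mark_times E \<omega>) + 1 + 1))"
  have B: "\<bar>?F (insert_point y \<omega>)\<bar> \<le> B" if y: "y \<in> space point_law" for y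
    unfolding B_def
  proof (rule loop_functional_le[OF g C insert_point_space[OF y \<omega>]])
    have "mark_times E (insert_point y \<omega>) \<subseteq> insert (fst (snd y)) (mark_times E \<omega>)"
      unfolding mark_times_def insert_point_def by (cases y; cases "snd y") (auto split: if_splits)
    then have "card (mark_times E (insert_point y \<omega>)) \<le> card (insert (fst (snd y)) (mark_times E \<omega>))"
      using mt(1) by (intro card_mono) auto
    also have "\<dots> \<le> card (mark_times E \<omega>) + 1" by (simp add: card_insert_if mt(1))
    finally show "card (mark_times E (insert_point y \<omega>)) \<le> card (mark_times E \<omega>) + 1" .
  qed
  obtain e0 where e0: "e0 \<in> E" using E_ne by blast
  have "integrable point_law (\<lambda>y. ?F (insert_point y \<omega>))"
    by (rule point.integrable_const_bound[where B = B])
       (use B loop_functional_insert_measurable(1)[OF \<omega> e0] in \<open>auto intro!: AE_I2\<close>)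
  then have "insertion_mean ?F \<omega> = (LINT e|measure_pmf (pmf_of_set E). LINT p|mark_distribution. ?F (insert_point (e, p) \<omega>))"
    unfolding insertion_mean_def point_law_def by (rule edge_mark.integral_fst'[symmetric])
  also have "\<dots> = (\<Sum>e\<in>E. LINT p|mark_distribution. ?F (insert_point (e, p) \<omega>)) / card E"
    by (rule integral_pmf_of_set[OF E_ne finite_edges])
  finally have mean: "card E * insertion_mean ?F \<omega> = (\<Sum>e\<in>E. LINT p|mark_distribution. ?F (insert_point (e, p) \<omega>))"
    using E_ne finite_edges by simp
  let ?I = "\<lambda>e. (1 + \<theta> * u) * (LINT s|circle. I_plus V E \<omega> e s) + (1 + \<theta> * (1 - u)) * (LINT s|circle. I_minus V E \<omega> e s) - 1"
  have edge: "(LINT p|mark_distribution. ?F (insert_point (e, p) \<omega>)) = g ?l + \<psi> ?l * ?I e" if e: "e \<in> E" for e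
  proof -
    note meas = loop_functional_insert_measurable(2)[OF \<omega> e, of g]
    have bd: "\<bar>?F (insert_point (e, (s, m)) \<omega>)\<bar> \<le> B" if "0 \<le> s" "s < 1" for s m
      by (rule B) (use that in \<open>simp add: space_point_law\<close>)
    note Ii = I_integrable[OF e]
    have "(LINT p|mark_distribution. ?F (insert_point (e, p) \<omega>))
      = (LINT s|circle. u * ?F (insert_point (e, (s, Cross)) \<omega>) + (1 - u) * ?F (insert_point (e, (s, Bar)) \<omega>))"
      by (rule integral_mark_distribution(1)[OF meas bd])
    also have "\<dots> = (LINT s|circle. g ?l + \<psi> ?l * ((1 + \<theta> * u) * I_plus V E \<omega> e s + (1 + \<theta> * (1 - u)) * I_minus V E \<omega> e s - 1))"
    proof (rule integral_cong_AE)
      show "(\<lambda>s. u * ?F (insert_point (e, (s, Cross)) \<omega>) + (1 - u) * ?F (insert_point (e, (s, Bar)) \<omega>)) \<in> borel_measurable circle"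
        using integral_mark_distribution(2)[OF meas bd, THEN borel_measurable_integrable] by simp
      show "(\<lambda>s. g ?l + \<psi> ?l * ((1 + \<theta> * u) * I_plus V E \<omega> e s + (1 + \<theta> * (1 - u)) * I_minus V E \<omega> e s - 1)) \<in> borel_measurable circle"
        using Ii[THEN borel_measurable_integrable] by simp
      have "AE s in circle. s \<in> space circle \<and> s \<notin> mark_times E \<omega>"
        using AE_circle_notin_finite[OF mt(1)] by (simp add: AE_space)
      then show "AE s in circle. u * ?F (insert_point (e, (s, Cross)) \<omega>) + (1 - u) * ?F (insert_point (e, (s, Bar)) \<omega>)
          = g ?l + \<psi> ?l * ((1 + \<theta> * u) * I_plus V E \<omega> e s + (1 + \<theta> * (1 - u)) * I_minus V E \<omega> e s - 1)"
      proof eventually_elim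
        case (elim s)
        then have s: "0 \<le> s" "s < 1" "s \<notin> mark_times E \<omega>" unfolding space_circle by auto
        interpret S: sliced_config V E "insert s (mark_times E \<omega>)" \<omega> by (rule sliced_at[OF s(1,2)])
        obtain a b where ab: "e = {a, b}" "a \<noteq> b" using edge_doubleton[OF e] .
        let ?x = "loop_number V E (add_mark e (s, Cross) \<omega>)" and ?y = "loop_number V E (add_mark e (s, Bar) \<omega>)"
        consider
            "I_plus V E \<omega> e s = 1" "I_minus V E \<omega> e s = 0" "?x = Suc ?l" "?y = ?l"
          | "I_plus V E \<omega> e s = 0" "I_minus V E \<omega> e s = 1" "?x = ?l" "?y = Suc ?l"
          | k where "I_plus V E \<omega> e s = 0" "I_minus V E \<omega> e s = 0" "?l = Suc k" "?x = k" "?y = k"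
          using S.loop_number_add_mark_cases[OF e ab _ s(3)] by auto
        moreover have "g (Suc ?l) = g ?l + \<theta> * \<psi> ?l" using up[of ?l] by simp
        moreover have "g k = g ?l - \<psi> ?l" if "?l = Suc k" for k using down[of k] that by simp
        ultimately show ?case
          unfolding loop_functional_insert[OF e s] by cases (simp_all add: algebra_simps)
      qed
    qed
    also have "\<dots> = g ?l + \<psi> ?l * ?I e"
      using Ii circle.prob_space by simp
    finally show ?thesis .
  qed
  have F: "?F \<omega> = g ?l" unfolding loop_functional_def using d by simp
  have "card E * (insertion_mean ?F \<omega> - ?F \<omega>) = card E * insertion_mean ?F \<omega> - card E * g ?l"
    by (simp only: right_diff_distrib F)
  also have "card E * insertion_mean ?F \<omega> = (\<Sum>e\<in>E. g ?l + \<psi> ?l * ?I e)"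
    unfolding mean by (rule sum.cong[OF refl edge])
  also have "(\<Sum>e\<in>E. g ?l + \<psi> ?l * ?I e) - card E * g ?l = (\<Sum>e\<in>E. \<psi> ?l * ?I e)"
    by (simp add: sum.distrib)
  also have "\<dots> = \<psi> ?l * (\<Sum>e\<in>E. ?I e)"
    by (rule sum_distrib_left[symmetric])
  also have "(\<Sum>e\<in>E. ?I e) = (1 + \<theta> * u) * J_plus V E \<omega> + (1 + \<theta> * (1 - u)) * J_minus V E \<omega> - card E"
    unfolding J_plus_def J_minus_def by (simp add: sum.distrib sum_subtractf sum_distrib_left)
  finally show ?thesis .
qed

end

abbreviation J_observable :: "real \<Rightarrow> 'v config \<Rightarrow> real" where
  "J_observable \<theta> \<omega> \<equiv> (1 + \<theta> * u) * J_plus V E \<omega> + (1 + \<theta> * (1 - u)) * J_minus V E \<omega> - card E"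

text \<open>
  Apart from the constant functions, with \<open>\<psi> = 0\<close>, the conditions \<open>up\<close> and \<open>down\<close> are met by \<open>g k = \<theta> ^ k\<close> with
  \<open>\<psi> k = \<theta> ^ k * (\<theta> - 1) / \<theta>\<close> and, if \<open>\<theta> = 1\<close>, by \<open>g k = k\<close> with \<open>\<psi> k = 1\<close>.
\<close>

context
  fixes g \<psi> :: "nat \<Rightarrow> real" and C c \<theta> :: real
  assumes g: "\<And>k. \<bar>g k\<bar> \<le> C * c ^ k" and C: "0 \<le> C" "1 \<le> c"
    and up: "\<And>k. g (Suc k) - g k = \<theta> * \<psi> k" and down: "\<And>k. g (Suc k) - g k = \<psi> (Suc k)"
begin

lemma insertion_mean_difference:
  assumes \<omega>: "\<omega> \<in> space (graph_configs E)"
  shows "card E * (insertion_mean (loop_functional g) \<omega> - loop_functional g \<omega>)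
    = (if distinct_times E \<omega> then \<psi> (loop_number V E \<omega>) * J_observable \<theta> \<omega> else 0)"
proof (cases "distinct_times E \<omega>")
  case True
  then show ?thesis using insertion_mean_loop_functional[OF \<omega> True g C up down] by simp
next
  case False
  then show ?thesis
    unfolding insertion_mean_def loop_functional_def using insert_point_not_distinct[OF False] by simp
qed

lemma weighted_J_measurable:
  assumes P: "sets P = sets mark_configs"
  shows "(\<lambda>\<omega>. \<psi> (loop_number V E \<omega>) * J_observable \<theta> \<omega>) \<in> borel_measurable (config_law E P)"
proof (rule integral_config_law(2)[OF finite_edges P])
  have "(\<lambda>\<omega>. card E * (insertion_mean (loop_functional g) \<omega> - loop_functional g \<omega>)) \<in> borel_measurable (graph_configs E)"
    using insertion_mean_measurable[OF loop_functional_measurable] loop_functional_measurable by simp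
  then show "(\<lambda>\<omega>. (if distinct_times E \<omega> then \<psi> (loop_number V E \<omega>) * J_observable \<theta> \<omega> else 0)) \<in> borel_measurable (graph_configs E)"
    by (rule measurable_cong[THEN iffD1, rotated]) (rule insertion_mean_difference)
qed

lemma derivative_of_loop_functional:
  assumes P: "\<And>\<tau>. 0 \<le> \<tau> \<Longrightarrow> poisson_process_law (mark_intensity \<tau> u) (P \<tau>)" and t: "0 \<le> t"
  shows "((\<lambda>\<tau>. LINT \<omega>|config_law E (P \<tau>). g (loop_number V E \<omega>)) has_real_derivative
     (LINT \<omega>|config_law E (P t). \<psi> (loop_number V E \<omega>) * J_observable \<theta> \<omega>)) (at t within {0..})"
proof -
  have sets: "sets (P \<tau>) = sets mark_configs" if "0 \<le> \<tau>" for \<tau>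
    using P[OF that] unfolding poisson_process_law_def configurations_mark_intensity by blast
  have law: "(LINT \<omega>|config_law E (P \<tau>). g (loop_number V E \<omega>)) = (LINT \<omega>|(\<Pi>\<^sub>M e\<in>E. P \<tau>). loop_functional g \<omega>)" if "0 \<le> \<tau>" for \<tau>
    unfolding integral_config_law(1)[OF finite_edges sets[OF that]] loop_functional_def ..
  have "((\<lambda>\<tau>. LINT \<omega>|(\<Pi>\<^sub>M e\<in>E. P \<tau>). loop_functional g \<omega>) has_real_derivative
     card E * (LINT \<omega>|(\<Pi>\<^sub>M e\<in>E. P t). insertion_mean (loop_functional g) \<omega> - loop_functional g \<omega>)) (at t within {0..})"
    by (rule derivative_of_poisson_expectation[OF P t loop_functional_measurable loop_functional_bounded[OF g C]])
  also have "card E * (LINT \<omega>|(\<Pi>\<^sub>M e\<in>E. P t). insertion_mean (loop_functional g) \<omega> - loop_functional g \<omega>)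
      = (LINT \<omega>|(\<Pi>\<^sub>M e\<in>E. P t). card E * (insertion_mean (loop_functional g) \<omega> - loop_functional g \<omega>))"
    by simp
  also have "\<dots> = (LINT \<omega>|(\<Pi>\<^sub>M e\<in>E. P t). (if distinct_times E \<omega> then \<psi> (loop_number V E \<omega>) * J_observable \<theta> \<omega> else 0))"
  proof (rule Bochner_Integration.integral_cong[OF refl])
    fix \<omega> assume "\<omega> \<in> space (\<Pi>\<^sub>M e\<in>E. P t)"
    then have "\<omega> \<in> space (graph_configs E)"
      using sets_eq_imp_space_eq[OF sets_PiM_cong[OF refl[of E] sets[OF t]]] by blast
    then show "card E * (insertion_mean (loop_functional g) \<omega> - loop_functional g \<omega>)
      = (if distinct_times E \<omega> then \<psi> (loop_number V E \<omega>) * J_observable \<theta> \<omega> else 0)"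
      by (rule insertion_mean_difference)
  qed
  also have "\<dots> = (LINT \<omega>|config_law E (P t). \<psi> (loop_number V E \<omega>) * J_observable \<theta> \<omega>)"
    by (rule integral_config_law(1)[OF finite_edges sets[OF t], symmetric])
  finally show ?thesis
    by (rule has_field_derivative_transform_within[of _ _ _ _ 1]) (use t law in auto)
qed

end

section \<open>The weighted measure\<close>

lemma edge_marks_0: "distinct_times E (edge_marks 0 x)"
  unfolding distinct_times_def edge_marks_def by simp

text \<open>
  The empty configuration has positive probability, and it is the only one at intensity 0.
\<close>

lemma loop_expectation_empty_config:
  fixes g :: "nat \<Rightarrow> real"
  assumes g: "\<And>k. \<bar>g k\<bar> \<le> C * c ^ k" "\<And>k. 0 < g k" and C: "0 \<le> C" "1 \<le> c"
    and P: "poisson_process_law (mark_intensity \<tau> u) Q" and \<tau>: "0 \<le> \<tau>"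
  shows "0 < (LINT \<omega>|config_law E Q. g (loop_number V E \<omega>))"
    and "\<tau> = 0 \<Longrightarrow> (LINT \<omega>|config_law E Q. g (loop_number V E \<omega>)) = g (loop_number V E (\<lambda>e\<in>E. {}))"
proof -
  let ?f = "\<lambda>n. poisson_weight (\<tau> * card E) n * sample_mean (loop_functional g) n"
  have sets: "sets Q = sets mark_configs"
    using P unfolding poisson_process_law_def configurations_mark_intensity by blast
  have s: "?f sums (LINT \<omega>|config_law E Q. g (loop_number V E \<omega>))"
    unfolding integral_config_law(1)[OF finite_edges sets] 
    using integral_graph_law(2)[OF P \<tau> loop_functional_measurable loop_functional_bounded[OF g(1) C]]
    unfolding loop_functional_def .
  have e0: "edge_marks 0 x = (\<lambda>e\<in>E. {})" for x unfolding edge_marks_def by simp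
  have f0: "sample_mean (loop_functional g) 0 = g (loop_number V E (\<lambda>e\<in>E. {}))"
    using edge_marks_0 points.P.prob_space unfolding sample_mean_def loop_functional_def e0 by simp
  have nonneg: "0 \<le> ?f n" for n
  proof -
    have "0 \<le> loop_functional g \<omega>" for \<omega> unfolding loop_functional_def using g(2) by (simp add: less_imp_le)
    then have "0 \<le> sample_mean (loop_functional g) n" unfolding sample_mean_def by (intro integral_nonneg_AE) simp
    then show ?thesis using poisson_weight_nonneg[of "\<tau> * card E" n] \<tau> by simp
  qed
  have "0 < ?f 0" unfolding f0 using g(2) by (simp add: poisson_weight_def)
  also have "?f 0 = sum ?f {0}" by simp
  also have "\<dots> \<le> suminf ?f" by (rule sum_le_suminf[OF sums_summable[OF s]]) (use nonneg in auto)
  also have "suminf ?f = (LINT \<omega>|config_law E Q. g (loop_number V E \<omega>))" by (rule sums_unique[OF s, symmetric])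
  finally show "0 < (LINT \<omega>|config_law E Q. g (loop_number V E \<omega>))" .
  assume "\<tau> = 0"
  then have "?f = (\<lambda>n. if n = 0 then g (loop_number V E (\<lambda>e\<in>E. {})) else 0)"
    by (auto simp: poisson_weight_def f0)
  then have "?f sums g (loop_number V E (\<lambda>e\<in>E. {}))"
    using sums_single[of 0 "\<lambda>_. g (loop_number V E (\<lambda>e\<in>E. {}))"] by simp
  then show "(LINT \<omega>|config_law E Q. g (loop_number V E \<omega>)) = g (loop_number V E (\<lambda>e\<in>E. {}))"
    using sums_unique2[OF s] by simp
qed

text \<open>
  The total mass is the expectation of the constant 1, whose derivative in the intensity vanishes, and it is 1 at
  intensity 0. In other words, the mark times are almost surely distinct.
\<close>

lemma config_law_total_mass:
  assumes P: "\<And>\<tau>. 0 \<le> \<tau> \<Longrightarrow> poisson_process_law (mark_intensity \<tau> u) (P \<tau>)" and t: "0 \<le> t"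
  shows "partition_function V E (P t) 1 = 1"
proof -
  have d: "(partition_function V E (P x) 1) = (LINT \<omega>|config_law E (P x). 1)" for x
    unfolding partition_function_def by simp
  have "\<exists>c. \<forall>x\<in>{0..}. (LINT \<omega>|config_law E (P x). (1::real)) = c"
  proof (rule has_field_derivative_zero_constant)
    fix x :: real assume x: "x \<in> {0..}"
    show "((\<lambda>x. LINT \<omega>|config_law E (P x). (1::real)) has_real_derivative 0) (at x within {0..})"
      using derivative_of_loop_functional[of "\<lambda>_. 1" 1 1 0 "\<lambda>_. 0" P x] P x by simp
  qed simp
  moreover have "(LINT \<omega>|config_law E (P 0). (1::real)) = 1"
    by (rule loop_expectation_empty_config(2)[of "\<lambda>_. 1" 1 1 0 "P 0"]) (use P in auto)
  ultimately show ?thesis unfolding d using t by (metis atLeast_iff order_refl)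
qed

lemma loop_number_measurable:
  fixes g :: "nat \<Rightarrow> real"
  assumes P: "sets Q = sets mark_configs"
  shows "(\<lambda>\<omega>. g (loop_number V E \<omega>)) \<in> borel_measurable (config_law E Q)"
  by (rule integral_config_law(2)[OF finite_edges P])
     (use loop_functional_measurable[of g] in \<open>unfold loop_functional_def\<close>)

lemma weighted_expectation_eq:
  fixes f :: "'v config \<Rightarrow> real"
  assumes P: "sets Q = sets mark_configs" and \<theta>: "0 < \<theta>"
    and Z: "0 < partition_function V E Q \<theta>" and f: "f \<in> borel_measurable (config_law E Q)"
  shows "weighted_expectation V E Q \<theta> f
    = (LINT \<omega>|config_law E Q. \<theta> ^ loop_number V E \<omega> * f \<omega>) / partition_function V E Q \<theta>"
proof -
  let ?Z = "partition_function V E Q \<theta>"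
  have "(\<lambda>\<omega>. \<theta> ^ loop_number V E \<omega>) \<in> borel_measurable (config_law E Q)"
    by (rule loop_number_measurable[OF P])
  then have "weighted_expectation V E Q \<theta> f = (LINT \<omega>|config_law E Q. (\<theta> ^ loop_number V E \<omega> / ?Z) *\<^sub>R f \<omega>)"
    unfolding weighted_expectation_def weighted_law_def
    by (intro integral_density f) (use \<theta> Z in auto)
  also have "\<dots> = (LINT \<omega>|config_law E Q. \<theta> ^ loop_number V E \<omega> * f \<omega> / ?Z)" by simp
  also have "\<dots> = (LINT \<omega>|config_law E Q. \<theta> ^ loop_number V E \<omega> * f \<omega>) / ?Z" by (rule integral_divide_zero)
  finally show ?thesis .
qed

text \<open>
  The product of the observable with \<open>\<psi> \<lambda>\<close> is an effect of insertion, hence measurable, and for a suitable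
  choice of \<open>g\<close> the function \<open>\<psi>\<close> has no zeros.
\<close>

lemma J_observable_measurable:
  assumes P: "sets Q = sets mark_configs" and \<theta>: "0 < \<theta>"
  shows "J_observable \<theta> \<in> borel_measurable (config_law E Q)"
proof -
  obtain g \<psi> :: "nat \<Rightarrow> real" and C c where
    g: "\<And>k. \<bar>g k\<bar> \<le> C * c ^ k" "0 \<le> C" "1 \<le> c" "\<And>k. g (Suc k) - g k = \<theta> * \<psi> k" "\<And>k. g (Suc k) - g k = \<psi> (Suc k)"
    and \<psi>: "\<And>k. \<psi> k \<noteq> 0"
  proof (cases "\<theta> = 1")
    case True
    have "real k \<le> 2 ^ k" for k using of_nat_less_two_power[of k, where 'a = real] by simp
    then show ?thesis by (intro that[of real 1 2 "\<lambda>_. 1"]) (simp_all add: True)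
  next
    case False
    have "\<theta> ^ k \<le> max 1 \<theta> ^ k" for k using \<theta> by (intro power_mono) auto
    then show ?thesis
      using \<theta> False by (intro that[of "\<lambda>k. \<theta> ^ k" 1 "max 1 \<theta>" "\<lambda>k. \<theta> ^ k * (\<theta> - 1) / \<theta>"]) (simp_all add: field_simps)
  qed
  have "J_observable \<theta> = (\<lambda>\<omega>. \<psi> (loop_number V E \<omega>) * J_observable \<theta> \<omega> / \<psi> (loop_number V E \<omega>))"
    using \<psi> by simp
  also have "\<dots> \<in> borel_measurable (config_law E Q)" 
    by (rule borel_measurable_divide[OF weighted_J_measurable[OF g P] loop_number_measurable[OF P]])
  finally show ?thesis .
qed

end

lemma config_law_no_edges: "config_law ({} :: 'v set set) Q = count_space {\<lambda>_. undefined}"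
proof -
  have "{\<omega> :: 'v config. distinct_times {} \<omega>} = UNIV" unfolding distinct_times_def by simp
  then show ?thesis unfolding config_law_def PiM_empty restrict_count_space by simp
qed

theorem proposition3p4:
  fixes V :: "'v set" and E :: "'v set set"
    and P :: "real \<Rightarrow> (real \<times> mark) set measure"
    and u \<theta> t :: real
  assumes "finite V"
    and "\<forall>e\<in>E. e \<subseteq> V \<and> card e = 2"
    and "0 \<le> u" and "u \<le> 1"
    and "0 < \<theta>"
    and "\<forall>\<tau>\<ge>0. poisson_process_law (mark_intensity \<tau> u) (P \<tau>)"
    and "0 \<le> t"
  shows "\<exists>D.
     (if \<theta> = 1
      then ((\<lambda>\<tau>. weighted_expectation V E (P \<tau>) 1 (\<lambda>\<omega>. real (loop_number V E \<omega>)))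
              has_real_derivative D) (at t within {0..})
      else (\<exists>L. ((\<lambda>\<tau>. ln (partition_function V E (P \<tau>) \<theta>))
                   has_real_derivative L) (at t within {0..}) \<and>
                D = \<theta> / (\<theta> - 1) * L)) \<and>
     D = weighted_expectation V E (P t) \<theta>
           (\<lambda>\<omega>. (1 + \<theta> * u) * J_plus V E \<omega> + (1 + \<theta> * (1 - u)) * J_minus V E \<omega> - real (card E))"
proof (cases "E = {}")
  case True
  \<comment> \<open>There is only one configuration, so that nothing depends on the intensity.\<close>
  have J: "J_plus V {} = (\<lambda>_. 0)" "J_minus V {} = (\<lambda>_. 0)" unfolding J_plus_def J_minus_def by auto
  have "weighted_expectation V {} Q a (\<lambda>_. 0) = 0" for Q a unfolding weighted_expectation_def by simp
  moreover have "weighted_expectation V {} (P \<tau>) a f = weighted_expectation V {} (P t) a f"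
    "partition_function V {} (P \<tau>) a = partition_function V {} (P t) a" for \<tau> a f
    unfolding weighted_expectation_def weighted_law_def partition_function_def config_law_no_edges by simp_all
  then have "(\<lambda>\<tau>. weighted_expectation V {} (P \<tau>) a f) = (\<lambda>\<tau>. weighted_expectation V {} (P t) a f)"
    "(\<lambda>\<tau>. ln (partition_function V {} (P \<tau>) a)) = (\<lambda>\<tau>. ln (partition_function V {} (P t) a))" for a f
    by metis+
  ultimately show ?thesis unfolding True J by (auto intro!: exI[of _ 0] DERIV_const)
next
  case False
  interpret loop_graph V E by unfold_locales (use assms in auto)
  interpret random_loops V E u by unfold_locales (use assms False finite_edges in auto)
  have P: "poisson_process_law (mark_intensity \<tau> u) (P \<tau>)" if "0 \<le> \<tau>" for \<tau> using assms(6) that by blast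
  have sets: "sets (P \<tau>) = sets mark_configs" if "0 \<le> \<tau>" for \<tau>
    using P[OF that] unfolding poisson_process_law_def configurations_mark_intensity by blast
  note J = J_observable_measurable[OF sets \<open>0 < \<theta>\<close>]
  have bound: "\<bar>\<theta> ^ k\<bar> \<le> 1 * max 1 \<theta> ^ k" for k using \<open>0 < \<theta>\<close> by (simp add: power_mono)
  have Z: "0 < partition_function V E (P \<tau>) \<theta>" if "0 \<le> \<tau>" for \<tau>
    unfolding partition_function_def
    by (rule loop_expectation_empty_config(1)[OF bound _ _ _ P[OF that] that]) (use \<open>0 < \<theta>\<close> in auto)
  let ?R = "weighted_expectation V E (P t) \<theta> (J_observable \<theta>)"
  have R: "?R = (LINT \<omega>|config_law E (P t). \<theta> ^ loop_number V E \<omega> * J_observable \<theta> \<omega>) / partition_function V E (P t) \<theta>"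
    by (rule weighted_expectation_eq[OF sets[OF \<open>0 \<le> t\<close>] \<open>0 < \<theta>\<close> Z[OF \<open>0 \<le> t\<close>] J[OF \<open>0 \<le> t\<close>]])
  show ?thesis
  proof (cases "\<theta> = 1")
    case True
    have lam: "weighted_expectation V E (P \<tau>) 1 (\<lambda>\<omega>. real (loop_number V E \<omega>)) = (LINT \<omega>|config_law E (P \<tau>). real (loop_number V E \<omega>))"
      if \<tau>: "0 \<le> \<tau>" for \<tau>
      using weighted_expectation_eq[OF sets[OF \<tau>], of 1] config_law_total_mass[of P, OF P \<tau>]
        loop_number_measurable[OF sets[OF \<tau>], of real] by simp
    have "real k \<le> 2 ^ k" for k using of_nat_less_two_power[of k, where 'a = real] by simp
    then have "((\<lambda>\<tau>. LINT \<omega>|config_law E (P \<tau>). real (loop_number V E \<omega>)) has_real_derivative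
        (LINT \<omega>|config_law E (P t). 1 * J_observable \<theta> \<omega>)) (at t within {0..})"
      by (intro derivative_of_loop_functional[where C = 1 and c = 2 and \<psi> = "\<lambda>_. 1"]) (use P True \<open>0 \<le> t\<close> in auto)
    then have "((\<lambda>\<tau>. weighted_expectation V E (P \<tau>) 1 (\<lambda>\<omega>. real (loop_number V E \<omega>))) has_real_derivative
        (LINT \<omega>|config_law E (P t). 1 * J_observable \<theta> \<omega>)) (at t within {0..})"
      by (rule has_field_derivative_transform_within[of _ _ _ _ 1]) (use \<open>0 \<le> t\<close> lam in auto)
    moreover have "(LINT \<omega>|config_law E (P t). 1 * J_observable \<theta> \<omega>) = ?R"
      unfolding R using config_law_total_mass[of P, OF P \<open>0 \<le> t\<close>] True by simp
    ultimately show ?thesis using True by auto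
  next
    case False
    let ?X = "LINT \<omega>|config_law E (P t). \<theta> ^ loop_number V E \<omega> * J_observable \<theta> \<omega>"
    have "((\<lambda>\<tau>. partition_function V E (P \<tau>) \<theta>) has_real_derivative
        (LINT \<omega>|config_law E (P t). \<theta> ^ loop_number V E \<omega> * (\<theta> - 1) / \<theta> * J_observable \<theta> \<omega>)) (at t within {0..})"
      unfolding partition_function_def
      by (rule derivative_of_loop_functional[OF bound, where \<psi> = "\<lambda>k. \<theta> ^ k * (\<theta> - 1) / \<theta>"])
         (use P \<open>0 \<le> t\<close> \<open>0 < \<theta>\<close> in \<open>auto simp: field_simps\<close>)
    also have "(LINT \<omega>|config_law E (P t). \<theta> ^ loop_number V E \<omega> * (\<theta> - 1) / \<theta> * J_observable \<theta> \<omega>)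
        = (LINT \<omega>|config_law E (P t). (\<theta> - 1) / \<theta> * (\<theta> ^ loop_number V E \<omega> * J_observable \<theta> \<omega>))"
      by (simp add: mult_ac)
    also have "\<dots> = (\<theta> - 1) / \<theta> * ?X" by (rule integral_mult_right_zero)
    finally have "((\<lambda>\<tau>. ln (partition_function V E (P \<tau>) \<theta>)) has_real_derivative
        1 / partition_function V E (P t) \<theta> * ((\<theta> - 1) / \<theta> * ?X)) (at t within {0..})"
      by (rule DERIV_chain2[where f = ln and g = "\<lambda>\<tau>. partition_function V E (P \<tau>) \<theta>", OF DERIV_ln_divide[OF Z[OF \<open>0 \<le> t\<close>]]])
    moreover have "?R = \<theta> / (\<theta> - 1) * (1 / partition_function V E (P t) \<theta> * ((\<theta> - 1) / \<theta> * ?X))"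
    proof -
      have "\<theta> / (\<theta> - 1) * (1 / z * ((\<theta> - 1) / \<theta> * x)) = x / z" for x z :: real
        using False \<open>0 < \<theta>\<close> by simp
      then show ?thesis unfolding R by simp
    qed
    ultimately show ?thesis using False by auto
  qed
qed

end
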